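(* For every $(a;b)\in U^{o}$, $$Q(a;b)=3\left(s(a;b)+\frac{1}{4}S(a;b)\right).$$
   Context: Let $\mathfrak H$ be the upper half plane. For $\tau\in\mathfrak H$ let $q=e^{2\pi\sqrt{-1}\tau}$ and, with fractional powers $q^{r}=e^{2\pi\sqrt{-1}r\tau}$, let $\theta_1(z,\tau)=2\sum_{n\ge 0}(-1)^n q^{\frac12(n+\frac12)^2}\sin((2n+1)\pi z)$, $\theta_2(z,\tau)=2\sum_{n\ge 0} q^{\frac12(n+\frac12)^2}\cos((2n+1)\pi z)$, $\theta_3(z,\tau)=1+2\sum_{n\ge1}q^{\frac12 n^2}\cos(2n\pi z)$, $\theta_4(z,\tau)=1+2\sum_{n\ge1}(-1)^nq^{\frac12 n^2}\cos(2n\pi z)$. Put $k=\theta_2(0,\tau)^2/\theta_3(0,\tau)^2$, $\lambda(\tau)=k^2$, $K=\frac{\pi}{2}\theta_3(0,\tau)^2$. The Jacobi elliptic function $\mathrm{cs}=\mathrm{cn}/\mathrm{sn}$ satisfies $$\mathrm{cs}(2Kz,k)=\frac{\theta_4(0,\tau)}{\theta_3(0,\tau)}\,\frac{\theta_2(z,\tau)}{\theta_1(z,\tau)}.$$ Let $U^{o}=\{(a;b)\in(\mathbb Z\setminus\{0\})\times\mathbb Z_{>0} : \gcd(a,b)=1,\ a+b\text{ odd}\}$. The elliptic classical Dedekind sum is $$s_\tau(a;b)=\frac{1}{4b}\sum_{\substack{0\le\mu,\nu\le b-1\\(\mu,\nu)\ne(0,0)}}(-1)^{\mu}\,\mathrm{cs}\!\left(2Ka\tfrac{\mu\tau+\nu}{b},k\right)\mathrm{cs}\!\left(2K\tfrac{\mu\tau+\nu}{b},k\right),\qquad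 s_\tau(a;1)=0 .$$ For $(a;b)\in U^{o}$, $Q(a;b)$ denotes the unique rational number, independent of $\tau$ (its existence is a known fact), such that $s_\tau(a;b)=Q(a;b)\left(\frac13-\frac16\lambda(\tau)\right)$. The classical Dedekind sum is $s(a;b)=\frac{1}{4b}\sum_{\nu=1}^{b-1}\cot\left(\frac{\pi a\nu}{b}\right)\cot\left(\frac{\pi\nu}{b}\right)$, $s(a;1)=0$, and the Hardy–Berndt sum is $S(a;b)=\sum_{\mu=1}^{b-1}(-1)^{\mu+1+\lfloor a\mu/b\rfloor}$, where $\lfloor\cdot\rfloor$ is the floor function and empty sums are $0$. *)

theory Defs
  imports "HOL-Analysis.Analysis"
begin

definition qpow :: "complex \<Rightarrow> real \<Rightarrow> complex" where
  "qpow \<tau> r = exp (2 * of_real pi * \<i> * of_real r * \<tau>)"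

definition theta1 :: "complex \<Rightarrow> complex \<Rightarrow> complex" where
  "theta1 z \<tau> = 2 * (\<Sum>n. (-1) ^ n * qpow \<tau> (1/2 * (real n + 1/2)\<^sup>2)
                        * sin (of_nat (2 * n + 1) * of_real pi * z))"

definition theta2 :: "complex \<Rightarrow> complex \<Rightarrow> complex" where
  "theta2 z \<tau> = 2 * (\<Sum>n. qpow \<tau> (1/2 * (real n + 1/2)\<^sup>2)
                        * cos (of_nat (2 * n + 1) * of_real pi * z))"

text \<open>The sums over \<open>n \<ge> 1\<close> are indexed by \<open>Suc n\<close>.\<close>

definition theta3 :: "complex \<Rightarrow> complex \<Rightarrow> complex" where
  "theta3 z \<tau> = 1 + 2 * (\<Sum>n. qpow \<tau> (1/2 * (real (Suc n))\<^sup>2)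
                        * cos (of_nat (2 * Suc n) * of_real pi * z))"

definition theta4 :: "complex \<Rightarrow> complex \<Rightarrow> complex" where
  "theta4 z \<tau> = 1 + 2 * (\<Sum>n. (-1) ^ Suc n * qpow \<tau> (1/2 * (real (Suc n))\<^sup>2)
                        * cos (of_nat (2 * Suc n) * of_real pi * z))"

definition elliptic_k :: "complex \<Rightarrow> complex" where
  "elliptic_k \<tau> = (theta2 0 \<tau>)\<^sup>2 / (theta3 0 \<tau>)\<^sup>2"

definition modular_lambda :: "complex \<Rightarrow> complex" where
  "modular_lambda \<tau> = (elliptic_k \<tau>)\<^sup>2"

definition elliptic_K :: "complex \<Rightarrow> complex" where
  "elliptic_K \<tau> = of_real pi / 2 * (theta3 0 \<tau>)\<^sup>2"

text \<open>
  The Jacobi functions of modulus \<open>k = elliptic_k \<tau>\<close>, as functions of \<open>u = 2 K z\<close>,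
  parametrised by \<open>\<tau>\<close> and given by their classical theta quotients.
  The function cs is not defined as the pointwise quotient of cn by sn: at the common poles of
  cn and sn (for instance \<open>z = \<tau>/2\<close>, which occurs in the sums below) division by zero
  would give the value 0 instead of the finite value of the meromorphic function cs.
\<close>

definition jacobi_sn :: "complex \<Rightarrow> complex \<Rightarrow> complex" where
  "jacobi_sn u \<tau> = (let z = u / (2 * elliptic_K \<tau>)
                    in theta3 0 \<tau> / theta2 0 \<tau> * (theta1 z \<tau> / theta4 z \<tau>))"

definition jacobi_cn :: "complex \<Rightarrow> complex \<Rightarrow> complex" where
  "jacobi_cn u \<tau> = (let z = u / (2 * elliptic_K \<tau>)
                    in theta4 0 \<tau> / theta2 0 \<tau> * (theta2 z \<tau> / theta4 z \<tau>))"

definition jacobi_cs :: "complex \<Rightarrow> complex \<Rightarrow> complex" where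
  "jacobi_cs u \<tau> = (let z = u / (2 * elliptic_K \<tau>)
                    in theta4 0 \<tau> / theta3 0 \<tau> * (theta2 z \<tau> / theta1 z \<tau>))"

lemma jacobi_cs_eq_cn_over_sn:
  assumes "theta2 0 \<tau> \<noteq> 0" and "theta4 (u / (2 * elliptic_K \<tau>)) \<tau> \<noteq> 0"
  shows "jacobi_cs u \<tau> = jacobi_cn u \<tau> / jacobi_sn u \<tau>"
  using assms by (simp add: jacobi_cs_def jacobi_cn_def jacobi_sn_def Let_def)

definition U_odd :: "(int \<times> int) set" where
  "U_odd = {(a, b). a \<noteq> 0 \<and> b > 0 \<and> gcd a b = 1 \<and> odd (a + b)}"

text \<open>In the three sums below, the value at \<open>b = 1\<close> is an empty sum, hence 0.\<close>

definition elliptic_dedekind_sum :: "complex \<Rightarrow> int \<Rightarrow> int \<Rightarrow> complex" where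
  "elliptic_dedekind_sum \<tau> a b = 1 / (4 * of_int b) *
     (\<Sum>(\<mu>, \<nu>) \<in> {0..b - 1} \<times> {0..b - 1} - {(0, 0)}.
        (-1) powi \<mu>
        * jacobi_cs (2 * elliptic_K \<tau> * of_int a * ((of_int \<mu> * \<tau> + of_int \<nu>) / of_int b)) \<tau>
        * jacobi_cs (2 * elliptic_K \<tau> * ((of_int \<mu> * \<tau> + of_int \<nu>) / of_int b)) \<tau>)"

definition dedekind_Q :: "int \<Rightarrow> int \<Rightarrow> rat" where
  "dedekind_Q a b = (THE r. \<forall>\<tau>. Im \<tau> > 0 \<longrightarrow>
     elliptic_dedekind_sum \<tau> a b = of_rat r * (1/3 - 1/6 * modular_lambda \<tau>))"

definition dedekind_sum :: "int \<Rightarrow> int \<Rightarrow> real" where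
  "dedekind_sum a b = 1 / (4 * of_int b) *
     (\<Sum>\<nu> = 1..b - 1. cot (pi * of_int a * of_int \<nu> / of_int b) * cot (pi * of_int \<nu> / of_int b))"

definition hardy_berndt_sum :: "int \<Rightarrow> int \<Rightarrow> real" where
  "hardy_berndt_sum a b =
     (\<Sum>\<mu> = 1..b - 1. (-1) powi (\<mu> + 1 + \<lfloor>of_int a * of_int \<mu> / (of_int b :: real)\<rfloor>))"

end

theory Submission
  imports Defs "HOL-Complex_Analysis.Complex_Analysis"
begin

text \<open>
  Write \<open>f z = cs (2 K z)\<close>. For coprime \<open>a, b > 0\<close> with \<open>a + b\<close> odd, the function
  \<open>f z * f (a z) * f (b z)\<close> is elliptic with periods \<open>1, \<tau>\<close>; the sum of its residues at the \<open>a\<close>- and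
  \<open>b\<close>-division points and at \<open>0\<close> vanishes, which gives
  \<open>s_\<tau>(a;b) + s_\<tau>(b;a) = \<epsilon> (1 + a\<^sup>2 + b\<^sup>2) / (a b)\<close>, with \<open>\<epsilon>\<close> depending on \<open>\<tau>\<close> only.
  The case \<open>(a;b) = (1;2)\<close>, where \<open>s_\<tau>\<close> is explicit by Jacobi's quartic identity for theta constants,
  identifies \<open>4 \<epsilon> = 1/3 - \<lambda>/6\<close>. Since \<open>s_\<tau>(a;b)\<close> is odd in \<open>a\<close> and \<open>2b\<close>-periodic in \<open>a\<close>,
  the Euclidean algorithm shows that \<open>s_\<tau>(a;b)\<close> is a rational multiple of \<open>1/3 - \<lambda>/6\<close>. The
  multiple is read off in the limit \<open>\<tau> \<rightarrow> i \<infinity>\<close>, where \<open>\<lambda> \<rightarrow> 0\<close>: the terms with \<open>\<mu> = 0\<close> tend to the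
  cotangent products of the Dedekind sum, and each term with \<open>\<mu> > 0\<close> tends to the sign
  \<open>(-1)^(\<mu> + 1 + \<lfloor>a\<mu>/b\<rfloor>)\<close> of the Hardy--Berndt sum.

  No contour integrals are used: an elliptic function with removable singularities is constant by
  Liouville's theorem, and the residue theorem is obtained by subtracting translates of the logarithmic
  derivative of \<open>\<theta>\<^sub>1\<close>, which is additively quasi-periodic.
\<close>

section \<open>Theta series\<close>

text \<open>The parity condition makes the product elliptic: translation by \<tau> multiplies its
  three factors by -1, (-1)^a and (-1)^b. Coprimality confines multiple poles to the lattice itself,
  where the pole is triple: with cs expanded as c/z + e z + ..., the residue there is c^2 e (1 + a^2
  + b^2)/(ab), and every other pole is simple. Hence \<epsilon> = - c e / 4, but neither c nor e is
  ever computed; the pair (1;2) fixes their product. The period in a is 2b and not b because moving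
  a by b translates one argument by \<mu>\<tau> + \<nu>, at the cost of the sign (-1)^\<mu>. Since x
  / 0 = 0, a quotient takes a spurious value at its poles, and additive translation laws fail there.
  Regularity is therefore expressed by the existence of limits, and such laws are required near a
  point rather than at it. \<open>dedekind_Q\<close> is a definite description, so the existence and
  uniqueness of the rational factor are part of what is proved.\<close>

lemma summable_gaussian:
  fixes c R :: real
  assumes "c > 0"
  shows "summable (\<lambda>n::nat. exp (R * real n - c * (real n)\<^sup>2))"
proof (rule summable_comparison_test_ev)
  have "eventually (\<lambda>n::nat. real n \<ge> (R + 1) / c) sequentially"
    by real_asymp
  then show "\<forall>\<^sub>F n in sequentially. norm (exp (R * real n - c * (real n)\<^sup>2)) \<le> exp (-1) ^ n"
  proof eventually_elim
    case (elim n)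
    have "R + 1 \<le> c * real n" using elim assms by (simp add: field_simps)
    then have "(R + 1) * real n \<le> c * real n * real n"
      by (intro mult_right_mono) auto
    then have "R * real n - c * (real n)\<^sup>2 \<le> real n * (-1)"
      by (simp add: algebra_simps power2_eq_square)
    then show ?case
      by (simp add: exp_of_nat_mult[symmetric])
  qed
  show "summable (\<lambda>n. exp (-1 :: real) ^ n)"
    by (rule summable_geometric) simp
qed

lemma int_UNIV_split: "(UNIV :: int set) = range int \<union> range (\<lambda>n. - int n - 1)"
proof -
  have "x \<in> range int \<union> range (\<lambda>n. - int n - 1)" for x
  proof (cases "x \<ge> 0")
    case True
    then have "x = int (nat x)" by simp
    then show ?thesis by blast
  next
    case False
    then have "x = - int (nat (-x-1)) - 1" by simp
    then show ?thesis by blast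
  qed
  then show ?thesis by auto
qed

text \<open>The reflection n -> -n-1 is the symmetry of n + 1/2, so this way of folding the integers
  yields exactly the pairs that combine to a cosine in \<open>theta2\<close>.\<close>

lemma has_sum_int_split:
  fixes f :: "int \<Rightarrow> 'a :: topological_comm_monoid_add"
  assumes "((\<lambda>n. f (int n)) has_sum s) UNIV" "((\<lambda>n. f (- int n - 1)) has_sum t) UNIV"
  shows "(f has_sum (s + t)) UNIV"
proof -
  have 1: "(f has_sum s) (range int)"
    using assms(1) by (subst has_sum_reindex) (auto simp: o_def inj_on_def)
  have 2: "(f has_sum t) (range (\<lambda>n. - int n - 1))"
    using assms(2) by (subst has_sum_reindex) (auto simp: o_def inj_on_def)
  show ?thesis unfolding int_UNIV_split
    by (rule has_sum_Un_disjoint[OF 1 2]) auto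
qed

text \<open>Majorant for the theta terms: on a strip where the imaginary part of z is bounded, the
  linear part of the exponent is dominated by a multiple of the modulus of n and the quadratic part
  ensures convergence.\<close>

lemma summable_on_int_gaussian:
  fixes c R :: real
  assumes "c > 0"
  shows "(\<lambda>n::int. exp (R * \<bar>real_of_int n\<bar> - c * (real_of_int n)\<^sup>2)) summable_on UNIV"
proof -
  let ?g = "\<lambda>n::int. exp (R * \<bar>real_of_int n\<bar> - c * (real_of_int n)\<^sup>2)"
  let ?h = "\<lambda>n::nat. exp (R * real n - c * (real n)\<^sup>2)"
  have s: "summable ?h" using summable_gaussian[OF assms] .
  have "(\<lambda>n. ?g (int n)) summable_on UNIV"
    using s by (subst summable_on_UNIV_nonneg_real_iff) auto
  moreover have "(\<lambda>n. ?g (- int n - 1)) summable_on UNIV"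
  proof (subst summable_on_UNIV_nonneg_real_iff)
    have eq: "?g (- int n - 1) = ?h (Suc n)" for n
    proof -
      have "\<bar>real_of_int (- int n - 1)\<bar> = real (Suc n)" by simp
      moreover have "(real_of_int (- int n - 1))\<^sup>2 = (real (Suc n))\<^sup>2"
        by (simp add: power2_eq_square algebra_simps)
      ultimately show ?thesis by metis
    qed
    show "summable (\<lambda>n. ?g (- int n - 1))"
      unfolding eq using s by (subst summable_Suc_iff)
  qed auto
  ultimately show ?thesis
    unfolding summable_on_def using has_sum_int_split[of ?g] by blast
qed

text \<open>Up to exponential factors, the four theta functions are translates of this one by half periods.\<close>

definition jtheta_term :: "complex \<Rightarrow> int \<Rightarrow> complex \<Rightarrow> complex" where
  "jtheta_term \<tau> n z = exp (of_real pi * \<i> * (of_int n ^ 2 * \<tau> + 2 * of_int n * z))"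

definition jtheta :: "complex \<Rightarrow> complex \<Rightarrow> complex" where
  "jtheta \<tau> z = (\<Sum>\<^sub>\<infinity>n\<in>UNIV. jtheta_term \<tau> n z)"

lemma norm_jtheta_term:
  "norm (jtheta_term \<tau> n z) = exp (- 2 * pi * Im z * of_int n - pi * Im \<tau> * (of_int n)\<^sup>2)"
proof -
  have "Re (of_real pi * \<i> * (of_int n ^ 2 * \<tau> + 2 * of_int n * z))
      = - 2 * pi * Im z * of_int n - pi * Im \<tau> * (of_int n)\<^sup>2"
    by (simp add: power2_eq_square algebra_simps)
  then show ?thesis unfolding jtheta_term_def by simp
qed

lemma norm_jtheta_term_le:
  assumes "\<bar>Im z\<bar> \<le> R"
  shows "norm (jtheta_term \<tau> n z) \<le> exp (2 * pi * R * \<bar>of_int n\<bar> - pi * Im \<tau> * (of_int n)\<^sup>2)"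
proof -
  have "- (Im z * of_int n) \<le> \<bar>Im z\<bar> * \<bar>of_int n\<bar>"
    by (metis abs_ge_minus_self abs_mult)
  also have "\<dots> \<le> R * \<bar>of_int n\<bar>" using assms by (intro mult_right_mono) auto
  finally have "2 * pi * (- (Im z * of_int n)) \<le> 2 * pi * (R * \<bar>of_int n\<bar>)"
    by (intro mult_left_mono) auto
  then show ?thesis unfolding norm_jtheta_term by (simp add: algebra_simps)
qed

lemma jtheta_add_1: "jtheta \<tau> (z + 1) = jtheta \<tau> z"
proof -
  have "jtheta_term \<tau> n (z + 1) = jtheta_term \<tau> n z" for n
  proof -
    have "jtheta_term \<tau> n (z + 1)
        = exp (of_real pi * \<i> * (of_int n ^ 2 * \<tau> + 2 * of_int n * z) + (2 * of_int n * of_real pi) * \<i>)"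
      unfolding jtheta_term_def by (simp add: algebra_simps)
    moreover have "exp ((2 * of_int n * of_real pi) * \<i>) = 1"
      using exp_integer_2pi[of "of_int n"] by simp
    ultimately show ?thesis unfolding jtheta_term_def by (simp only: exp_add) simp
  qed
  then show ?thesis unfolding jtheta_def by simp
qed

lemma jtheta_minus: "jtheta \<tau> (- z) = jtheta \<tau> z"
  unfolding jtheta_def
  by (rule infsum_reindex_bij_witness[of _ uminus uminus]) (auto simp: jtheta_term_def)

context
  fixes \<tau> :: complex
  assumes Im_pos: "Im \<tau> > 0"
begin

lemma summable_norm_jtheta_term: "(\<lambda>n. norm (jtheta_term \<tau> n z)) summable_on UNIV"
  by (rule Infinite_Sum.abs_summable_on_comparison_test'[OF summable_on_int_gaussian[of "pi * Im \<tau>" "2 * pi * \<bar>Im z\<bar>"]])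
     (use Im_pos norm_jtheta_term_le[of z "\<bar>Im z\<bar>"] in auto)

lemma has_sum_jtheta: "((\<lambda>n. jtheta_term \<tau> n z) has_sum jtheta \<tau> z) UNIV"
  unfolding jtheta_def
  by (rule has_sum_infsum, rule abs_summable_summable, rule summable_norm_jtheta_term)

lemma uniform_limit_jtheta:
  "uniform_limit {z. \<bar>Im z\<bar> \<le> R} (\<lambda>X z. \<Sum>n\<in>X. jtheta_term \<tau> n z) (jtheta \<tau>) (finite_subsets_at_top UNIV)"
  unfolding jtheta_def
  by (rule Weierstrass_m_test_general[OF _ summable_on_int_gaussian[of "pi * Im \<tau>" "2 * pi * R"]])
     (use Im_pos norm_jtheta_term_le[of _ R] in auto)

lemma holomorphic_jtheta: "jtheta \<tau> holomorphic_on UNIV"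
proof -
  have "\<exists>e>0. jtheta \<tau> holomorphic_on ball z e" for z
  proof -
    have sub: "cball z 1 \<subseteq> {w. \<bar>Im w\<bar> \<le> \<bar>Im z\<bar> + 1}"
    proof
      fix w assume "w \<in> cball z 1"
      then have "\<bar>Im (w - z)\<bar> \<le> 1"
        using abs_Im_le_cmod[of "w - z"] by (simp add: dist_norm norm_minus_commute)
      then show "w \<in> {w. \<bar>Im w\<bar> \<le> \<bar>Im z\<bar> + 1}" by simp
    qed
    have u: "uniform_limit (cball z 1) (\<lambda>X z. \<Sum>n\<in>X. jtheta_term \<tau> n z) (jtheta \<tau>) (finite_subsets_at_top UNIV)"
      by (rule uniform_limit_on_subset[OF uniform_limit_jtheta sub])
    have "jtheta \<tau> holomorphic_on ball z 1"
    proof (rule holomorphic_uniform_limit[OF always_eventually u])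
      show "\<forall>X. continuous_on (cball z 1) (\<lambda>z. \<Sum>n\<in>X. jtheta_term \<tau> n z) \<and>
               (\<lambda>z. \<Sum>n\<in>X. jtheta_term \<tau> n z) holomorphic_on ball z 1"
        unfolding jtheta_term_def by (auto intro!: continuous_intros holomorphic_intros)
    qed auto
    then show ?thesis by (intro exI[of _ 1]) auto
  qed
  then have "jtheta \<tau> analytic_on UNIV" unfolding analytic_on_def by blast
  then show ?thesis by (rule analytic_imp_holomorphic)
qed

lemma jtheta_add_tau: "jtheta \<tau> (z + \<tau>) = exp (- of_real pi * \<i> * (\<tau> + 2 * z)) * jtheta \<tau> z"
proof -
  let ?c = "exp (- of_real pi * \<i> * (\<tau> + 2 * z))"
  have t: "jtheta_term \<tau> n (z + \<tau>) = ?c * jtheta_term \<tau> (n + 1) z" for n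
    unfolding jtheta_term_def exp_add[symmetric]
    by (simp add: power2_eq_square algebra_simps)
  have "((\<lambda>n. ?c * jtheta_term \<tau> n z) has_sum ?c * jtheta \<tau> z) UNIV"
    by (rule has_sum_cmult_right[OF has_sum_jtheta])
  then have "((\<lambda>n. ?c * jtheta_term \<tau> (n + 1) z) has_sum ?c * jtheta \<tau> z) UNIV"
    by (subst has_sum_reindex_bij_betw[of "\<lambda>n. n + 1" UNIV UNIV "\<lambda>n. ?c * jtheta_term \<tau> n z"])
       (auto intro!: bij_betwI[of _ _ _ "\<lambda>n. n - 1"])
  with t have "((\<lambda>n. jtheta_term \<tau> n (z + \<tau>)) has_sum ?c * jtheta \<tau> z) UNIV" by simp
  with has_sum_jtheta[of "z + \<tau>"] show ?thesis by (rule has_sum_unique)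
qed

text \<open>The Fourier coefficient of index 0 over the real segment [0,1] equals 1, since every
  term with n \<noteq> 0 integrates to 0 and uniform convergence allows termwise integration. This
  is what later excludes a zero constant in the product formula.\<close>

lemma jtheta_nontrivial: "\<exists>z. jtheta \<tau> z \<noteq> 0"
proof (rule ccontr)
  assume "\<not> ?thesis"
  then have z: "jtheta \<tau> z = 0" for z by auto
  let ?f = "\<lambda>X x::real. \<Sum>n\<in>X. jtheta_term \<tau> n (of_real x)"
  have "uniform_limit (of_real ` {0..1::real}) (\<lambda>X z. \<Sum>n\<in>X. jtheta_term \<tau> n z) (jtheta \<tau>) (finite_subsets_at_top UNIV)"
    by (rule uniform_limit_on_subset[OF uniform_limit_jtheta[of 0]]) auto
  then have u: "uniform_limit {0..1::real} ?f (\<lambda>x. jtheta \<tau> (of_real x)) (finite_subsets_at_top UNIV)"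
    unfolding uniform_limit_iff by simp
  obtain I J where I: "\<And>X. (?f X has_integral I X) {0..1}"
    and J: "((\<lambda>x. jtheta \<tau> (of_real x)) has_integral J) {0..1}"
    and IJ: "(I \<longlongrightarrow> J) (finite_subsets_at_top UNIV)"
    by (rule uniform_limit_integral[OF u]) (auto simp: jtheta_term_def intro!: continuous_intros)
  have "J = 0" using J z by (auto intro: has_integral_unique)
  have t: "((\<lambda>x. jtheta_term \<tau> n (of_real x)) has_integral (if n = 0 then 1 else 0)) {0..1}" for n
  proof (cases "n = 0")
    case True
    have "((\<lambda>x. 1 :: complex) has_integral 1) {0..1::real}"
      using has_integral_const_real[of "1::complex" 0 1] by simp
    with True show ?thesis by (simp add: jtheta_term_def)
  next
    case False
    let ?F = "\<lambda>x::real. jtheta_term \<tau> n (of_real x) / (2 * of_real pi * \<i> * of_int n)"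
    have "((\<lambda>x. jtheta_term \<tau> n (of_real x)) has_integral ?F 1 - ?F 0) {0..1}"
    proof (rule fundamental_theorem_of_calculus)
      fix x :: real assume "x \<in> {0..1}"
      show "(?F has_vector_derivative jtheta_term \<tau> n (of_real x)) (at x within {0..1})"
        unfolding jtheta_term_def using False
        by (auto intro!: derivative_eq_intros has_vector_derivative_real_field simp: field_simps)
    qed simp
    moreover have "?F 1 = ?F 0"
    proof -
      have "jtheta_term \<tau> n 1 = exp (of_real pi * \<i> * (of_int n ^ 2 * \<tau>) + (2 * of_int n * of_real pi) * \<i>)"
        unfolding jtheta_term_def by (simp add: algebra_simps)
      also have "\<dots> = jtheta_term \<tau> n 0"
        using exp_integer_2pi[of "of_int n"] by (simp add: exp_add jtheta_term_def)
      finally show ?thesis by simp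
    qed
    ultimately show ?thesis using False by simp
  qed
  have "I X = 1" if "finite X" "0 \<in> X" for X
  proof -
    have "(?f X has_integral (\<Sum>n\<in>X. if n = 0 then 1 else 0)) {0..1}"
      by (intro has_integral_sum that t)
    then have "I X = (\<Sum>n\<in>X. if n = 0 then 1 else 0)" using I[of X] has_integral_unique by blast
    with that show ?thesis by simp
  qed
  then have "eventually (\<lambda>X. I X = 1) (finite_subsets_at_top UNIV)"
    unfolding eventually_finite_subsets_at_top by (intro exI[of _ "{0}"]) auto
  then have "(I \<longlongrightarrow> 1) (finite_subsets_at_top UNIV)" by (rule tendsto_eventually)
  with IJ have "J = 1" by (intro tendsto_unique) auto
  with \<open>J = 0\<close> show False by simp
qed

lemma sums_jtheta_term:
  "(\<lambda>n. jtheta_term \<tau> (int n) z + jtheta_term \<tau> (- int n - 1) z) sums jtheta \<tau> z"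
proof -
  let ?f = "\<lambda>n. jtheta_term \<tau> n z"
  have s: "?f summable_on A" for A
    by (rule summable_on_subset_banach[of _ UNIV])
       (use has_sum_jtheta in \<open>auto simp: summable_on_def\<close>)
  have 1: "(\<lambda>n. ?f (int n)) summable_on UNIV"
    using s[of "range int"] by (subst (asm) summable_on_reindex) (auto simp: o_def)
  have 2: "(\<lambda>n. ?f (- int n - 1)) summable_on UNIV"
    using s[of "range (\<lambda>n. - int n - 1)"] by (subst (asm) summable_on_reindex) (auto simp: o_def inj_on_def)
  obtain u v where u: "((\<lambda>n. ?f (int n)) has_sum u) UNIV" and v: "((\<lambda>n. ?f (- int n - 1)) has_sum v) UNIV"
    using 1 2 unfolding summable_on_def by blast
  have "u + v = jtheta \<tau> z"
    using has_sum_int_split[OF u v] has_sum_jtheta by (rule has_sum_unique)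
  then show ?thesis using sums_add[OF has_sum_imp_sums[OF u] has_sum_imp_sums[OF v]] by simp
qed

text \<open>The pairs (n, -n-1) are exchanged for the pairs (n+1, -n-1), which suit
  \<open>theta3\<close> and \<open>theta4\<close>, by subtracting the telescoping series of f(n) -
  f(n+1), whose sum is the term f(0) = 1.\<close>

lemma sums_jtheta_term_Suc:
  "(\<lambda>n. jtheta_term \<tau> (int (Suc n)) z + jtheta_term \<tau> (- int (Suc n)) z) sums (jtheta \<tau> z - 1)"
proof -
  let ?f = "\<lambda>n. jtheta_term \<tau> n z"
  have s: "?f summable_on A" for A
    by (rule summable_on_subset_banach[of _ UNIV])
       (use has_sum_jtheta in \<open>auto simp: summable_on_def\<close>)
  have 1: "summable (\<lambda>n. ?f (int n))"
    using s[of "range int"] 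
    by (subst (asm) summable_on_reindex) (auto simp: o_def intro: summable_on_imp_summable)
  then have "(\<lambda>n. ?f (int n) - ?f (int (Suc n))) sums (?f (int 0) - 0)"
    by (intro telescope_sums' summable_LIMSEQ_zero)
  from sums_diff[OF sums_jtheta_term[of z] this]
  show ?thesis by (simp add: jtheta_term_def[of _ 0] add.commute minus_diff_commute)
qed

section \<open>The four theta series as translates of one function\<close>

lemma theta3_eq_jtheta: "theta3 z \<tau> = jtheta \<tau> z"
proof -
  have eq: "(jtheta_term \<tau> (int (Suc n)) z + jtheta_term \<tau> (- int (Suc n)) z) / 2
     = qpow \<tau> (1/2 * (real (Suc n))\<^sup>2) * cos (of_nat (2 * Suc n) * of_real pi * z)" for n
    unfolding jtheta_term_def qpow_def cos_exp_eq
    by (simp add: exp_add[symmetric] distrib_left) (simp add: algebra_simps power2_eq_square)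
  show ?thesis
    unfolding theta3_def by (subst sums_unique[OF sums_divide[OF sums_jtheta_term_Suc[of z], of 2], unfolded eq, symmetric]) (simp add: field_simps)
qed

lemma theta4_eq_jtheta: "theta4 z \<tau> = jtheta \<tau> (z + 1 / 2)"
proof -
  have m: "exp (of_real pi * \<i> * of_nat k) = (-1) ^ k" for k
    by (metis exp_of_nat2_mult exp_pi_i)
  have eq: "(jtheta_term \<tau> (int (Suc n)) (z + 1/2) + jtheta_term \<tau> (- int (Suc n)) (z + 1/2)) / 2
     = (-1) ^ Suc n * qpow \<tau> (1/2 * (real (Suc n))\<^sup>2) * cos (of_nat (2 * Suc n) * of_real pi * z)" for n
  proof -
    have a: "jtheta_term \<tau> (int (Suc n)) (z + 1/2) = (-1) ^ Suc n * jtheta_term \<tau> (int (Suc n)) z"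
      unfolding m[symmetric] jtheta_term_def exp_add[symmetric] by (simp add: algebra_simps)
    have "jtheta_term \<tau> (- int (Suc n)) (z + 1/2) = inverse ((-1) ^ Suc n) * jtheta_term \<tau> (- int (Suc n)) z"
      unfolding m[symmetric] jtheta_term_def exp_minus[symmetric] exp_add[symmetric] by (simp add: algebra_simps)
    then have b: "jtheta_term \<tau> (- int (Suc n)) (z + 1/2) = (-1) ^ Suc n * jtheta_term \<tau> (- int (Suc n)) z"
      by (simp add: power_inverse[symmetric])
    have c: "jtheta_term \<tau> (int (Suc n)) z + jtheta_term \<tau> (- int (Suc n)) z
     = 2 * (qpow \<tau> (1/2 * (real (Suc n))\<^sup>2) * cos (of_nat (2 * Suc n) * of_real pi * z))"
      unfolding jtheta_term_def qpow_def cos_exp_eq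
      by (simp add: exp_add[symmetric] distrib_left) (simp add: algebra_simps power2_eq_square)
    show ?thesis unfolding a b distrib_left[symmetric] c by simp
  qed
  show ?thesis
    unfolding theta4_def by (subst sums_unique[OF sums_divide[OF sums_jtheta_term_Suc[of "z + 1/2"], of 2], unfolded eq, symmetric]) (simp add: field_simps)
qed

lemma theta2_eq_jtheta:
  "theta2 z \<tau> = exp (of_real pi * \<i> * (\<tau> / 4 + z)) * jtheta \<tau> (z + \<tau> / 2)"
proof -
  let ?c = "exp (of_real pi * \<i> * (\<tau> / 4 + z))"
  have eq: "?c * (jtheta_term \<tau> (int n) (z + \<tau> / 2) + jtheta_term \<tau> (- int n - 1) (z + \<tau> / 2)) / 2
     = qpow \<tau> (1/2 * (real n + 1/2)\<^sup>2) * cos (of_nat (2 * n + 1) * of_real pi * z)" for n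
  proof -
    let ?x = "of_nat (2 * n + 1) * of_real pi * z"
    have "?c * jtheta_term \<tau> (int n) (z + \<tau> / 2) = qpow \<tau> (1/2 * (real n + 1/2)\<^sup>2) * exp (\<i> * ?x)"
      unfolding jtheta_term_def qpow_def exp_add[symmetric]
      by (rule arg_cong[where f = exp]) (simp add: field_simps power2_eq_square)
    moreover have "?c * jtheta_term \<tau> (- int n - 1) (z + \<tau> / 2) = qpow \<tau> (1/2 * (real n + 1/2)\<^sup>2) * exp (- (\<i> * ?x))"
      unfolding jtheta_term_def qpow_def exp_add[symmetric]
      by (rule arg_cong[where f = exp]) (simp add: field_simps power2_eq_square)
    ultimately show ?thesis by (simp add: cos_exp_eq distrib_left)
  qed
  show ?thesis
    unfolding theta2_def
    by (subst sums_unique[OF sums_divide[OF sums_mult[OF sums_jtheta_term[of "z + \<tau> / 2"], of ?c], of 2], unfolded eq, symmetric]) (simp add: field_simps)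
qed

lemma theta1_eq_theta2: "theta1 z \<tau> = theta2 (z - 1 / 2) \<tau>"
proof -
  have "cos (of_nat (2 * n + 1) * of_real pi * (z - 1 / 2)) = (-1) ^ n * sin (of_nat (2 * n + 1) * of_real pi * z)" for n
  proof -
    have "of_nat (2 * n + 1) * of_real pi * (z - 1 / 2) = of_nat (2 * n + 1) * of_real pi * z - (of_real pi / 2 + of_nat n * of_real pi)"
      by (simp add: algebra_simps)
    moreover have "cos (x - (of_real pi / 2 + of_nat n * of_real pi)) = (-1) ^ n * sin x" for x :: complex
    proof -
      have "cos (of_real pi / 2 + of_nat n * of_real pi :: complex) = of_real (cos (pi / 2 + real n * pi))"
        by (simp add: cos_of_real[symmetric])
      moreover have "sin (of_real pi / 2 + of_nat n * of_real pi :: complex) = of_real (sin (pi / 2 + real n * pi))"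
        by (simp add: sin_of_real[symmetric])
      ultimately show ?thesis by (simp add: cos_diff cos_add sin_add)
    qed
    ultimately show ?thesis by simp
  qed
  then show ?thesis unfolding theta1_def theta2_def by (simp add: mult_ac)
qed

end

section \<open>Elliptic functions without poles\<close>

lemma real_coords:
  fixes \<tau> z :: complex
  assumes "Im \<tau> > 0"
  obtains s t :: real where "z = of_real t * \<tau> + of_real s"
proof
  show "z = of_real (Im z / Im \<tau>) * \<tau> + of_real (Re z - Im z / Im \<tau> * Re \<tau>)"
    using assms by (simp add: complex_eq_iff)
qed

section \<open>The period lattice\<close>

definition period_lattice :: "complex \<Rightarrow> complex set" where
  "period_lattice \<tau> = {of_int m * \<tau> + of_int n | m n. True}"

lemma period_latticeI [intro]: "of_int m * \<tau> + of_int n \<in> period_lattice \<tau>"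
  unfolding period_lattice_def by blast

lemma period_latticeE:
  assumes "z \<in> period_lattice \<tau>"
  obtains m n where "z = of_int m * \<tau> + of_int n"
  using assms unfolding period_lattice_def by blast

lemma zero_in_period_lattice [simp]: "0 \<in> period_lattice \<tau>"
  using period_latticeI[of 0 \<tau> 0] by simp

lemma period_lattice_add: "z \<in> period_lattice \<tau> \<Longrightarrow> w \<in> period_lattice \<tau> \<Longrightarrow> z + w \<in> period_lattice \<tau>"
proof -
  assume "z \<in> period_lattice \<tau>" "w \<in> period_lattice \<tau>"
  then obtain m n m' n' where "z = of_int m * \<tau> + of_int n" "w = of_int m' * \<tau> + of_int n'"
    by (metis period_latticeE)
  then have "z + w = of_int (m + m') * \<tau> + of_int (n + n')" by (simp add: algebra_simps)
  then show ?thesis by (metis period_latticeI)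
qed

lemma period_lattice_of_int_mult: "z \<in> period_lattice \<tau> \<Longrightarrow> of_int k * z \<in> period_lattice \<tau>"
proof -
  assume "z \<in> period_lattice \<tau>"
  then obtain m n where "z = of_int m * \<tau> + of_int n"
    by (metis period_latticeE)
  then have "of_int k * z = of_int (k * m) * \<tau> + of_int (k * n)" by (simp add: algebra_simps)
  then show ?thesis by (metis period_latticeI)
qed

lemma period_lattice_minus: "z \<in> period_lattice \<tau> \<Longrightarrow> - z \<in> period_lattice \<tau>"
  using period_lattice_of_int_mult[of z \<tau> "-1"] by simp

lemma period_lattice_diff: "z \<in> period_lattice \<tau> \<Longrightarrow> w \<in> period_lattice \<tau> \<Longrightarrow> z - w \<in> period_lattice \<tau>"
  using period_lattice_add[of z \<tau> "-w"] period_lattice_minus[of w \<tau>] by simp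

lemma real_coords_in_period_lattice_iff:
  assumes "Im \<tau> > 0"
  shows "of_real t * \<tau> + of_real s \<in> period_lattice \<tau> \<longleftrightarrow> t \<in> \<int> \<and> s \<in> \<int>"
proof
  assume "of_real t * \<tau> + of_real s \<in> period_lattice \<tau>"
  then obtain m n where e: "of_real t * \<tau> + of_real s = of_int m * \<tau> + of_int n"
    by (rule period_latticeE)
  have "t * Im \<tau> = of_int m * Im \<tau>" using arg_cong[OF e, of Im] by simp
  with assms have t: "t = of_int m" by simp
  with arg_cong[OF e, of Re] have "s = of_int n" by simp
  with t show "t \<in> \<int> \<and> s \<in> \<int>" by simp
next
  assume "t \<in> \<int> \<and> s \<in> \<int>"
  then obtain m n where "t = of_int m" "s = of_int n" by (auto elim!: Ints_cases)
  then show "of_real t * \<tau> + of_real s \<in> period_lattice \<tau>" using period_latticeI[of m \<tau> n] by simp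
qed

lemma shift_int:
  fixes f :: "complex \<Rightarrow> 'a" and \<omega> :: complex
  assumes "\<And>z. f (z + \<omega>) = f z"
  shows "f (z + of_int n * \<omega>) = f z"
proof (induction n rule: int_induct[of _ 0])
  case (step1 i)
  then show ?case using assms[of "z + of_int i * \<omega>"] by (simp add: algebra_simps)
next
  case (step2 i)
  then show ?case using assms[of "z + of_int (i - 1) * \<omega>"] by (simp add: algebra_simps)
qed simp

lemma entire_doubly_periodic_constant:
  fixes f :: "complex \<Rightarrow> complex"
  assumes "Im \<tau> > 0" and "f holomorphic_on UNIV"
    and "\<And>z. f (z + 1) = f z" "\<And>z. f (z + \<tau>) = f z"
  obtains c where "\<And>z. f z = c"
proof -
  let ?K = "(\<lambda>(s, t). of_real t * \<tau> + of_real s) ` ({0..1::real} \<times> {0..1::real})"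
  have K: "compact ?K"
    by (intro compact_continuous_image compact_Times) (auto simp: case_prod_unfold intro!: continuous_intros)
  have "range f \<subseteq> f ` ?K"
  proof
    fix y assume "y \<in> range f"
    then obtain z where y: "y = f z" by auto
    obtain s t where z: "z = of_real t * \<tau> + of_real s" using real_coords[OF assms(1)] .
    let ?w = "of_real (t - \<lfloor>t\<rfloor>) * \<tau> + of_real (s - \<lfloor>s\<rfloor>)"
    have "f ?w = f (?w + of_int \<lfloor>t\<rfloor> * \<tau> + of_int \<lfloor>s\<rfloor> * 1)"
      using shift_int[of f 1] shift_int[of f \<tau>] assms(3,4) by metis
    also have "?w + of_int \<lfloor>t\<rfloor> * \<tau> + of_int \<lfloor>s\<rfloor> * 1 = z"
      unfolding z by (simp add: algebra_simps)
    finally have "y = f ?w" using y by simp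
    moreover have "?w \<in> ?K"
      by (rule image_eqI[of _ _ "(s - \<lfloor>s\<rfloor>, t - \<lfloor>t\<rfloor>)"]) (auto, linarith+)
    ultimately show "y \<in> f ` ?K" by blast
  qed
  moreover have "bounded (f ` ?K)"
    using assms(2) by (intro compact_imp_bounded compact_continuous_image K)
      (auto intro: holomorphic_on_imp_continuous_on holomorphic_on_subset)
  ultimately have "bounded (range f)" using bounded_subset by blast
  then have "f constant_on UNIV" by (rule Liouville_theorem[OF assms(2)])
  then show ?thesis using that unfolding constant_on_def by blast
qed

lemma filterlim_at_shift:
  fixes f :: "complex \<Rightarrow> complex"
  assumes "(f \<longlongrightarrow> L) (at (z + \<omega>))"
  shows "((\<lambda>w. f (w + \<omega>)) \<longlongrightarrow> L) (at z)"
  using assms LIM_offset[of f L "z + \<omega>" \<omega>] by simp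

text \<open>After removal of its singularities T is an entire function G whose derivative is doubly
  periodic, hence a constant \<alpha>. So G is affine; the period 1 forces \<alpha> = 0, and a
  constant function has no additive increment. The conclusion C = 0 is the form in which the residue
  theorem will appear.\<close>

lemma additively_quasi_elliptic_constant:
  fixes T :: "complex \<Rightarrow> complex"
  assumes tau: "Im \<tau> > 0" and mero: "T meromorphic_on UNIV"
    and lim: "\<And>z. \<exists>L. (T \<longlongrightarrow> L) (at z)"
    and per1: "\<And>z. \<forall>\<^sub>F w in at z. T (w + 1) = T w"
    and per\<tau>: "\<And>z. \<forall>\<^sub>F w in at z. T (w + \<tau>) = T w + C"
  shows "C = 0 \<and> (\<exists>k. \<forall>z. (T \<longlongrightarrow> k) (at z))"
proof -
  define G where "G = remove_sings T"
  have G: "(T \<longlongrightarrow> G z) (at z)" for z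
    using lim[of z] unfolding G_def by (metis remove_sings_eqI)
  have "G analytic_on {z}" for z
    unfolding G_def
    by (rule remove_sings_analytic_at[OF _ G]) (use mero in \<open>auto simp: meromorphic_on_altdef\<close>)
  then have "G analytic_on UNIV" by (subst analytic_on_analytic_at) auto
  then have hol: "G holomorphic_on UNIV" by (rule analytic_imp_holomorphic)
  have G1: "G (z + 1) = G z" for z
  proof -
    have "((\<lambda>w. T (w + 1)) \<longlongrightarrow> G (z + 1)) (at z)" by (rule filterlim_at_shift[OF G])
    then have "(T \<longlongrightarrow> G (z + 1)) (at z)"
      by (rule Lim_transform_eventually[OF _ per1])
    then show ?thesis using G[of z] by (intro tendsto_unique) auto
  qed
  have G\<tau>: "G (z + \<tau>) = G z + C" for z
  proof -
    have "((\<lambda>w. T (w + \<tau>)) \<longlongrightarrow> G (z + \<tau>)) (at z)" by (rule filterlim_at_shift[OF G])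
    then have "((\<lambda>w. T w + C) \<longlongrightarrow> G (z + \<tau>)) (at z)"
      by (rule Lim_transform_eventually[OF _ per\<tau>])
    moreover have "((\<lambda>w. T w + C) \<longlongrightarrow> G z + C) (at z)" by (intro tendsto_intros G)
    ultimately show ?thesis by (intro tendsto_unique[of "at z"]) auto
  qed
  have der: "(G has_field_derivative deriv G z) (at z)" for z
    using hol by (auto intro: holomorphic_derivI)
  have "deriv G (z + \<omega>) = deriv G z" if "\<And>z. G (z + \<omega>) = G z + c" for z \<omega> c
  proof -
    have "((\<lambda>w. G (w + \<omega>)) has_field_derivative deriv G (z + \<omega>)) (at z)"
      using der[of "z + \<omega>"] DERIV_shift[of G _ z \<omega>] by simp
    moreover have "((\<lambda>w. G (w + \<omega>)) has_field_derivative deriv G z) (at z)"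
      unfolding that using der[of z] by (auto intro!: derivative_eq_intros)
    ultimately show ?thesis by (rule DERIV_unique)
  qed
  from this[of 1 0] this[of \<tau> C] obtain \<alpha> where \<alpha>: "\<And>z. deriv G z = \<alpha>"
    using entire_doubly_periodic_constant[OF tau holomorphic_deriv[OF hol]] G1 G\<tau> by auto
  have "\<exists>c. \<forall>z\<in>UNIV. G z - \<alpha> * z = c"
  proof (rule has_field_derivative_zero_constant)
    fix z :: complex
    show "((\<lambda>z. G z - \<alpha> * z) has_field_derivative 0) (at z within UNIV)"
      using der[of z] \<alpha> by (auto intro!: derivative_eq_intros)
  qed simp
  then obtain c where "\<And>z. G z - \<alpha> * z = c" by auto
  then have c: "G z = \<alpha> * z + c" for z by (simp add: diff_eq_eq add.commute)
  have "\<alpha> = 0" using G1[of 0] by (simp add: c)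
  then have "G z = c" for z using c by simp
  then show ?thesis using G\<tau>[of 0] G by auto
qed

text \<open>The strictly periodic case with poles possible only at lattice points. Periodicity
  carries the limit at 0 to all of them. The conclusion is confined to points off the lattice
  because the value of T on the lattice may be a convention of division by zero.\<close>

lemma elliptic_regular_constant:
  fixes T :: "complex \<Rightarrow> complex"
  assumes tau: "Im \<tau> > 0" and mero: "T meromorphic_on UNIV"
    and T1: "\<And>z. T (z + 1) = T z" and T\<tau>: "\<And>z. T (z + \<tau>) = T z"
    and lim_0: "(T \<longlongrightarrow> L) (at 0)"
    and lim_off: "\<And>z. z \<notin> period_lattice \<tau> \<Longrightarrow> (T \<longlongrightarrow> T z) (at z)"
  obtains k where "\<And>z. z \<notin> period_lattice \<tau> \<Longrightarrow> T z = k"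
proof -
  have lim: "\<exists>L. (T \<longlongrightarrow> L) (at z)" for z
  proof (cases "z \<in> period_lattice \<tau>")
    case True
    then obtain m n where z: "z = of_int m * \<tau> + of_int n" by (rule period_latticeE)
    have "T w = T (w + - z)" for w
    proof -
      have "T w = T (w - z + of_int m * \<tau> + of_int n * 1)" by (simp add: z)
      also have "\<dots> = T (w - z)" using shift_int[of T 1, OF T1] shift_int[of T \<tau>, OF T\<tau>] by metis
      finally show ?thesis by simp
    qed
    then have "T = (\<lambda>w. T (w + - z))" by blast
    then show ?thesis using filterlim_at_shift[of T _ z "- z"] lim_0 by auto
  next
    case False
    then show ?thesis using lim_off by blast
  qed
  from additively_quasi_elliptic_constant[OF tau mero this, of 0] T1 T\<tau>
  obtain k where k: "\<And>z. (T \<longlongrightarrow> k) (at z)" by auto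
  have "T z = k" if "z \<notin> period_lattice \<tau>" for z
    using tendsto_unique[OF _ lim_off[OF that] k[of z]] by simp
  then show ?thesis using that by blast
qed

section \<open>Infinite products\<close>

text \<open>The q-Pochhammer symbol of infinite length, usually written (y; q) with subscript
  infinity. Two of them, at y and at q/y for y = exp(2 \<pi> i z), make up the factor of the Jacobi
  product that carries all zeros of \<open>theta1\<close>.\<close>

definition qpoch :: "complex \<Rightarrow> complex \<Rightarrow> complex" where
  "qpoch q y = (\<Prod>n. 1 - q ^ n * y)"

context
  fixes q :: complex
  assumes q: "norm q < 1"
begin

lemma convergent_prod_qpoch: "convergent_prod (\<lambda>n. 1 - q ^ n * y)"
proof (rule abs_convergent_prod_imp_convergent_prod, rule summable_imp_abs_convergent_prod)
  show "summable (\<lambda>n. norm (1 - q ^ n * y - 1))"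
    using q by (auto simp: norm_mult norm_power intro!: summable_mult2 summable_geometric)
qed

lemma qpoch_LIMSEQ: "(\<lambda>n. \<Prod>k<n. 1 - q ^ k * y) \<longlonglongrightarrow> qpoch q y"
  using convergent_prod_LIMSEQ[OF convergent_prod_qpoch[of y]] LIMSEQ_lessThan_iff_atMost
  unfolding qpoch_def by blast

lemma qpoch_rec: "qpoch q y = (1 - y) * qpoch q (q * y)"
proof -
  have "(\<lambda>n. \<Prod>k<Suc n. 1 - q ^ k * y) \<longlonglongrightarrow> qpoch q y"
    using qpoch_LIMSEQ by (subst filterlim_sequentially_Suc)
  moreover have "(\<Prod>k<Suc n. 1 - q ^ k * y) = (1 - y) * (\<Prod>k<n. 1 - q ^ k * (q * y))" for n
    by (subst prod.lessThan_Suc_shift) (simp add: mult_ac)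
  moreover have "(\<lambda>n. (1 - y) * (\<Prod>k<n. 1 - q ^ k * (q * y))) \<longlonglongrightarrow> (1 - y) * qpoch q (q * y)"
    by (intro tendsto_mult_left qpoch_LIMSEQ)
  ultimately show ?thesis using LIMSEQ_unique by simp
qed

lemma qpoch_nonzero: "(\<And>n. q ^ n * y \<noteq> 1) \<Longrightarrow> qpoch q y \<noteq> 0"
  unfolding qpoch_def using convergent_prod_qpoch by (rule prodinf_nonzero) (metis eq_iff_diff_eq_0)

lemma holomorphic_qpoch: "qpoch q holomorphic_on UNIV"
proof -
  have "\<exists>e>0. qpoch q holomorphic_on ball z e" for z
  proof -
    have "uniformly_convergent_on (cball z 1) (\<lambda>N y. \<Sum>n<N. norm (- (q ^ n * y)))"
    proof (rule Weierstrass_m_test'[of _ _ "\<lambda>n. norm q ^ n * (norm z + 1)"])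
      fix n y assume "y \<in> cball z 1"
      then have "norm y \<le> norm z + 1"
        using norm_triangle_ineq2[of y z] by (simp add: dist_norm norm_minus_commute)
      then show "norm (norm (- (q ^ n * y))) \<le> norm q ^ n * (norm z + 1)"
        by (auto simp: norm_mult norm_power intro!: mult_left_mono)
    qed (use q in \<open>auto intro!: summable_mult2 summable_geometric\<close>)
    then have "uniformly_convergent_on (cball z 1) (\<lambda>N y. \<Prod>n<N. 1 + (- (q ^ n * y)))"
      by (intro uniformly_convergent_on_prod) (auto intro!: continuous_intros)
    then obtain l where l: "uniform_limit (cball z 1) (\<lambda>N y. \<Prod>n<N. 1 - q ^ n * y) l sequentially"
      unfolding uniformly_convergent_on_def by auto
    have "l y = qpoch q y" if "y \<in> cball z 1" for y
      using LIMSEQ_unique[OF tendsto_uniform_limitI[OF l that] qpoch_LIMSEQ] .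
    then have u: "uniform_limit (cball z 1) (\<lambda>N y. \<Prod>n<N. 1 - q ^ n * y) (qpoch q) sequentially"
      using l unfolding uniform_limit_iff by simp
    have "qpoch q holomorphic_on ball z 1"
      by (rule holomorphic_uniform_limit[OF always_eventually u])
         (auto intro!: continuous_intros holomorphic_intros)
    then show ?thesis by (intro exI[of _ 1]) auto
  qed
  then have "qpoch q analytic_on UNIV" unfolding analytic_on_def by blast
  then show ?thesis by (rule analytic_imp_holomorphic)
qed

end


text \<open>Distinct lattice points are at least \<open>min 1 (Im \<tau>)\<close> apart: the
  imaginary part of their difference is an integer multiple of \<open>Im \<tau>\<close>, and if it
  is 0 the difference is a nonzero integer.\<close>

lemma eventually_not_in_period_lattice:
  assumes "Im \<tau> > 0"
  shows "\<forall>\<^sub>F w in at z. w \<notin> period_lattice \<tau>"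
proof -
  have "\<not> z islimpt period_lattice \<tau>"
  proof (rule discrete_imp_not_islimpt[of "min 1 (Im \<tau>)"])
    fix x y assume xy: "x \<in> period_lattice \<tau>" "y \<in> period_lattice \<tau>" "dist y x < min 1 (Im \<tau>)"
    have "y - x \<in> period_lattice \<tau>" using xy(1,2) by (intro period_lattice_diff)
    then obtain m n where yx: "y - x = of_int m * \<tau> + of_int n" by (rule period_latticeE)
    have "\<bar>of_int m * Im \<tau>\<bar> < Im \<tau>"
      using abs_Im_le_cmod[of "y - x"] xy(3) unfolding yx dist_norm by simp
    then have "\<bar>of_int m\<bar> * Im \<tau> < 1 * Im \<tau>"
      using assms by (simp add: abs_mult)
    then have "\<bar>real_of_int m\<bar> < 1" using assms by (subst (asm) mult_less_cancel_right_pos)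
    then have m: "m = 0" by linarith
    have "\<bar>real_of_int n\<bar> < 1"
      using abs_Re_le_cmod[of "y - x"] xy(3) m unfolding yx dist_norm by simp
    then have "n = 0" by linarith
    with m yx show "y = x" by simp
  qed (use assms in simp)
  then show ?thesis by (simp add: islimpt_iff_eventually)
qed

section \<open>Quasi-periodicity and zeros of the theta functions\<close>

lemma holomorphic_shift:
  assumes "f holomorphic_on UNIV"
  shows "(\<lambda>z. f (z + c)) holomorphic_on A"
proof -
  have "(\<lambda>z. z + c) holomorphic_on A" by (intro holomorphic_intros)
  from holomorphic_on_compose_gen[OF this assms] show ?thesis by (simp add: o_def)
qed

lemma theta2_minus: "theta2 (- z) \<tau> = theta2 z \<tau>"
  unfolding theta2_def by simp

lemma theta4_minus: "theta4 (- z) \<tau> = theta4 z \<tau>"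
  unfolding theta4_def by simp

lemma exp_2_pi_i_of_int [simp]: "exp (2 * of_real pi * \<i> * of_int n) = 1"
  using exp_integer_2pi[of "of_int n"] by (simp add: mult_ac)

lemma exp_2_pi_i_eq_1_iff: "exp (2 * of_real pi * \<i> * z) = 1 \<longleftrightarrow> (\<exists>n. z = of_int n)"
proof
  assume "exp (2 * of_real pi * \<i> * z) = 1"
  then obtain n :: int where n: "Im (2 * of_real pi * \<i> * z) = of_int (2 * n) * pi" "Re (2 * of_real pi * \<i> * z) = 0"
    unfolding exp_eq_1 by auto
  then have "z = of_int n" by (simp add: complex_eq_iff)
  then show "\<exists>n. z = of_int n" ..
qed auto

context
  fixes \<tau> :: complex
  assumes Im_pos: "Im \<tau> > 0"
begin

lemma holomorphic_theta2: "(\<lambda>z. theta2 z \<tau>) holomorphic_on A"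
  unfolding theta2_eq_jtheta[OF Im_pos]
  by (intro holomorphic_intros holomorphic_shift holomorphic_jtheta Im_pos)

lemma holomorphic_theta1: "(\<lambda>z. theta1 z \<tau>) holomorphic_on A"
  using holomorphic_shift[OF holomorphic_theta2, of "- 1 / 2"] by (simp add: theta1_eq_theta2[OF Im_pos])

lemma holomorphic_theta4: "(\<lambda>z. theta4 z \<tau>) holomorphic_on A"
  unfolding theta4_eq_jtheta[OF Im_pos]
  by (intro holomorphic_shift holomorphic_jtheta Im_pos)

lemma theta2_add_1: "theta2 (z + 1) \<tau> = - theta2 z \<tau>"
proof -
  have "jtheta \<tau> (z + 1 + \<tau> / 2) = jtheta \<tau> (z + \<tau> / 2)"
    using jtheta_add_1[of \<tau> "z + \<tau> / 2"] by (simp add: add_ac)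
  moreover have "exp (of_real pi * \<i> * (\<tau> / 4 + (z + 1))) = - exp (of_real pi * \<i> * (\<tau> / 4 + z))"
    by (simp add: exp_add distrib_left)
  ultimately show ?thesis unfolding theta2_eq_jtheta[OF Im_pos] by simp
qed

lemma theta2_add_tau: "theta2 (z + \<tau>) \<tau> = exp (- of_real pi * \<i> * (\<tau> + 2 * z)) * theta2 z \<tau>"
proof -
  have "jtheta \<tau> (z + \<tau> + \<tau> / 2) = exp (- of_real pi * \<i> * (\<tau> + 2 * (z + \<tau> / 2))) * jtheta \<tau> (z + \<tau> / 2)"
    using jtheta_add_tau[OF Im_pos, of "z + \<tau> / 2"] by (simp add: add_ac)
  moreover have "exp (of_real pi * \<i> * (\<tau> / 4 + (z + \<tau>))) * exp (- of_real pi * \<i> * (\<tau> + 2 * (z + \<tau> / 2)))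
    = exp (- of_real pi * \<i> * (\<tau> + 2 * z)) * exp (of_real pi * \<i> * (\<tau> / 4 + z))"
    unfolding exp_add[symmetric] by (rule arg_cong[where f = exp]) (simp add: algebra_simps)
  ultimately show ?thesis unfolding theta2_eq_jtheta[OF Im_pos] by (simp add: mult.assoc[symmetric])
qed

lemma theta1_add_half: "theta1 (z + 1 / 2) \<tau> = theta2 z \<tau>"
  using theta1_eq_theta2[OF Im_pos, of "z + 1 / 2"] by simp

lemma theta2_add_half: "theta2 (z + 1 / 2) \<tau> = - theta1 z \<tau>"
  using theta2_add_1[of "z - 1 / 2"] by (simp add: theta1_eq_theta2[OF Im_pos] add_ac diff_add_eq)

lemma theta1_minus: "theta1 (- z) \<tau> = - theta1 z \<tau>"
  using theta2_add_half[of z] theta2_minus[of "z + 1 / 2" \<tau>] theta1_eq_theta2[OF Im_pos, of "- z"]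
  by simp

lemma theta1_0: "theta1 0 \<tau> = 0"
  using theta1_minus[of 0] by simp

lemma theta1_add_1: "theta1 (z + 1) \<tau> = - theta1 z \<tau>"
  using theta2_add_1[of "z - 1 / 2"] by (simp add: theta1_eq_theta2[OF Im_pos] algebra_simps)

lemma theta1_add_tau: "theta1 (z + \<tau>) \<tau> = - exp (- of_real pi * \<i> * (\<tau> + 2 * z)) * theta1 z \<tau>"
proof -
  have "exp (- of_real pi * \<i> * (\<tau> + 2 * (z - 1 / 2))) = - exp (- of_real pi * \<i> * (\<tau> + 2 * z))"
  proof -
    have "- of_real pi * \<i> * (\<tau> + 2 * (z - 1 / 2)) = - of_real pi * \<i> * (\<tau> + 2 * z) + of_real pi * \<i>"
      by (simp add: algebra_simps)
    then show ?thesis by (simp only: exp_add exp_pi_i) simp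
  qed
  then show ?thesis
    using theta2_add_tau[of "z - 1 / 2"] by (simp add: theta1_eq_theta2[OF Im_pos] algebra_simps)
qed

lemma theta4_add_1: "theta4 (z + 1) \<tau> = theta4 z \<tau>"
  using jtheta_add_1[of \<tau> "z + 1 / 2"] by (simp add: theta4_eq_jtheta[OF Im_pos] add_ac)

lemma theta4_add_tau: "theta4 (z + \<tau>) \<tau> = - exp (- of_real pi * \<i> * (\<tau> + 2 * z)) * theta4 z \<tau>"
proof -
  have "exp (- of_real pi * \<i> * (\<tau> + 2 * (z + 1 / 2))) = - exp (- of_real pi * \<i> * (\<tau> + 2 * z))"
  proof -
    have "- of_real pi * \<i> * (\<tau> + 2 * (z + 1 / 2)) = - of_real pi * \<i> * (\<tau> + 2 * z) - of_real pi * \<i>"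
      by (simp add: algebra_simps)
    then show ?thesis by (simp only: exp_diff exp_pi_i) simp
  qed
  then show ?thesis
    using jtheta_add_tau[OF Im_pos, of "z + 1 / 2"] by (simp add: theta4_eq_jtheta[OF Im_pos] add_ac)
qed

lemma theta1_half_tau: "theta1 (\<tau> / 2) \<tau> = \<i> * exp (- of_real pi * \<i> * \<tau> / 4) * theta4 0 \<tau>"
proof -
  have "jtheta \<tau> (\<tau> / 2 - 1 / 2 + \<tau> / 2) = jtheta \<tau> (- 1 / 2 + \<tau>)" by (simp add: algebra_simps)
  also have "\<dots> = exp (- of_real pi * \<i> * (\<tau> - 1)) * jtheta \<tau> (- 1 / 2)"
    by (subst jtheta_add_tau[OF Im_pos]) simp
  also have "jtheta \<tau> (- 1 / 2) = theta4 0 \<tau>"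
    using jtheta_minus[of \<tau> "1 / 2"] by (simp add: theta4_eq_jtheta[OF Im_pos])
  finally have j: "jtheta \<tau> (\<tau> / 2 - 1 / 2 + \<tau> / 2) = exp (- of_real pi * \<i> * (\<tau> - 1)) * theta4 0 \<tau>" .
  have "exp (of_real pi * \<i> * (\<tau> / 4 + (\<tau> / 2 - 1 / 2))) * exp (- of_real pi * \<i> * (\<tau> - 1))
     = exp (of_real pi / 2 * \<i> + - of_real pi * \<i> * \<tau> / 4)"
    unfolding exp_add[symmetric] by (rule arg_cong[where f = exp]) (simp add: field_simps)
  also have "\<dots> = exp (of_real pi / 2 * \<i>) * exp (- of_real pi * \<i> * \<tau> / 4)" by (rule exp_add)
  also have "exp (of_real pi / 2 * \<i>) = \<i>"
    using cis_pi_half unfolding cis_conv_exp by (simp add: mult.commute)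
  finally show ?thesis
    unfolding theta1_eq_theta2[OF Im_pos] theta2_eq_jtheta[OF Im_pos] j
    by (simp add: mult.assoc[symmetric])
qed

lemma theta2_half_tau: "theta2 (\<tau> / 2) \<tau> = exp (- of_real pi * \<i> * \<tau> / 4) * theta3 0 \<tau>"
proof -
  have "jtheta \<tau> (\<tau> / 2 + \<tau> / 2) = exp (- of_real pi * \<i> * \<tau>) * theta3 0 \<tau>"
    using jtheta_add_tau[OF Im_pos, of 0] by (simp add: theta3_eq_jtheta[OF Im_pos])
  moreover have "exp (of_real pi * \<i> * (\<tau> / 4 + \<tau> / 2)) * exp (- of_real pi * \<i> * \<tau>) = exp (- of_real pi * \<i> * \<tau> / 4)"
    unfolding exp_add[symmetric] by (rule arg_cong[where f = exp]) (simp add: field_simps)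
  ultimately show ?thesis
    unfolding theta2_eq_jtheta[OF Im_pos] by (simp add: mult.assoc[symmetric])
qed

lemma theta4_half: "theta4 (1 / 2) \<tau> = theta3 0 \<tau>"
  using jtheta_add_1[of \<tau> 0] by (simp add: theta4_eq_jtheta[OF Im_pos] theta3_eq_jtheta[OF Im_pos])

lemma theta4_half_tau_half: "theta4 (\<tau> / 2 + 1 / 2) \<tau> = exp (- of_real pi * \<i> * \<tau> / 4) * theta2 0 \<tau>"
proof -
  have "theta4 (\<tau> / 2 + 1 / 2) \<tau> = jtheta \<tau> (\<tau> / 2)"
    using jtheta_add_1[of \<tau> "\<tau> / 2"] by (simp add: theta4_eq_jtheta[OF Im_pos] add_ac)
  then show ?thesis
    by (simp add: theta2_eq_jtheta[OF Im_pos] mult.assoc[symmetric] exp_add[symmetric])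
qed

text \<open>
  The constant \<open>k\<close> of the Jacobi product need not be computed: the quotient of the series by the product is
  elliptic without poles, and it cannot vanish because the series is not identically zero.
\<close>

lemma theta1_product:
  obtains k :: complex and B :: "complex \<Rightarrow> complex" where
    "k \<noteq> 0" "\<And>z. z \<notin> period_lattice \<tau> \<Longrightarrow> B z \<noteq> 0" "B 0 \<noteq> 0" "B holomorphic_on UNIV"
    "\<And>z. z \<notin> period_lattice \<tau> \<Longrightarrow>
       exp (of_real pi * \<i> * z) * theta1 z \<tau> = k * (1 - exp (2 * of_real pi * \<i> * z)) * B z"
proof -
  define q where "q = exp (2 * of_real pi * \<i> * \<tau>)"
  define y where "y = (\<lambda>z. exp (2 * of_real pi * \<i> * z))"
  \<comment> \<open>\<open>B\<close> is the product \<open>P\<close> with its factor 1 - y taken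
    out. It does not vanish at 0, so the explicit factor shows that the zero of
    \<open>theta1\<close> at 0 is simple.\<close>
  define B where "B = (\<lambda>z. qpoch q (q * y z) * qpoch q (q / y z))"
  define P where "P = (\<lambda>z. qpoch q (y z) * qpoch q (q / y z))"
  \<comment> \<open>The exponential turns the sign change of \<open>theta1\<close> under z -> z + 1
    into periodicity, so that \<open>M\<close> and \<open>P\<close> acquire the same multipliers
    under both translations.\<close>
  define M where "M = (\<lambda>z. exp (of_real pi * \<i> * z) * theta1 z \<tau>)"
  have q: "norm q < 1" unfolding q_def using Im_pos by simp
  have [simp]: "y z \<noteq> 0" for z unfolding y_def by simp
  have [simp]: "q \<noteq> 0" unfolding q_def by simp
  have holq: "(\<lambda>z. qpoch q (g z)) holomorphic_on UNIV" if "g holomorphic_on UNIV" for g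
    using holomorphic_on_compose_gen[OF that holomorphic_qpoch[OF q]] by (simp add: o_def)
  have hol: "B holomorphic_on UNIV" "P holomorphic_on UNIV" "M holomorphic_on UNIV"
    unfolding B_def P_def M_def y_def
    by (auto intro!: holomorphic_intros holq holomorphic_theta1)
  have PB: "P z = (1 - y z) * B z" for z
    unfolding P_def B_def using qpoch_rec[OF q, of "y z"] by simp
  \<comment> \<open>Each factor of the product is thereby 1 - y(w) with w congruent to z or -z, so a
    vanishing factor would place z in the lattice.\<close>
  have qy: "q ^ n * y z = y (of_nat n * \<tau> + z)" for n z
    unfolding q_def y_def by (simp add: exp_of_nat_mult[symmetric] exp_add[symmetric] algebra_simps)
  have qy': "q ^ n / y z = y (of_nat n * \<tau> - z)" for n z
    unfolding q_def y_def by (simp add: exp_of_nat_mult[symmetric] exp_diff[symmetric] algebra_simps)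
  have y1: "y w \<noteq> 1" if "w \<notin> period_lattice \<tau>" for w
  proof
    assume "y w = 1"
    then obtain n where "w = of_int n" unfolding y_def exp_2_pi_i_eq_1_iff by blast
    with that period_latticeI[of 0 \<tau> n] show False by simp
  qed
  have P0: "P z \<noteq> 0" if z: "z \<notin> period_lattice \<tau>" for z
  proof -
    have "qpoch q (y z) \<noteq> 0"
    proof (rule qpoch_nonzero[OF q])
      fix n
      have "of_nat n * \<tau> + z \<notin> period_lattice \<tau>"
        using z period_lattice_diff[of "of_nat n * \<tau> + z" \<tau> "of_nat n * \<tau>"] period_latticeI[of "int n" \<tau> 0] by auto
      then show "q ^ n * y z \<noteq> 1" unfolding qy by (rule y1)
    qed
    moreover have "qpoch q (q / y z) \<noteq> 0"
    proof (rule qpoch_nonzero[OF q])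
      fix n
      have "of_nat (Suc n) * \<tau> - z \<notin> period_lattice \<tau>"
        using z period_lattice_diff[of "of_nat (Suc n) * \<tau>" \<tau> "of_nat (Suc n) * \<tau> - z"] period_latticeI[of "int (Suc n)" \<tau> 0] by auto
      then show "q ^ n * (q / y z) \<noteq> 1" using y1[of "of_nat (Suc n) * \<tau> - z"] qy'[of "Suc n" z] by (simp add: mult.commute)
    qed
    ultimately show ?thesis unfolding P_def by simp
  qed
  have B0: "B z \<noteq> 0" if "z \<notin> period_lattice \<tau>" for z using P0[OF that] PB[of z] by auto
  have B00: "B 0 \<noteq> 0"
  proof -
    have "qpoch q q \<noteq> 0"
    proof (rule qpoch_nonzero[OF q])
      fix n
      have "norm (q ^ Suc n) < 1" using power_Suc_less_one[of "norm q" n] q by (simp add: norm_power norm_mult)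
      then show "q ^ n * q \<noteq> 1" by (auto simp: mult.commute)
    qed
    then show ?thesis unfolding B_def y_def by simp
  qed
  have yper: "y (z + 1) = y z" "y (z + \<tau>) = q * y z" for z
    unfolding y_def q_def by (simp_all add: distrib_left exp_add)
  have "P (z + 1) = P z" for z unfolding P_def by (simp add: yper)
  have P\<tau>: "P (z + \<tau>) = - inverse (y z) * P z" for z
  proof -
    have 1: "qpoch q (y z) = (1 - y z) * qpoch q (q * y z)" by (rule qpoch_rec[OF q])
    have 2: "qpoch q (1 / y z) = (1 - 1 / y z) * qpoch q (q / y z)" using qpoch_rec[OF q, of "1 / y z"] by simp
    show ?thesis unfolding P_def yper by (simp add: 1 2 field_simps)
  qed
  have M1: "M (z + 1) = M z" for z
    unfolding M_def theta1_add_1 by (simp add: distrib_left exp_add)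
  have M\<tau>: "M (z + \<tau>) = - inverse (y z) * M z" for z
  proof -
    have "exp (of_real pi * \<i> * (z + \<tau>)) * exp (- of_real pi * \<i> * (\<tau> + 2 * z)) = inverse (y z) * exp (of_real pi * \<i> * z)"
      unfolding y_def exp_minus[symmetric] exp_add[symmetric] by (rule arg_cong[where f = exp]) (simp add: algebra_simps)
    then show ?thesis unfolding M_def theta1_add_tau by (simp add: mult.assoc[symmetric])
  qed
  define T where "T = (\<lambda>z. M z / P z)"
  have T1: "T (z + 1) = T z" for z unfolding T_def by (simp add: M1 \<open>P (z + 1) = P z\<close>)
  have T\<tau>: "T (z + \<tau>) = T z" for z unfolding T_def by (simp add: M\<tau> P\<tau>)
  have cont: "isCont f z" if "f holomorphic_on UNIV" for f :: "complex \<Rightarrow> complex" and z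
    using that by (meson UNIV_I continuous_on_eq_continuous_at holomorphic_on_imp_continuous_on open_UNIV)
  have lim_off: "(T \<longlongrightarrow> T z) (at z)" if "z \<notin> period_lattice \<tau>" for z
    unfolding T_def using cont[OF hol(2), of z] cont[OF hol(3), of z] P0[OF that]
    by (intro tendsto_divide) (auto simp: isCont_def)
  have dy: "((\<lambda>z. (1 - y z) / z) \<longlongrightarrow> - (2 * of_real pi * \<i>)) (at 0)"
  proof -
    have "((\<lambda>z. 1 - y z) has_field_derivative - (2 * of_real pi * \<i>)) (at 0)"
      unfolding y_def by (auto intro!: derivative_eq_intros)
    then show ?thesis unfolding has_field_derivative_iff by (simp add: y_def)
  qed
  have lim_0: "(T \<longlongrightarrow> deriv M 0 / (- (2 * of_real pi * \<i>) * B 0)) (at 0)"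
  proof -
    have "(M has_field_derivative deriv M 0) (at 0)"
      using hol(3) by (auto intro: holomorphic_derivI)
    then have "((\<lambda>z. M z / z) \<longlongrightarrow> deriv M 0) (at 0)"
      unfolding has_field_derivative_iff by (simp add: M_def theta1_0)
    then have "((\<lambda>z. (M z / z) / ((1 - y z) / z * B z)) \<longlongrightarrow> deriv M 0 / (- (2 * of_real pi * \<i>) * B 0)) (at 0)"
      using B00 cont[OF hol(1), of 0] dy by (intro tendsto_intros) (auto simp: isCont_def)
    then show ?thesis
      by (rule Lim_transform_eventually) (auto simp: eventually_at T_def PB intro!: exI[of _ 1])
  qed
  have ana: "f meromorphic_on UNIV" if "f holomorphic_on UNIV" for f
    using that by (intro analytic_on_imp_meromorphic_on) (simp add: analytic_on_open)
  have "T meromorphic_on UNIV"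
    unfolding T_def by (intro meromorphic_intros ana hol)
  from elliptic_regular_constant[OF Im_pos this T1 T\<tau> lim_0 lim_off]
  obtain k where Tk: "\<And>z. z \<notin> period_lattice \<tau> \<Longrightarrow> T z = k" by blast
  have eq: "M z = k * (1 - y z) * B z" if "z \<notin> period_lattice \<tau>" for z
    using Tk[OF that] P0[OF that] PB[of z] by (simp add: T_def divide_eq_eq)
  have "k \<noteq> 0"
  proof
    assume "k = 0"
    then have Z: "M z = 0" if "z \<notin> period_lattice \<tau>" for z using eq[OF that] by simp
    have Z': "M z = 0" for z
    proof -
      have "(M \<longlongrightarrow> M z) (at z)" using cont[OF hol(3)] by (simp add: isCont_def)
      moreover have "(M \<longlongrightarrow> 0) (at z)"
        by (rule tendsto_eventually, rule eventually_mono[OF eventually_not_in_period_lattice[OF Im_pos]]) (rule Z)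
      ultimately show ?thesis by (intro tendsto_unique[of "at z"]) auto
    qed
    have "jtheta \<tau> z = 0" for z
    proof -
      \<comment> \<open>The shift by 1/2 leads from \<open>theta1\<close> to \<open>theta2\<close>,
        and the shift by -\<tau>/2 undoes the one by which \<open>theta2\<close> differs from
        \<open>jtheta\<close>.\<close>
      have "theta1 (z - \<tau> / 2 + 1 / 2) \<tau> = 0" using Z'[of "z - \<tau> / 2 + 1 / 2"] unfolding M_def by simp
      then show ?thesis unfolding theta1_add_half theta2_eq_jtheta[OF Im_pos] by simp
    qed
    then show False using jtheta_nontrivial[OF Im_pos] by blast
  qed
  then show ?thesis
    using that[of k B] B0 B00 hol(1) eq unfolding M_def y_def by blast
qed

end

text \<open>\<open>P\<close> is the region in which the translation law is valid. Its invariance in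
  both directions is what lets the induction pass to negative multiples of the period.\<close>

lemma shift_int_add_on:
  fixes f :: "complex \<Rightarrow> complex" and \<omega> C :: complex
  assumes P: "\<And>z. P (z + \<omega>) \<longleftrightarrow> P z" and f: "\<And>z. P z \<Longrightarrow> f (z + \<omega>) = f z + C" and z: "P z"
  shows "P (z + of_int n * \<omega>) \<and> f (z + of_int n * \<omega>) = f z + of_int n * C"
proof (induction n rule: int_induct[of _ 0])
  case base
  then show ?case using z by simp
next
  case (step1 i)
  then show ?case using f[of "z + of_int i * \<omega>"] P[of "z + of_int i * \<omega>"] by (simp add: algebra_simps)
next
  case (step2 i)
  then show ?case using f[of "z + of_int (i - 1) * \<omega>"] P[of "z + of_int (i - 1) * \<omega>"]
    by (simp add: algebra_simps)
qed

lemma shift_int_uminus: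
  fixes f :: "complex \<Rightarrow> complex" and \<omega> :: complex
  assumes "\<And>z. f (z + \<omega>) = - f z"
  shows "f (z + of_int n * \<omega>) = (-1) powi n * f z"
proof (induction n rule: int_induct[of _ 0])
  case (step1 i)
  then show ?case using assms[of "z + of_int i * \<omega>"] by (simp add: algebra_simps power_int_add)
next
  case (step2 i)
  then show ?case using assms[of "z + of_int (i - 1) * \<omega>"] by (simp add: algebra_simps power_int_diff)
qed simp

lemma period_lattice_add_period_iff:
  "z + \<tau> \<in> period_lattice \<tau> \<longleftrightarrow> z \<in> period_lattice \<tau>"
  "z + 1 \<in> period_lattice \<tau> \<longleftrightarrow> z \<in> period_lattice \<tau>"
proof -
  have "\<tau> \<in> period_lattice \<tau>" "1 \<in> period_lattice \<tau>"
    using period_latticeI[of 1 \<tau> 0] period_latticeI[of 0 \<tau> 1] by auto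
  note L = this
  show "z + \<tau> \<in> period_lattice \<tau> \<longleftrightarrow> z \<in> period_lattice \<tau>"
    using period_lattice_add[OF _ L(1), of z] period_lattice_diff[OF _ L(1), of "z + \<tau>"] by fastforce
  show "z + 1 \<in> period_lattice \<tau> \<longleftrightarrow> z \<in> period_lattice \<tau>"
    using period_lattice_add[OF _ L(2), of z] period_lattice_diff[OF _ L(2), of "z + 1"] by fastforce
qed

lemma isCont_entire:
  fixes f :: "complex \<Rightarrow> complex"
  assumes "f holomorphic_on UNIV"
  shows "isCont f z"
  using assms by (meson UNIV_I continuous_on_eq_continuous_at holomorphic_on_imp_continuous_on open_UNIV)

lemma entire_imp_analytic:
  fixes f :: "complex \<Rightarrow> complex"
  assumes "f holomorphic_on UNIV"
  shows "f analytic_on A"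
  using assms analytic_on_open analytic_on_subset by blast

lemma analytic_tendsto:
  fixes f :: "complex \<Rightarrow> complex"
  assumes "f analytic_on {z}"
  shows "(f \<longlongrightarrow> f z) (at z)"
  using analytic_at_imp_isCont[OF assms] by (simp add: isCont_def)

text \<open>Used in place of Taylor series: each application peels off one coefficient and leaves an
  analytic remainder. The factorisation holds for every z, also outside the domain of analyticity,
  because \<open>h1\<close> is the difference quotient everywhere except at a.\<close>

lemma analytic_divided_difference:
  fixes h :: "complex \<Rightarrow> complex"
  assumes "h analytic_on {a}"
  obtains h1 where "h1 analytic_on {a}" "\<And>z. h z = h a + (z - a) * h1 z"
proof -
  obtain S where S: "open S" "a \<in> S" "h holomorphic_on S" using assms by (auto simp: analytic_at)
  define h1 where "h1 = (\<lambda>z. if z = a then deriv h a else (h z - h a) / (z - a))"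
  have "h1 holomorphic_on S" unfolding h1_def by (rule pole_lemma_open[OF S(3,1)])
  then have "h1 analytic_on {a}" using S by (auto simp: analytic_at)
  moreover have "h z = h a + (z - a) * h1 z" for z by (simp add: h1_def)
  ultimately show ?thesis using that by blast
qed

lemma deriv_shift_quasi_periodic:
  fixes f :: "complex \<Rightarrow> complex"
  assumes "f analytic_on {z}" "\<forall>\<^sub>F w in nhds z. f (w + \<omega>) = f w + C"
  shows "deriv f (z + \<omega>) = deriv f z"
proof -
  have "(f has_field_derivative deriv f z) (at z)"
    using assms(1) analytic_on_imp_differentiable_at field_differentiable_derivI by blast
  then have "((\<lambda>w. f w + C) has_field_derivative deriv f z) (at z)"
    by (auto intro!: derivative_eq_intros)
  then have "((\<lambda>w. f (w + \<omega>)) has_field_derivative deriv f z) (at z)"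
    using assms(2) by (subst DERIV_cong_ev[OF refl _ refl]) auto
  then show ?thesis using DERIV_shift[of f _ z \<omega>] by (intro DERIV_imp_deriv) simp
qed

context
  fixes \<tau> :: complex
  assumes Im_pos: "Im \<tau> > 0"
begin

lemma open_Compl_period_lattice: "open (- period_lattice \<tau>)"
proof -
  have "closed (period_lattice \<tau>)"
    unfolding closed_limpt using eventually_not_in_period_lattice[OF Im_pos]
    by (auto simp: islimpt_iff_eventually)
  then show ?thesis by (simp add: open_Compl)
qed

lemma exp_ne_1_off_period_lattice:
  assumes "z \<notin> period_lattice \<tau>"
  shows "exp (2 * of_real pi * \<i> * z) \<noteq> 1"
  using assms period_latticeI[of 0 \<tau>] by (auto simp: exp_2_pi_i_eq_1_iff)

text \<open>Off the lattice no factor of the product formula vanishes; on the lattice the zero at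
  the origin is propagated by quasi-periodicity.\<close>

lemma theta1_eq_0_iff: "theta1 z \<tau> = 0 \<longleftrightarrow> z \<in> period_lattice \<tau>"
proof
  obtain k B where "k \<noteq> 0" "\<And>z. z \<notin> period_lattice \<tau> \<Longrightarrow> B z \<noteq> 0"
    and eq: "\<And>z. z \<notin> period_lattice \<tau> \<Longrightarrow>
       exp (of_real pi * \<i> * z) * theta1 z \<tau> = k * (1 - exp (2 * of_real pi * \<i> * z)) * B z"
    using theta1_product[OF Im_pos] by metis
  moreover assume "theta1 z \<tau> = 0"
  ultimately show "z \<in> period_lattice \<tau>"
    using exp_ne_1_off_period_lattice[of z] by (metis eq_iff_diff_eq_0 mult_eq_0_iff)
next
  assume "z \<in> period_lattice \<tau>"
  then obtain m n where z: "z = of_int m * \<tau> + of_int n" by (rule period_latticeE)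
  \<comment> \<open>\<open>shift_int\<close> is applied to the truth value of the equation: the
    multipliers of \<open>theta1\<close> are never zero, so being a zero is strictly periodic
    although \<open>theta1\<close> is not.\<close>
  have "(theta1 (0 + of_int m * \<tau> + of_int n * 1) \<tau> = 0) = (theta1 (0 + of_int m * \<tau>) \<tau> = 0)"
    by (rule shift_int) (simp add: theta1_add_1[OF Im_pos])
  also have "\<dots> = (theta1 0 \<tau> = 0)"
    by (rule shift_int) (simp add: theta1_add_tau[OF Im_pos])
  finally show "theta1 z \<tau> = 0" by (simp add: z theta1_0[OF Im_pos])
qed

section \<open>The simple zero of theta1 at the origin and the theta constants\<close>

definition theta1_quot :: "complex \<Rightarrow> complex" where
  "theta1_quot z = (if z = 0 then deriv (\<lambda>z. theta1 z \<tau>) 0 else theta1 z \<tau> / z)"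

lemma theta1_quot: "theta1 z \<tau> = z * theta1_quot z"
  by (simp add: theta1_quot_def theta1_0[OF Im_pos])

lemma holomorphic_theta1_quot: "theta1_quot holomorphic_on UNIV"
  using pole_lemma_open[OF holomorphic_theta1[OF Im_pos], of UNIV 0]
  by (simp add: theta1_quot_def[abs_def] theta1_0[OF Im_pos] cong: if_cong)

lemma theta1_quot_minus: "theta1_quot (- z) = theta1_quot z"
  by (simp add: theta1_quot_def theta1_minus[OF Im_pos])

text \<open>The zero at the origin is simple. In the product formula only 1 - exp(2 \<pi> i z)
  vanishes there, with derivative -2 \<pi> i; dividing by z and passing to the limit leaves nonzero
  factors.\<close>

lemma theta1_quot_0: "theta1_quot 0 \<noteq> 0"
proof -
  obtain k B where k: "k \<noteq> 0" "B 0 \<noteq> 0" "B holomorphic_on UNIV"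
    and eq: "\<And>z. z \<notin> period_lattice \<tau> \<Longrightarrow>
       exp (of_real pi * \<i> * z) * theta1 z \<tau> = k * (1 - exp (2 * of_real pi * \<i> * z)) * B z"
    using theta1_product[OF Im_pos] by metis
  have "((\<lambda>z. 1 - exp (2 * of_real pi * \<i> * z)) has_field_derivative - (2 * of_real pi * \<i>)) (at 0)"
    by (auto intro!: derivative_eq_intros)
  then have "((\<lambda>z. (1 - exp (2 * of_real pi * \<i> * z)) / z) \<longlongrightarrow> - (2 * of_real pi * \<i>)) (at 0)"
    unfolding has_field_derivative_iff by simp
  then have 1: "((\<lambda>z. k * ((1 - exp (2 * of_real pi * \<i> * z)) / z) * B z) \<longlongrightarrow> k * (- (2 * of_real pi * \<i>)) * B 0) (at 0)"
    using isCont_entire[OF k(3), of 0] by (intro tendsto_intros) (auto simp: isCont_def)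
  have "((\<lambda>z. exp (of_real pi * \<i> * z) * theta1_quot z) \<longlongrightarrow> exp (of_real pi * \<i> * 0) * theta1_quot 0) (at 0)"
    using isCont_entire[OF holomorphic_theta1_quot, of 0] by (intro tendsto_intros) (auto simp: isCont_def)
  moreover have "\<forall>\<^sub>F z in at 0. exp (of_real pi * \<i> * z) * theta1_quot z = k * ((1 - exp (2 * of_real pi * \<i> * z)) / z) * B z"
    using eventually_not_in_period_lattice[OF Im_pos]
  proof eventually_elim
    case (elim z)
    then have "z \<noteq> 0" by auto
    with eq[OF elim] show ?case by (simp add: theta1_quot_def field_simps)
  qed
  ultimately have "((\<lambda>z. k * ((1 - exp (2 * of_real pi * \<i> * z)) / z) * B z) \<longlongrightarrow> exp (of_real pi * \<i> * 0) * theta1_quot 0) (at 0)"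
    by (rule Lim_transform_eventually)
  then have "exp (of_real pi * \<i> * 0) * theta1_quot 0 = k * (- (2 * of_real pi * \<i>)) * B 0"
    by (rule tendsto_unique[OF _ _ 1, rotated]) simp
  with k show ?thesis by simp
qed

lemma half_periods_not_in_period_lattice:
  "1 / 2 \<notin> period_lattice \<tau>" "\<tau> / 2 \<notin> period_lattice \<tau>" "\<tau> / 2 + 1 / 2 \<notin> period_lattice \<tau>"
proof -
  have h: "(1 / 2 :: real) \<notin> \<int>"
  proof
    assume "(1 / 2 :: real) \<in> \<int>"
    then obtain n where "(1 / 2 :: real) = of_int n" by (auto elim: Ints_cases)
    then have "2 * n = 1" by linarith
    then show False by presburger
  qed
  show "1 / 2 \<notin> period_lattice \<tau>" "\<tau> / 2 \<notin> period_lattice \<tau>" "\<tau> / 2 + 1 / 2 \<notin> period_lattice \<tau>"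
    using real_coords_in_period_lattice_iff[OF Im_pos, of 0 "1/2"] real_coords_in_period_lattice_iff[OF Im_pos, of "1/2" 0]
      real_coords_in_period_lattice_iff[OF Im_pos, of "1/2" "1/2"] h by simp_all
qed

text \<open>Up to nonzero factors, the three theta constants are the values of \<open>theta1\<close>
  at the three half periods, none of which is a lattice point.\<close>

lemma theta2_0_nonzero: "theta2 0 \<tau> \<noteq> 0"
  using theta1_eq_0_iff[of "1 / 2"] half_periods_not_in_period_lattice(1) theta1_add_half[OF Im_pos, of 0] by simp

lemma theta3_0_nonzero: "theta3 0 \<tau> \<noteq> 0"
  using theta1_eq_0_iff[of "\<tau> / 2 + 1 / 2"] half_periods_not_in_period_lattice(3)
    theta1_add_half[OF Im_pos, of "\<tau> / 2"] theta2_half_tau[OF Im_pos] by auto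

lemma theta4_0_nonzero: "theta4 0 \<tau> \<noteq> 0"
  using theta1_eq_0_iff[of "\<tau> / 2"] half_periods_not_in_period_lattice(2) theta1_half_tau[OF Im_pos] by auto

section \<open>The logarithmic derivative of theta1\<close>

text \<open>It differs from the Weierstrass zeta function by a linear term, chosen such that the
  increment under 1 is 0; the whole quasi-periodicity, -2 \<pi> i, is thus carried by
  \<tau>.\<close>

definition theta1_logderiv :: "complex \<Rightarrow> complex" where
  "theta1_logderiv z = deriv (\<lambda>z. theta1 z \<tau>) z / theta1 z \<tau>"

lemma analytic_theta1_logderiv:
  assumes "z \<notin> period_lattice \<tau>"
  shows "theta1_logderiv analytic_on {z}"
  unfolding theta1_logderiv_def[abs_def] using assms theta1_eq_0_iff[of z]
  by (intro analytic_intros entire_imp_analytic holomorphic_deriv holomorphic_theta1[OF Im_pos]) auto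

lemma meromorphic_theta1_logderiv: "theta1_logderiv meromorphic_on UNIV"
  unfolding theta1_logderiv_def[abs_def]
  by (intro meromorphic_intros analytic_on_imp_meromorphic_on entire_imp_analytic holomorphic_deriv holomorphic_theta1[OF Im_pos]) auto

lemma theta1_logderiv_add_1: "theta1_logderiv (z + 1) = theta1_logderiv z"
proof -
  let ?\<theta> = "\<lambda>z. theta1 z \<tau>"
  have d: "(?\<theta> has_field_derivative deriv ?\<theta> z) (at z)" for z
    by (rule holomorphic_derivI[OF holomorphic_theta1[OF Im_pos, of UNIV]]) auto
  have "((\<lambda>w. ?\<theta> (w + 1)) has_field_derivative deriv ?\<theta> (z + 1)) (at z)"
    using d[of "z + 1"] DERIV_shift[of ?\<theta> _ z 1] by simp
  moreover have "((\<lambda>w. ?\<theta> (w + 1)) has_field_derivative - deriv ?\<theta> z) (at z)"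
    unfolding theta1_add_1[OF Im_pos] by (intro derivative_intros d)
  ultimately have "deriv ?\<theta> (z + 1) = - deriv ?\<theta> z" by (rule DERIV_unique)
  then show ?thesis unfolding theta1_logderiv_def theta1_add_1[OF Im_pos] by simp
qed

lemma theta1_logderiv_add_tau:
  assumes "z \<notin> period_lattice \<tau>"
  shows "theta1_logderiv (z + \<tau>) = theta1_logderiv z - 2 * of_real pi * \<i>"
proof -
  let ?\<theta> = "\<lambda>z. theta1 z \<tau>"
  let ?e = "\<lambda>z. exp (- of_real pi * \<i> * (\<tau> + 2 * z))"
  have d: "(?\<theta> has_field_derivative deriv ?\<theta> z) (at z)" for z
    by (rule holomorphic_derivI[OF holomorphic_theta1[OF Im_pos, of UNIV]]) auto
  have "((\<lambda>w. ?\<theta> (w + \<tau>)) has_field_derivative deriv ?\<theta> (z + \<tau>)) (at z)"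
    using d[of "z + \<tau>"] DERIV_shift[of ?\<theta> _ z \<tau>] by simp
  moreover have "((\<lambda>w. ?\<theta> (w + \<tau>)) has_field_derivative
      - ?e z * deriv ?\<theta> z + 2 * of_real pi * \<i> * ?e z * ?\<theta> z) (at z)"
    unfolding theta1_add_tau[OF Im_pos] by (auto intro!: derivative_eq_intros d)
  ultimately have "deriv ?\<theta> (z + \<tau>) = - ?e z * deriv ?\<theta> z + 2 * of_real pi * \<i> * ?e z * ?\<theta> z"
    by (rule DERIV_unique)
  moreover have "?\<theta> z \<noteq> 0" using assms theta1_eq_0_iff by simp
  ultimately show ?thesis
    unfolding theta1_logderiv_def theta1_add_tau[OF Im_pos] by (simp add: field_simps)
qed

text \<open>With \<open>theta1\<close> written as z D(z) and D(0) \<noteq> 0, the logarithmic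
  derivative is 1/z + D'/D, where D'/D is analytic near 0. Two differentiations give 2/z^3 plus an
  analytic function.\<close>

lemma theta1_logderiv_local:
  "\<exists>L. ((\<lambda>z. theta1_logderiv z - 1 / z) \<longlongrightarrow> L) (at 0)"
  "\<exists>L. ((\<lambda>z. deriv (deriv theta1_logderiv) z - 2 / z ^ 3) \<longlongrightarrow> L) (at 0)"
proof -
  let ?D = theta1_quot
  obtain r where r: "r > 0" "\<And>z. dist 0 z < r \<Longrightarrow> ?D z \<noteq> 0"
    using continuous_at_avoid[OF isCont_entire[OF holomorphic_theta1_quot] theta1_quot_0] by auto
  define h where "h = (\<lambda>z. deriv ?D z / ?D z)"
  let ?S = "ball 0 r - {0 :: complex}"
  have S: "open ?S" by auto
  have h: "h holomorphic_on ball 0 r"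
    unfolding h_def using r
    by (intro holomorphic_intros holomorphic_on_subset[OF holomorphic_deriv[OF holomorphic_theta1_quot]]
        holomorphic_on_subset[OF holomorphic_theta1_quot]) auto
  have h': "deriv h holomorphic_on ball 0 r" by (rule holomorphic_deriv[OF h]) auto
  have h'': "deriv (deriv h) holomorphic_on ball 0 r" by (rule holomorphic_deriv[OF h']) auto
  have dD: "(?D has_field_derivative deriv ?D z) (at z)" for z
    by (rule holomorphic_derivI[OF holomorphic_theta1_quot]) auto
  have Z: "theta1_logderiv z = 1 / z + h z" if "z \<in> ?S" for z
  proof -
    have "((\<lambda>z. z * ?D z) has_field_derivative z * deriv ?D z + ?D z) (at z)"
      by (auto intro!: derivative_eq_intros dD)
    then have "deriv (\<lambda>z. theta1 z \<tau>) z = z * deriv ?D z + ?D z"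
      unfolding theta1_quot by (rule DERIV_imp_deriv)
    with that r show ?thesis
      unfolding theta1_logderiv_def h_def theta1_quot by (simp add: field_simps)
  qed
  have dh: "(h has_field_derivative deriv h z) (at z)" if "z \<in> ?S" for z
    using that by (intro holomorphic_derivI[OF h]) auto
  have dh': "(deriv h has_field_derivative deriv (deriv h) z) (at z)" if "z \<in> ?S" for z
    using that by (intro holomorphic_derivI[OF h']) auto
  have Z': "deriv theta1_logderiv z = - 1 / z ^ 2 + deriv h z" if "z \<in> ?S" for z
  proof -
    have "((\<lambda>z. 1 / z + h z) has_field_derivative - 1 / z ^ 2 + deriv h z) (at z)"
      using that by (auto intro!: derivative_eq_intros dh simp: power2_eq_square)
    from has_field_derivative_transform_within_open[OF this S that] Z show ?thesis
      by (intro DERIV_imp_deriv) auto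
  qed
  have Z'': "deriv (deriv theta1_logderiv) z = 2 / z ^ 3 + deriv (deriv h) z" if "z \<in> ?S" for z
  proof -
    have "((\<lambda>z. - 1 / z ^ 2 + deriv h z) has_field_derivative 2 / z ^ 3 + deriv (deriv h) z) (at z)"
      using that by (auto intro!: derivative_eq_intros dh' simp: field_simps eval_nat_numeral)
    from has_field_derivative_transform_within_open[OF this S that] Z' show ?thesis
      by (intro DERIV_imp_deriv) auto
  qed
  have ev: "\<forall>\<^sub>F z in at 0. z \<in> ?S" using r by (intro eventually_at_in_open) auto
  have lim: "(g \<longlongrightarrow> g 0) (at 0)" if "g holomorphic_on ball 0 r" for g :: "complex \<Rightarrow> complex"
    using that r(1) by (intro analytic_tendsto) (auto simp: analytic_at intro!: exI[of _ "ball 0 r"])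
  have "((\<lambda>z. theta1_logderiv z - 1 / z) \<longlongrightarrow> h 0) (at 0)"
    by (rule Lim_transform_eventually[OF lim[OF h] eventually_mono[OF ev]]) (simp add: Z)
  then show "\<exists>L. ((\<lambda>z. theta1_logderiv z - 1 / z) \<longlongrightarrow> L) (at 0)" by blast
  have "((\<lambda>z. deriv (deriv theta1_logderiv) z - 2 / z ^ 3) \<longlongrightarrow> deriv (deriv h) 0) (at 0)"
    by (rule Lim_transform_eventually[OF lim[OF h''] eventually_mono[OF ev]]) (simp add: Z'')
  then show "\<exists>L. ((\<lambda>z. deriv (deriv theta1_logderiv) z - 2 / z ^ 3) \<longlongrightarrow> L) (at 0)" by blast
qed

end

section \<open>The residue theorem for elliptic functions\<close>

lemma eventually_at_shift:
  fixes z \<omega> :: complex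
  assumes "eventually P (at (z + \<omega>))"
  shows "eventually (\<lambda>w. P (w + \<omega>)) (at z)"
proof -
  obtain d where d: "d > 0" "\<And>x. x \<noteq> z + \<omega> \<Longrightarrow> dist x (z + \<omega>) < d \<Longrightarrow> P x"
    using assms by (auto simp: eventually_at)
  show ?thesis unfolding eventually_at
    by (rule exI[of _ d]) (use d in \<open>auto intro!: d(2)\<close>)
qed

context
  fixes \<tau> :: complex
  assumes Im_pos: "Im \<tau> > 0"
begin

lemma eventually_nhds_not_in_period_lattice:
  "z \<notin> period_lattice \<tau> \<Longrightarrow> \<forall>\<^sub>F w in nhds z. w \<notin> period_lattice \<tau>"
  using eventually_nhds_in_open[OF open_Compl_period_lattice[OF Im_pos], of z] by simp

text \<open>An additive increment disappears on differentiation; the increments 0 and -2 \<pi> i of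
  the two periods are treated by one argument.\<close>

lemma deriv2_theta1_logderiv_periodic:
  assumes z: "z \<notin> period_lattice \<tau>"
  shows "deriv (deriv (theta1_logderiv \<tau>)) (z + 1) = deriv (deriv (theta1_logderiv \<tau>)) z"
    "deriv (deriv (theta1_logderiv \<tau>)) (z + \<tau>) = deriv (deriv (theta1_logderiv \<tau>)) z"
proof -
  let ?Z = "theta1_logderiv \<tau>"
  have "deriv ?Z (z + \<omega>) = deriv ?Z z \<and> deriv (deriv ?Z) (z + \<omega>) = deriv (deriv ?Z) z"
    if \<omega>: "\<And>z. z \<notin> period_lattice \<tau> \<Longrightarrow> ?Z (z + \<omega>) = ?Z z + C" for \<omega> C
  proof -
    have 1: "deriv ?Z (w + \<omega>) = deriv ?Z w" if "w \<notin> period_lattice \<tau>" for w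
      by (rule deriv_shift_quasi_periodic[OF analytic_theta1_logderiv[OF Im_pos that]
            eventually_mono[OF eventually_nhds_not_in_period_lattice[OF that]]]) (rule \<omega>)
    have "deriv (deriv ?Z) (z + \<omega>) = deriv (deriv ?Z) z"
      by (rule deriv_shift_quasi_periodic[of _ _ _ 0])
         (use z 1 in \<open>auto intro!: analytic_deriv analytic_theta1_logderiv[OF Im_pos]
            eventually_mono[OF eventually_nhds_not_in_period_lattice[OF z]]\<close>)
    with 1[OF z] show ?thesis by simp
  qed
  from this[of 1 0] this[of \<tau> "- 2 * of_real pi * \<i>"]
  show "deriv (deriv ?Z) (z + 1) = deriv (deriv ?Z) z" "deriv (deriv ?Z) (z + \<tau>) = deriv (deriv ?Z) z"
    by (simp_all add: theta1_logderiv_add_1[OF Im_pos] theta1_logderiv_add_tau[OF Im_pos])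
qed

text \<open>Subtracting the principal parts leaves a regular function that grows under \<tau> by 2
  \<pi> i times the sum of the residues, and such an increment has to vanish. Principal parts with
  terms of order 1 and 3 suffice: a product of three odd functions is odd, so no double pole term
  occurs at 0.\<close>

lemma elliptic_residue_sum:
  fixes F :: "complex \<Rightarrow> complex" and p r k :: "'i \<Rightarrow> complex"
  assumes fin: "finite I" and mero: "F meromorphic_on UNIV"
    and F1: "\<And>z. F (z + 1) = F z" and F\<tau>: "\<And>z. F (z + \<tau>) = F z"
    and incongruent: "\<And>i j. i \<in> I \<Longrightarrow> j \<in> I \<Longrightarrow> i \<noteq> j \<Longrightarrow> p i - p j \<notin> period_lattice \<tau>"
    and regular: "\<And>z. (\<And>i. i \<in> I \<Longrightarrow> z - p i \<notin> period_lattice \<tau>) \<Longrightarrow> \<exists>L. (F \<longlongrightarrow> L) (at z)"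
    and principal: "\<And>i. i \<in> I \<Longrightarrow> \<exists>L. ((\<lambda>z. F z - r i / (z - p i) - k i / (z - p i) ^ 3) \<longlongrightarrow> L) (at (p i))"
  shows "(\<Sum>i\<in>I. r i) = 0"
proof -
  define Z where "Z = theta1_logderiv \<tau>"
  define Z2 where "Z2 = deriv (deriv Z)"
  \<comment> \<open>The second derivative of \<open>Z\<close> absorbs the triple poles; it has no \<open>1/z\<close> term and is strictly periodic.\<close>
  define E where "E = (\<lambda>i z. r i * Z (z - p i) + k i / 2 * Z2 (z - p i))"
  define T where "T = (\<lambda>z. F z - (\<Sum>i\<in>I. E i z))"
  \<comment> \<open>At its poles \<open>theta1_logderiv\<close> has the value 0 on both sides of the
    translation law, which would demand a difference of -2 \<pi> i. Hence the laws for
    \<open>T\<close> are stated only at points congruent to none of the \<open>p i\<close>.\<close>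
  define ok where "ok = (\<lambda>w. \<forall>i\<in>I. w - p i \<notin> period_lattice \<tau>)"
  have mZ: "Z meromorphic_on UNIV" unfolding Z_def by (rule meromorphic_theta1_logderiv[OF Im_pos])
  have mZ2: "Z2 meromorphic_on UNIV" unfolding Z2_def by (intro meromorphic_intros mZ)
  have shift: "(\<lambda>z. g (z - p i)) meromorphic_on UNIV" if "g meromorphic_on UNIV" for g i
    by (rule meromorphic_on_compose[OF that, where f = "\<lambda>z. z - p i"]) (auto intro!: analytic_intros)
  have mT: "T meromorphic_on UNIV"
    unfolding T_def E_def by (intro meromorphic_intros mero shift[OF mZ] shift[OF mZ2])
  have ana_E: "E i analytic_on {z}" if "z - p i \<notin> period_lattice \<tau>" for i z
  proof -
    have Za: "Z analytic_on {z - p i}" unfolding Z_def by (rule analytic_theta1_logderiv[OF Im_pos that])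
    then have "Z2 analytic_on {z - p i}" unfolding Z2_def by (intro analytic_deriv)
    moreover have "(\<lambda>z. g (z - p i)) analytic_on {z}" if "g analytic_on {z - p i}" for g
    proof -
      have "(\<lambda>z. z - p i) analytic_on {z}" by (intro analytic_intros)
      from analytic_on_compose_gen[OF this that] show ?thesis by (simp add: o_def)
    qed
    ultimately show ?thesis unfolding E_def using Za by (intro analytic_intros) auto
  qed
  have ok_ev: "\<forall>\<^sub>F w in at z. ok w" for z
    unfolding ok_def
    using eventually_at_shift[OF eventually_not_in_period_lattice[OF Im_pos], where z = z and \<omega> = "- p _"]
    by (intro eventually_ball_finite fin) auto
  have ok1: "ok (w + 1) \<longleftrightarrow> ok w" for w
    unfolding ok_def using period_lattice_add_period_iff(2)[of "w - p _" \<tau>] by (simp add: algebra_simps)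
  have ok\<tau>: "ok (w + \<tau>) \<longleftrightarrow> ok w" for w
    unfolding ok_def using period_lattice_add_period_iff(1)[of "w - p _" \<tau>] by (simp add: algebra_simps)
  define C where "C = 2 * of_real pi * \<i> * (\<Sum>i\<in>I. r i)"
  have T1: "T (w + 1) = T w" if "ok w" for w
  proof -
    have "E i (w + 1) = E i w" if "i \<in> I" for i
    proof -
      have "w - p i \<notin> period_lattice \<tau>" using \<open>ok w\<close> that by (simp add: ok_def)
      from theta1_logderiv_add_1[OF Im_pos, of "w - p i"] deriv2_theta1_logderiv_periodic(1)[OF this]
      show ?thesis unfolding E_def Z2_def Z_def by (simp add: algebra_simps)
    qed
    then show ?thesis unfolding T_def by (simp add: F1)
  qed
  have T\<tau>: "T (w + \<tau>) = T w + C" if "ok w" for w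
  proof -
    have "E i (w + \<tau>) = E i w - 2 * of_real pi * \<i> * r i" if "i \<in> I" for i
    proof -
      have "w - p i \<notin> period_lattice \<tau>" using \<open>ok w\<close> that by (simp add: ok_def)
      note per = theta1_logderiv_add_tau[OF Im_pos this] deriv2_theta1_logderiv_periodic(2)[OF this]
      have "w + \<tau> - p i = w - p i + \<tau>" by simp
      then show ?thesis unfolding E_def Z2_def Z_def by (simp only: per) (simp add: algebra_simps)
    qed
    then have "(\<Sum>i\<in>I. E i (w + \<tau>)) = (\<Sum>i\<in>I. E i w - 2 * of_real pi * \<i> * r i)"
      by (intro sum.cong) auto
    then show ?thesis unfolding T_def C_def by (simp add: F\<tau> sum_subtractf sum_distrib_left)
  qed
  have lim_p: "\<exists>L. (T \<longlongrightarrow> L) (at (p i))" if i: "i \<in> I" for i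
  proof -
    obtain L1 where 1: "((\<lambda>z. F z - r i / (z - p i) - k i / (z - p i) ^ 3) \<longlongrightarrow> L1) (at (p i))"
      using principal[OF i] by blast
    have tr: "\<exists>L. ((\<lambda>z. g (z - p i)) \<longlongrightarrow> L) (at (p i))" if "\<exists>L. (g \<longlongrightarrow> L) (at 0)" for g :: "complex \<Rightarrow> complex"
      using that filterlim_at_shift[of g _ "p i" "- p i"] by auto
    obtain L2 where 2: "((\<lambda>z. Z (z - p i) - 1 / (z - p i)) \<longlongrightarrow> L2) (at (p i))"
      using tr[OF theta1_logderiv_local(1)[OF Im_pos]] unfolding Z_def by blast
    obtain L3 where 3: "((\<lambda>z. Z2 (z - p i) - 2 / (z - p i) ^ 3) \<longlongrightarrow> L3) (at (p i))"
      using tr[OF theta1_logderiv_local(2)[OF Im_pos]] unfolding Z2_def Z_def by blast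
    have 4: "((\<lambda>z. \<Sum>j\<in>I - {i}. E j z) \<longlongrightarrow> (\<Sum>j\<in>I - {i}. E j (p i))) (at (p i))"
      by (intro tendsto_sum analytic_tendsto ana_E incongruent) (use i in auto)
    \<comment> \<open>The polar terms cancel in this regrouping, and each bracket has a limit of its
      own. The weight \<open>k i / 2\<close> is explained by the leading term 2/z^3 of
      \<open>Z2\<close>.\<close>
    have "T = (\<lambda>z. (F z - r i / (z - p i) - k i / (z - p i) ^ 3) - r i * (Z (z - p i) - 1 / (z - p i))
            - k i / 2 * (Z2 (z - p i) - 2 / (z - p i) ^ 3) - (\<Sum>j\<in>I - {i}. E j z))"
      unfolding T_def sum.remove[OF fin i] E_def by (simp add: fun_eq_iff algebra_simps)
    moreover have "((\<lambda>z. (F z - r i / (z - p i) - k i / (z - p i) ^ 3) - r i * (Z (z - p i) - 1 / (z - p i))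
            - k i / 2 * (Z2 (z - p i) - 2 / (z - p i) ^ 3) - (\<Sum>j\<in>I - {i}. E j z))
         \<longlongrightarrow> L1 - r i * L2 - k i / 2 * L3 - (\<Sum>j\<in>I - {i}. E j (p i))) (at (p i))"
      by (intro tendsto_intros 1 2 3 4)
    ultimately show ?thesis by auto
  qed
  have lim: "\<exists>L. (T \<longlongrightarrow> L) (at z)" for z
  proof (cases "ok z")
    case True
    then obtain L where "(F \<longlongrightarrow> L) (at z)" using regular[of z] unfolding ok_def by blast
    then have "(T \<longlongrightarrow> L - (\<Sum>i\<in>I. E i z)) (at z)"
      unfolding T_def using True by (intro tendsto_intros analytic_tendsto ana_E) (auto simp: ok_def)
    then show ?thesis by blast
  next
    case False
    then obtain i where i: "i \<in> I" "z - p i \<in> period_lattice \<tau>" unfolding ok_def by blast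
    then obtain m n where mn: "z - p i = of_int m * \<tau> + of_int n" by (meson period_latticeE)
    \<comment> \<open>A singular point congruent to \<open>p i\<close> inherits its limit from
      there: the lattice translation changes \<open>T\<close> by a constant only.\<close>
    have sh: "T (w + (z - p i)) = T w + of_int m * C" if "ok w" for w
    proof -
      have a: "ok (w + of_int m * \<tau>) \<and> T (w + of_int m * \<tau>) = T w + of_int m * C"
        by (rule shift_int_add_on[where P = ok]) (use ok\<tau> T\<tau> that in auto)
      have "T (w + of_int m * \<tau> + of_int n * 1) = T (w + of_int m * \<tau>) + of_int n * 0"
        using shift_int_add_on[where P = ok and f = T and \<omega> = 1 and C = 0 and z = "w + of_int m * \<tau>" and n = n] ok1 T1 a by auto
      with a show ?thesis unfolding mn by (simp add: add.assoc)
    qed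
    obtain L where "(T \<longlongrightarrow> L) (at (p i))" using lim_p[OF i(1)] by blast
    then have "((\<lambda>w. T (w + (p i - z)) + of_int m * C) \<longlongrightarrow> L + of_int m * C) (at z)"
      by (intro tendsto_intros filterlim_at_shift) simp
    moreover have "\<forall>\<^sub>F w in at z. T (w + (p i - z)) + of_int m * C = T w"
      using eventually_at_shift[OF ok_ev, where z = z and \<omega> = "p i - z"]
    proof eventually_elim
      case (elim w)
      from sh[OF elim] show ?case by simp
    qed
    ultimately show ?thesis using Lim_transform_eventually by blast
  qed
  have "C = 0"
  proof -
    have "\<forall>\<^sub>F w in at z. T (w + 1) = T w" "\<forall>\<^sub>F w in at z. T (w + \<tau>) = T w + C" for z
      by (rule eventually_mono[OF ok_ev], erule T1 T\<tau>)+
    from additively_quasi_elliptic_constant[OF Im_pos mT lim this] show ?thesis ..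
  qed
  then show ?thesis unfolding C_def by simp
qed

end

section \<open>The function cs and the quartic identity\<close>

text \<open>The function cs in the variable z = u/(2K), so that the translations to consider are
  those by 1 and \<tau> and K drops out of the sums. At its poles, the lattice points, the value is
  0.\<close>

definition cs_theta :: "complex \<Rightarrow> complex \<Rightarrow> complex" where
  "cs_theta \<tau> z = theta4 0 \<tau> / theta3 0 \<tau> * (theta2 z \<tau> / theta1 z \<tau>)"

text \<open>In f(z) = f(0) + z h(z) evenness makes h odd away from 0. Continuity then yields h(0) =
  0, so a second factor z can be split off.\<close>

lemma even_analytic_factor:
  fixes f :: "complex \<Rightarrow> complex"
  assumes "f analytic_on {0}" and even: "\<And>z. f (- z) = f z"
  obtains g where "g analytic_on {0}" "\<And>z. f z = f 0 + z\<^sup>2 * g z"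
proof -
  obtain h where h: "h analytic_on {0}" "\<And>z. f z = f 0 + z * h z"
    using analytic_divided_difference[OF assms(1)] by auto
  have "h (- z) = - h z" if "z \<noteq> 0" for z
  proof -
    have "z * h z = (- z) * h (- z)" using h(2)[of z] h(2)[of "- z"] even[of z] by simp
    then have "z * (h (- z) + h z) = 0" by (simp add: algebra_simps)
    then show ?thesis using that by (simp add: eq_neg_iff_add_eq_0)
  qed
  then have ev: "\<forall>\<^sub>F z in at 0. h (- z) = - h z"
    by (auto simp: eventually_at intro!: exI[of _ 1])
  have lim: "(h \<longlongrightarrow> h 0) (at 0)" by (rule analytic_tendsto[OF h(1)])
  have "((\<lambda>z. h (- z)) \<longlongrightarrow> h 0) (at 0)"
  proof (rule filterlim_compose[OF lim])
    show "filterlim uminus (at 0) (at (0 :: complex))"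
      by (rule filterlim_atI) (auto simp: eventually_at intro!: tendsto_eq_intros exI[of _ 1])
  qed
  then have "((\<lambda>z. - h z) \<longlongrightarrow> h 0) (at 0)" using ev by (rule Lim_transform_eventually)
  moreover have "((\<lambda>z. - h z) \<longlongrightarrow> - h 0) (at 0)" by (intro tendsto_intros lim)
  ultimately have "h 0 = - h 0" by (intro tendsto_unique[of "at 0"]) auto
  then have h0: "h 0 = 0" by simp
  obtain g where g: "g analytic_on {0}" "\<And>z. h z = h 0 + z * g z"
    using analytic_divided_difference[OF h(1)] by auto
  have "f z = f 0 + z\<^sup>2 * g z" for z using h(2)[of z] g(2)[of z] h0 by (simp add: power2_eq_square)
  with g(1) show ?thesis using that by blast
qed

context
  fixes \<tau> :: complex
  assumes Im_pos: "Im \<tau> > 0"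
begin

lemma elliptic_K_nonzero: "elliptic_K \<tau> \<noteq> 0"
  unfolding elliptic_K_def using theta3_0_nonzero[OF Im_pos] by simp

lemma jacobi_cs_eq_cs_theta: "jacobi_cs (2 * elliptic_K \<tau> * w) \<tau> = cs_theta \<tau> w"
  unfolding jacobi_cs_def cs_theta_def Let_def using elliptic_K_nonzero by simp

lemma cs_theta_add_1: "cs_theta \<tau> (z + 1) = cs_theta \<tau> z"
  unfolding cs_theta_def theta1_add_1[OF Im_pos] theta2_add_1[OF Im_pos] by simp

lemma cs_theta_add_tau: "cs_theta \<tau> (z + \<tau>) = - cs_theta \<tau> z"
  unfolding cs_theta_def theta1_add_tau[OF Im_pos] theta2_add_tau[OF Im_pos] by simp

lemma cs_theta_minus: "cs_theta \<tau> (- z) = - cs_theta \<tau> z"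
  unfolding cs_theta_def theta1_minus[OF Im_pos] theta2_minus by simp

lemma cs_theta_add_period:
  "cs_theta \<tau> (z + (of_int m * \<tau> + of_int n)) = (-1) powi m * cs_theta \<tau> z"
proof -
  have "cs_theta \<tau> (z + of_int m * \<tau> + of_int n * 1) = cs_theta \<tau> (z + of_int m * \<tau>)"
    by (rule shift_int) (rule cs_theta_add_1)
  also have "\<dots> = (-1) powi m * cs_theta \<tau> z"
    by (rule shift_int_uminus) (rule cs_theta_add_tau)
  finally show ?thesis by (simp add: add.assoc)
qed

lemma cs_theta_analytic: "z \<notin> period_lattice \<tau> \<Longrightarrow> cs_theta \<tau> analytic_on {z}"
  unfolding cs_theta_def[abs_def] using theta1_eq_0_iff[OF Im_pos, of z] theta3_0_nonzero[OF Im_pos]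
  by (intro analytic_intros entire_imp_analytic holomorphic_theta1[OF Im_pos] holomorphic_theta2[OF Im_pos]) auto

lemma cs_theta_meromorphic: "cs_theta \<tau> meromorphic_on UNIV"
  unfolding cs_theta_def[abs_def]
  by (intro meromorphic_intros analytic_on_imp_meromorphic_on entire_imp_analytic
      holomorphic_theta1[OF Im_pos] holomorphic_theta2[OF Im_pos])

text \<open>z cs(2Kz) is even and analytic at 0, so the expansion of cs has no constant term. A
  remainder of order z^2 is small enough not to reach the 1/z coefficient of a product of three such
  functions.\<close>

lemma cs_theta_laurent:
  obtains c e v where "c \<noteq> 0" "v analytic_on {0}"
    "\<And>z. z \<noteq> 0 \<Longrightarrow> cs_theta \<tau> z = c / z + e * z + z\<^sup>2 * v z"
proof -
  let ?C = "theta4 0 \<tau> / theta3 0 \<tau>"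
  define W where "W = (\<lambda>z. ?C * (theta2 z \<tau> / theta1_quot \<tau> z))"
  have W: "W analytic_on {0}"
    unfolding W_def using theta1_quot_0[OF Im_pos]
    by (intro analytic_intros entire_imp_analytic holomorphic_theta2[OF Im_pos] holomorphic_theta1_quot[OF Im_pos]) auto
  have "W (- z) = W z" for z
    unfolding W_def theta1_quot_minus[OF Im_pos] theta2_minus ..
  then obtain g where g: "g analytic_on {0}" "\<And>z. W z = W 0 + z\<^sup>2 * g z"
    using even_analytic_factor[OF W] by blast
  obtain v where v: "v analytic_on {0}" "\<And>z. g z = g 0 + z * v z"
    using analytic_divided_difference[OF g(1)] by auto
  have "W 0 \<noteq> 0"
    unfolding W_def using theta1_quot_0[OF Im_pos] theta2_0_nonzero[OF Im_pos]
      theta3_0_nonzero[OF Im_pos] theta4_0_nonzero[OF Im_pos] by simp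
  moreover have "cs_theta \<tau> z = W 0 / z + g 0 * z + z\<^sup>2 * v z" if "z \<noteq> 0" for z
  proof -
    have "cs_theta \<tau> z = W z / z"
      unfolding cs_theta_def W_def theta1_quot[OF Im_pos] using that by simp
    also have "\<dots> = (W 0 + z\<^sup>2 * (g 0 + z * v z)) / z" using g(2)[of z] v(2)[of z] by simp
    also have "\<dots> = W 0 / z + g 0 * z + z\<^sup>2 * v z" using that by (simp add: field_simps power2_eq_square)
    finally show ?thesis .
  qed
  ultimately show ?thesis using that v(1) by blast
qed

lemma theta12_half_period_values:
  defines "E \<equiv> exp (- of_real pi * \<i> * \<tau> / 4)"
  shows "theta1 (1 / 2) \<tau> = theta2 0 \<tau>" "theta2 (1 / 2) \<tau> = 0"
    "theta1 (\<tau> / 2 + 1 / 2) \<tau> = E * theta3 0 \<tau>" "theta2 (\<tau> / 2 + 1 / 2) \<tau> = - \<i> * E * theta4 0 \<tau>"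
  unfolding E_def
  using theta1_add_half[OF Im_pos, of 0] theta2_add_half[OF Im_pos, of 0] theta1_0[OF Im_pos]
    theta1_add_half[OF Im_pos, of "\<tau> / 2"] theta2_add_half[OF Im_pos, of "\<tau> / 2"]
    theta1_half_tau[OF Im_pos] theta2_half_tau[OF Im_pos] by simp_all

text \<open>The even numerator \<open>N\<close> vanishes at 0, hence to second order, which cancels
  the double zero of the denominator: the elliptic quotient \<open>T\<close> is constant. Its value
  is - theta3^2 at 1/2 and - (theta4^4 + theta2^4) / theta3^2 at (1 + \<tau>)/2, with theta
  constants throughout.\<close>

lemma jacobi_quartic: "theta3 0 \<tau> ^ 4 = theta2 0 \<tau> ^ 4 + theta4 0 \<tau> ^ 4"
proof -
  define N where "N = (\<lambda>z. theta4 0 \<tau> ^ 2 * theta2 z \<tau> ^ 2 - theta2 0 \<tau> ^ 2 * theta4 z \<tau> ^ 2)"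
  define T where "T = (\<lambda>z. N z / theta1 z \<tau> ^ 2)"
  have holN: "N holomorphic_on UNIV"
    unfolding N_def by (intro holomorphic_intros holomorphic_theta2[OF Im_pos] holomorphic_theta4[OF Im_pos])
  have "N (- z) = N z" for z unfolding N_def theta2_minus theta4_minus ..
  then obtain g where g: "g analytic_on {0}" "\<And>z. N z = N 0 + z\<^sup>2 * g z"
    using even_analytic_factor[OF entire_imp_analytic[OF holN]] by blast
  have N0: "N 0 = 0" unfolding N_def by (simp add: mult.commute)
  have T1: "T (z + 1) = T z" for z
    unfolding T_def N_def theta1_add_1[OF Im_pos] theta2_add_1[OF Im_pos] theta4_add_1[OF Im_pos] by simp
  have T\<tau>: "T (z + \<tau>) = T z" for z
  proof -
    let ?e = "exp (- of_real pi * \<i> * (\<tau> + 2 * z))"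
    have "N (z + \<tau>) = ?e ^ 2 * N z"
      unfolding N_def theta2_add_tau[OF Im_pos] theta4_add_tau[OF Im_pos] by (simp add: power_mult_distrib algebra_simps)
    moreover have "theta1 (z + \<tau>) \<tau> ^ 2 = ?e ^ 2 * theta1 z \<tau> ^ 2"
      unfolding theta1_add_tau[OF Im_pos] by (simp add: power_mult_distrib)
    ultimately show ?thesis unfolding T_def by simp
  qed
  have lim_off: "(T \<longlongrightarrow> T z) (at z)" if "z \<notin> period_lattice \<tau>" for z
    unfolding T_def using that theta1_eq_0_iff[OF Im_pos, of z]
    by (intro analytic_tendsto analytic_intros entire_imp_analytic holN holomorphic_theta1[OF Im_pos]) auto
  have lim_0: "\<exists>L. (T \<longlongrightarrow> L) (at 0)"
  proof -
    have "((\<lambda>z. g z / theta1_quot \<tau> z ^ 2) \<longlongrightarrow> g 0 / theta1_quot \<tau> 0 ^ 2) (at 0)"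
      using theta1_quot_0[OF Im_pos]
      by (intro analytic_tendsto analytic_intros g entire_imp_analytic holomorphic_theta1_quot[OF Im_pos]) auto
    moreover have "\<forall>\<^sub>F z in at 0. g z / theta1_quot \<tau> z ^ 2 = T z"
      unfolding T_def theta1_quot[OF Im_pos] using g(2) N0
      by (auto simp: eventually_at power_mult_distrib intro!: exI[of _ 1])
    ultimately show ?thesis using Lim_transform_eventually by blast
  qed
  have "T meromorphic_on UNIV"
    unfolding T_def
    by (intro meromorphic_intros analytic_on_imp_meromorphic_on entire_imp_analytic holN holomorphic_theta1[OF Im_pos])
  from elliptic_regular_constant[OF Im_pos this T1 T\<tau> _ lim_off] lim_0
  obtain k where Tk: "\<And>z. z \<notin> period_lattice \<tau> \<Longrightarrow> T z = k" by blast
  let ?E = "exp (- of_real pi * \<i> * \<tau> / 4)"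
  have "T (1 / 2) = - (theta3 0 \<tau> ^ 2)"
    unfolding T_def N_def theta12_half_period_values theta4_half[OF Im_pos]
    using theta2_0_nonzero[OF Im_pos] by simp
  moreover have "T (\<tau> / 2 + 1 / 2) = - (theta4 0 \<tau> ^ 4 + theta2 0 \<tau> ^ 4) / theta3 0 \<tau> ^ 2"
  proof -
    have "N (\<tau> / 2 + 1 / 2) = ?E ^ 2 * - (theta4 0 \<tau> ^ 4 + theta2 0 \<tau> ^ 4)"
      unfolding N_def theta12_half_period_values theta4_half_tau_half[OF Im_pos]
      by (simp add: power_mult_distrib algebra_simps power4_eq_xxxx power2_eq_square)
    then show ?thesis
      unfolding T_def theta12_half_period_values power_mult_distrib by simp
  qed
  moreover have "T (1 / 2) = T (\<tau> / 2 + 1 / 2)"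
    using Tk half_periods_not_in_period_lattice[OF Im_pos] by metis
  ultimately show ?thesis
    using theta3_0_nonzero[OF Im_pos] by (simp add: field_simps power4_eq_xxxx power2_eq_square)
qed

lemma elliptic_dedekind_sum_eq:
  "elliptic_dedekind_sum \<tau> a b = 1 / (4 * of_int b) *
     (\<Sum>(\<mu>, \<nu>) \<in> {0..b - 1} \<times> {0..b - 1} - {(0, 0)}.
        (-1) powi \<mu> * cs_theta \<tau> (of_int a * ((of_int \<mu> * \<tau> + of_int \<nu>) / of_int b))
        * cs_theta \<tau> ((of_int \<mu> * \<tau> + of_int \<nu>) / of_int b))"
  unfolding elliptic_dedekind_sum_def mult.assoc[of "2 * elliptic_K \<tau>" "of_int a"] jacobi_cs_eq_cs_theta ..

text \<open>Of the three half periods, 1/2 is a zero of cs. At the other two the square of cs is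
  negated by the sign (-1)^\<mu>, leaving 1 and (theta4/theta3)^4, and the quartic identity turns
  the latter into 1 - \<lambda>.\<close>

lemma elliptic_dedekind_sum_1_2: "elliptic_dedekind_sum \<tau> 1 2 = (2 - modular_lambda \<tau>) / 8"
proof -
  have X: "{0..2 - 1} \<times> {0..2 - 1} - {(0, 0)} = {(0 :: int, 1 :: int), (1, 0), (1, 1)}"
    by auto
  have nz: "theta3 0 \<tau> \<noteq> 0" "theta4 0 \<tau> \<noteq> 0" using theta3_0_nonzero theta4_0_nonzero Im_pos by auto
  have "cs_theta \<tau> (\<tau> / 2) = - \<i>"
    unfolding cs_theta_def theta1_half_tau[OF Im_pos] theta2_half_tau[OF Im_pos] using nz by (simp add: field_simps)
  moreover have "cs_theta \<tau> ((\<tau> + 1) / 2) = - \<i> * (theta4 0 \<tau> ^ 2 / theta3 0 \<tau> ^ 2)"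
    unfolding add_divide_distrib cs_theta_def theta12_half_period_values using nz by (simp add: power2_eq_square)
  moreover have "cs_theta \<tau> (1 / 2) = 0" unfolding cs_theta_def theta12_half_period_values by simp
  ultimately have "elliptic_dedekind_sum \<tau> 1 2 = (1 + (theta4 0 \<tau> ^ 2 / theta3 0 \<tau> ^ 2)\<^sup>2) / 8"
    unfolding elliptic_dedekind_sum_eq X by (simp add: power2_eq_square field_simps)
  also have "(theta4 0 \<tau> ^ 2 / theta3 0 \<tau> ^ 2)\<^sup>2 = (theta3 0 \<tau> ^ 4 - theta2 0 \<tau> ^ 4) / theta3 0 \<tau> ^ 4"
    using jacobi_quartic by (simp add: power_divide power_mult[symmetric])
  also have "\<dots> = 1 - modular_lambda \<tau>"
    unfolding modular_lambda_def elliptic_k_def using nz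
    by (simp add: diff_divide_distrib power_divide power_mult[symmetric])
  finally show ?thesis by simp
qed

end

section \<open>Reciprocity\<close>

definition division_indices :: "int \<Rightarrow> (int \<times> int) set" where
  "division_indices m = {0..m - 1} \<times> {0..m - 1} - {(0, 0)}"

definition division_point :: "complex \<Rightarrow> int \<Rightarrow> int \<Rightarrow> int \<Rightarrow> complex" where
  "division_point \<tau> m \<mu> \<nu> = (of_int \<mu> * \<tau> + of_int \<nu>) / of_int m"

text \<open>Applied to both coordinates: division points of coprime orders are congruent only if
  they lie in the lattice, so the a-division poles and the b-division poles are kept apart.\<close>

lemma coprime_fractions_congruent:
  fixes m m' \<mu> \<mu>' :: int
  assumes "coprime m m'" "m > 0" "m' > 0" "0 \<le> \<mu>" "\<mu> < m" "of_int \<mu> / of_int m - of_int \<mu>' / of_int m' \<in> (\<int> :: real set)"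
  shows "\<mu> = 0"
proof -
  obtain k :: int where "of_int \<mu> / of_int m - of_int \<mu>' / of_int m' = (of_int k :: real)"
    using assms(6) by (auto elim: Ints_cases)
  then have "of_int (\<mu> * m' - \<mu>' * m) = (of_int (k * m * m') :: real)"
    using assms(2,3) by (simp add: field_simps)
  then have "\<mu> * m' = (\<mu>' + k * m') * m" by (simp only: of_int_eq_iff) (simp add: algebra_simps)
  then have "m dvd \<mu> * m'" by simp
  then have "m dvd \<mu>" using assms(1) by (simp add: coprime_dvd_mult_left_iff)
  then show ?thesis using assms(4,5) zdvd_not_zless[of \<mu> m] by fastforce
qed

lemma same_fractions_congruent:
  fixes m \<mu> \<mu>' :: int
  assumes "m > 0" "0 \<le> \<mu>" "\<mu> < m" "0 \<le> \<mu>'" "\<mu>' < m" "of_int \<mu> / of_int m - of_int \<mu>' / of_int m \<in> (\<int> :: real set)"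
  shows "\<mu> = \<mu>'"
proof -
  obtain k :: int where "of_int \<mu> / of_int m - of_int \<mu>' / of_int m = (of_int k :: real)"
    using assms(6) by (auto elim: Ints_cases)
  then have "of_int (\<mu> - \<mu>') = (of_int (k * m) :: real)"
    using assms(1) by (simp add: field_simps)
  then have e: "\<mu> - \<mu>' = k * m" by (simp only: of_int_eq_iff)
  have "\<bar>k * m\<bar> < m" using assms(2-5) unfolding e[symmetric] by linarith
  then have "\<bar>k\<bar> * m < 1 * m" using assms(1) by (simp add: abs_mult)
  then have "\<bar>k\<bar> < 1" using assms(1) by (subst (asm) mult_less_cancel_right_pos)
  then show ?thesis using e by simp
qed

lemma division_point_real_coords:
  "division_point \<tau> m \<mu> \<nu> = of_real (of_int \<mu> / of_int m) * \<tau> + of_real (of_int \<nu> / of_int m)"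
  unfolding division_point_def by (simp add: add_divide_distrib)

text \<open>A term in 1/z arises when one factor contributes its linear term and the other two their
  poles. The three choices give c^2 e/(ab) times 1, a^2 and b^2; the product of the three poles
  gives c^3/(ab).\<close>

lemma triple_pole_expansion:
  fixes f v :: "complex \<Rightarrow> complex" and a b c e :: complex
  assumes "a \<noteq> 0" "b \<noteq> 0" and v: "v analytic_on {0}"
    and f: "\<And>z. z \<noteq> 0 \<Longrightarrow> f z = c / z + e * z + z\<^sup>2 * v z"
  shows "\<exists>L. ((\<lambda>z. f z * f (a * z) * f (b * z) - c\<^sup>2 * e * (1 + a\<^sup>2 + b\<^sup>2) / (a * b) / z - c ^ 3 / (a * b) / z ^ 3) \<longlongrightarrow> L) (at 0)"
proof -
  \<comment> \<open>Chosen so that f(u z) = (c + z^2 X(u,z)) / (u z), which gives the three factors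
    a common shape.\<close>
  define X where "X = (\<lambda>u z. u\<^sup>2 * (e + u * z * v (u * z)))"
  \<comment> \<open>\<open>R\<close> collects what remains of the product of the three numerators,
    divided by z^3, once the terms in 1 and z^2 are removed. It is analytic at 0.\<close>
  define R where "R = (\<lambda>z. c\<^sup>2 * (v z + a ^ 3 * v (a * z) + b ^ 3 * v (b * z))
      + c * z * (X 1 z * X a z + X a z * X b z + X b z * X 1 z) + z ^ 3 * (X 1 z * X a z * X b z))"
  have va: "(\<lambda>z. v (u * z)) analytic_on {0}" for u
  proof -
    have "(\<lambda>z. u * z) analytic_on {0}" by (intro analytic_intros)
    from analytic_on_compose_gen[OF this v] show ?thesis by (simp add: o_def)
  qed
  have Xa: "X u analytic_on {0}" for u unfolding X_def by (intro analytic_intros va)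
  have "R analytic_on {0}" unfolding R_def by (intro analytic_intros va Xa v)
  then have "((\<lambda>z. R z / (a * b)) \<longlongrightarrow> R 0 / (a * b)) (at 0)"
    using assms(1,2) by (intro tendsto_intros analytic_tendsto) auto
  moreover have eq: "R z / (a * b) = f z * f (a * z) * f (b * z) - c\<^sup>2 * e * (1 + a\<^sup>2 + b\<^sup>2) / (a * b) / z - c ^ 3 / (a * b) / z ^ 3"
    if z: "z \<noteq> 0" for z
  proof -
    have fu: "f (u * z) = (c + z\<^sup>2 * X u z) / (u * z)" if "u \<noteq> 0" for u
      using f[of "u * z"] that z unfolding X_def by (simp add: field_simps eval_nat_numeral)
    have sumX: "X 1 z + X a z + X b z = e * (1 + a\<^sup>2 + b\<^sup>2) + z * (v z + a ^ 3 * v (a * z) + b ^ 3 * v (b * z))"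
      unfolding X_def by (simp add: algebra_simps eval_nat_numeral)
    have "(c + z\<^sup>2 * X 1 z) * (c + z\<^sup>2 * X a z) * (c + z\<^sup>2 * X b z)
        = c ^ 3 + c\<^sup>2 * z\<^sup>2 * (X 1 z + X a z + X b z) + c * z ^ 4 * (X 1 z * X a z + X a z * X b z + X b z * X 1 z)
          + z ^ 6 * (X 1 z * X a z * X b z)"
      by (simp add: algebra_simps eval_nat_numeral)
    also have "\<dots> = c ^ 3 + c\<^sup>2 * e * (1 + a\<^sup>2 + b\<^sup>2) * z\<^sup>2 + z ^ 3 * R z"
      unfolding sumX R_def by (simp add: algebra_simps eval_nat_numeral)
    finally have P: "(c + z\<^sup>2 * X 1 z) * (c + z\<^sup>2 * X a z) * (c + z\<^sup>2 * X b z)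
        = c ^ 3 + c\<^sup>2 * e * (1 + a\<^sup>2 + b\<^sup>2) * z\<^sup>2 + z ^ 3 * R z" .
    have "f z * f (a * z) * f (b * z) = ((c + z\<^sup>2 * X 1 z) * (c + z\<^sup>2 * X a z) * (c + z\<^sup>2 * X b z)) / (a * b * z ^ 3)"
      using fu[of 1] fu[of a] fu[of b] assms(1,2) by (simp add: eval_nat_numeral)
    moreover have "R' / d = (C + K * z\<^sup>2 + z ^ 3 * R') / (d * z ^ 3) - K / d / z - C / d / z ^ 3"
      if "d \<noteq> 0" for R' d C K
      using that z by (simp add: add_divide_distrib power2_eq_square power3_eq_cube)
    ultimately show ?thesis unfolding P using assms(1,2) by simp
  qed
  have "\<forall>\<^sub>F z in at 0. R z / (a * b) = f z * f (a * z) * f (b * z) - c\<^sup>2 * e * (1 + a\<^sup>2 + b\<^sup>2) / (a * b) / z - c ^ 3 / (a * b) / z ^ 3"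
    by (rule eventually_mono[OF eventually_neq_at_within[of 0]]) (rule eq)
  ultimately show ?thesis by (intro exI) (rule Lim_transform_eventually)
qed

lemma simple_pole_expansion:
  fixes f v H :: "complex \<Rightarrow> complex" and m c e p :: complex
  assumes "m \<noteq> 0" and v: "v analytic_on {0}" and H: "H analytic_on {p}"
    and f: "\<And>z. z \<noteq> 0 \<Longrightarrow> f z = c / z + e * z + z\<^sup>2 * v z"
  shows "\<exists>L. ((\<lambda>z. f (m * (z - p)) * H z - c / m * H p / (z - p)) \<longlongrightarrow> L) (at p)"
proof -
  obtain H1 where H1: "H1 analytic_on {p}" "\<And>z. H z = H p + (z - p) * H1 z"
    using analytic_divided_difference[OF H] by blast
  define g where "g = (\<lambda>z. e * (m * (z - p)) + (m * (z - p))\<^sup>2 * v (m * (z - p)))"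
  have "(\<lambda>z. m * (z - p)) analytic_on {p}" by (intro analytic_intros)
  from analytic_on_compose_gen[OF this, of v "{0}"] v
  have "(\<lambda>z. v (m * (z - p))) analytic_on {p}" by (simp add: o_def)
  then have "(\<lambda>z. c / m * H1 z + g z * H z) analytic_on {p}"
    unfolding g_def by (intro analytic_intros H1 H)
  from analytic_tendsto[OF this] obtain L where "((\<lambda>z. c / m * H1 z + g z * H z) \<longlongrightarrow> L) (at p)" by blast
  moreover have eq: "c / m * H1 z + g z * H z = f (m * (z - p)) * H z - c / m * H p / (z - p)" if "z \<noteq> p" for z
  proof -
    have nz: "z - p \<noteq> 0" using that by simp
    then have "f (m * (z - p)) = c / (m * (z - p)) + g z" using f[of "m * (z - p)"] assms(1) by (simp add: g_def)
    moreover have "c / (m * (z - p)) * H z = c / m * H p / (z - p) + c / m * H1 z"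
      unfolding H1(2)[of z] using nz assms(1) by (simp add: distrib_left add_divide_distrib)
    ultimately show ?thesis by (simp add: distrib_right)
  qed
  have "\<forall>\<^sub>F z in at p. c / m * H1 z + g z * H z = f (m * (z - p)) * H z - c / m * H p / (z - p)"
    by (rule eventually_mono[OF eventually_neq_at_within[of p]]) (rule eq)
  ultimately show ?thesis by (intro exI) (rule Lim_transform_eventually)
qed

lemma elliptic_dedekind_sum_denominator_1: "elliptic_dedekind_sum \<tau> a 1 = 0"
  unfolding elliptic_dedekind_sum_def by simp

context
  fixes \<tau> :: complex
  assumes Im_pos: "Im \<tau> > 0"
begin

lemma division_points_congruent_iff:
  "division_point \<tau> m \<mu> \<nu> - division_point \<tau> m' \<mu>' \<nu>' \<in> period_lattice \<tau> \<longleftrightarrow>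
     of_int \<mu> / of_int m - of_int \<mu>' / of_int m' \<in> (\<int> :: real set) \<and>
     of_int \<nu> / of_int m - of_int \<nu>' / of_int m' \<in> (\<int> :: real set)"
proof -
  have "division_point \<tau> m \<mu> \<nu> - division_point \<tau> m' \<mu>' \<nu>' =
     of_real (of_int \<mu> / of_int m - of_int \<mu>' / of_int m') * \<tau> + of_real (of_int \<nu> / of_int m - of_int \<nu>' / of_int m')"
    unfolding division_point_real_coords by (simp add: algebra_simps)
  then show ?thesis by (simp only: real_coords_in_period_lattice_iff[OF Im_pos])
qed

text \<open>Taken with n = 1 and with n the other of the two numbers a, b, this makes the remaining
  two factors of the product analytic at a pole of order m, so that this pole is simple.\<close>

lemma division_point_not_in_period_lattice:
  assumes "(\<mu>, \<nu>) \<in> division_indices m" "coprime n m"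
  shows "of_int n * division_point \<tau> m \<mu> \<nu> \<notin> period_lattice \<tau>"
proof
  assume "of_int n * division_point \<tau> m \<mu> \<nu> \<in> period_lattice \<tau>"
  then have "of_real (of_int (n * \<mu>) / of_int m) * \<tau> + of_real (of_int (n * \<nu>) / of_int m) \<in> period_lattice \<tau>"
    unfolding division_point_real_coords by (simp add: algebra_simps)
  then have i: "of_int (n * \<mu>) / of_int m \<in> (\<int> :: real set)" "of_int (n * \<nu>) / of_int m \<in> (\<int> :: real set)"
    by (simp_all only: real_coords_in_period_lattice_iff[OF Im_pos])
  have m: "m > 0" "0 \<le> \<mu>" "\<mu> < m" "0 \<le> \<nu>" "\<nu> < m" "\<mu> \<noteq> 0 \<or> \<nu> \<noteq> 0"
    using assms(1) by (auto simp: division_indices_def)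
  have "x = 0" if x: "0 \<le> x" "x < m" "of_int (n * x) / of_int m \<in> (\<int> :: real set)" for x :: int
  proof -
    obtain k :: int where "of_int (n * x) / of_int m = (of_int k :: real)"
      using x(3) by (auto elim: Ints_cases)
    then have "of_int (n * x) = (of_int (k * m) :: real)" using m(1) by (simp add: field_simps)
    then have "n * x = k * m" by (simp only: of_int_eq_iff)
    then have "m dvd x" using assms(2) by (metis coprime_commute coprime_dvd_mult_right_iff dvd_triv_right)
    then show ?thesis using that zdvd_not_zless[of x m] by fastforce
  qed
  with i m show False by blast
qed

lemma elliptic_dedekind_sum_eq_division_points:
  "4 * of_int b * elliptic_dedekind_sum \<tau> a b =
     (\<Sum>(\<mu>, \<nu>) \<in> division_indices b. (-1) powi \<mu>
        * cs_theta \<tau> (of_int a * division_point \<tau> b \<mu> \<nu>) * cs_theta \<tau> (division_point \<tau> b \<mu> \<nu>))" if "b > 0"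
  using that unfolding elliptic_dedekind_sum_eq[OF Im_pos] division_indices_def division_point_def by simp

text \<open>\<epsilon> is obtained before a and b are chosen, since it depends on the Laurent
  coefficients of cs alone; a single known sum can therefore identify it.\<close>

lemma elliptic_dedekind_sum_reciprocity_aux:
  obtains \<epsilon> where
    "\<And>a b. a > 0 \<Longrightarrow> b > 0 \<Longrightarrow> coprime a b \<Longrightarrow> odd (a + b) \<Longrightarrow>
       elliptic_dedekind_sum \<tau> a b + elliptic_dedekind_sum \<tau> b a
         = \<epsilon> * of_int (1 + a\<^sup>2 + b\<^sup>2) / of_int (a * b)"
proof -
  let ?f = "cs_theta \<tau>"
  obtain c e v where c: "c \<noteq> 0" and v: "v analytic_on {0}"
    and f: "\<And>z. z \<noteq> 0 \<Longrightarrow> ?f z = c / z + e * z + z\<^sup>2 * v z"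
    using cs_theta_laurent[OF Im_pos] by metis
  have "elliptic_dedekind_sum \<tau> a b + elliptic_dedekind_sum \<tau> b a
         = (- c * e / 4) * of_int (1 + a\<^sup>2 + b\<^sup>2) / of_int (a * b)"
    if ab: "a > 0" "b > 0" "coprime a b" "odd (a + b)" for a b :: int
  proof -
    define F where "F = (\<lambda>z. ?f z * ?f (of_int a * z) * ?f (of_int b * z))"
    \<comment> \<open>A triple (m, \<mu>, \<nu>) names the pole (\<mu>\<tau> + \<nu>)/m. The origin,
      common to both families, is listed once, under m = 1; the index sets leave out (0, 0).\<close>
    define I where "I = insert (1, 0, 0) (Sigma {a, b} division_indices)"
    define p where "p = (\<lambda>(m, \<mu>, \<nu>). division_point \<tau> m \<mu> \<nu>)"
    define r0 where "r0 = c\<^sup>2 * e * (1 + (of_int a)\<^sup>2 + (of_int b)\<^sup>2) / (of_int a * of_int b)"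
    \<comment> \<open>For m in {a, b} the number a + b - m is the other one. The factor with
      argument m z has the pole, of residue c/m up to the sign (-1)^\<mu>, and the other two factors
      are evaluated at it.\<close>
    define r where "r = (\<lambda>(m :: int, \<mu> :: int, \<nu> :: int). if (\<mu>, \<nu>) = (0, 0) then r0 else
       c / of_int m * ((-1) powi \<mu> * ?f (of_int (a + b - m) * division_point \<tau> m \<mu> \<nu>) * ?f (division_point \<tau> m \<mu> \<nu>)))"
    define k where "k = (\<lambda>(m :: int, \<mu> :: int, \<nu> :: int). if (\<mu>, \<nu>) = (0, 0) then c ^ 3 / (of_int a * of_int b) else 0)"
    \<comment> \<open>Needed for the sum over {a, b} to consist of two terms.\<close>
    have ne: "a \<noteq> b" using ab(4) by auto
    have fin: "finite I" unfolding I_def division_indices_def by auto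
    have mero: "F meromorphic_on UNIV"
    proof -
      have "(\<lambda>z. ?f (of_int n * z)) meromorphic_on UNIV" for n
        by (rule meromorphic_on_compose[OF cs_theta_meromorphic[OF Im_pos], where f = "\<lambda>z. of_int n * z"])
           (auto intro!: analytic_intros)
      then show ?thesis unfolding F_def by (intro meromorphic_intros cs_theta_meromorphic[OF Im_pos])
    qed
    have fn: "?f (of_int n * (z + 1)) = ?f (of_int n * z)" "?f (of_int n * (z + \<tau>)) = (-1) powi n * ?f (of_int n * z)" for n z
      using cs_theta_add_period[OF Im_pos, of "of_int n * z" 0 n] cs_theta_add_period[OF Im_pos, of "of_int n * z" n 0]
      by (simp_all add: distrib_left)
    have F1: "F (z + 1) = F z" for z
      unfolding F_def fn cs_theta_add_1[OF Im_pos] ..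
    have F\<tau>: "F (z + \<tau>) = F z" for z
      unfolding F_def fn cs_theta_add_tau[OF Im_pos]
      using ab(4) by (cases "even a") (auto simp: power_int_minus_left)
    have Ibounds: "m > 0 \<and> 0 \<le> \<mu> \<and> \<mu> < m \<and> 0 \<le> \<nu> \<and> \<nu> < m \<and> (\<mu> = 0 \<and> \<nu> = 0 \<longrightarrow> m = 1)" if "(m, \<mu>, \<nu>) \<in> I" for m \<mu> \<nu>
      using that ab unfolding I_def division_indices_def by auto
    have Icop: "m = m' \<or> coprime m m'" if "(m, \<mu>, \<nu>) \<in> I" "(m', \<mu>', \<nu>') \<in> I" for m \<mu> \<nu> m' \<mu>' \<nu>'
      using that ab(3) unfolding I_def by (auto simp: coprime_commute)
    have incongruent: "p i - p j \<notin> period_lattice \<tau>" if ij: "i \<in> I" "j \<in> I" "i \<noteq> j" for i j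
    proof
      assume A: "p i - p j \<in> period_lattice \<tau>"
      obtain m \<mu> \<nu> m' \<mu>' \<nu>' where i: "i = (m, \<mu>, \<nu>)" and j: "j = (m', \<mu>', \<nu>')" by (metis prod_cases3)
      have Z: "of_int \<mu> / of_int m - of_int \<mu>' / of_int m' \<in> (\<int> :: real set)"
          "of_int \<nu> / of_int m - of_int \<nu>' / of_int m' \<in> (\<int> :: real set)"
        using A unfolding p_def i j by (simp_all add: division_points_congruent_iff)
      have Z': "of_int \<mu>' / of_int m' - of_int \<mu> / of_int m \<in> (\<int> :: real set)"
          "of_int \<nu>' / of_int m' - of_int \<nu> / of_int m \<in> (\<int> :: real set)"
        using Ints_minus[OF Z(1)] Ints_minus[OF Z(2)] by simp_all
      note bi = Ibounds[OF ij(1)[unfolded i]] and bj = Ibounds[OF ij(2)[unfolded j]]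
      consider "m = m'" | "m \<noteq> m'" "coprime m m'" using Icop ij i j by blast
      then show False
      proof cases
        case 1
        then have "\<mu> = \<mu>'" "\<nu> = \<nu>'"
          using same_fractions_congruent[of m \<mu> \<mu>'] same_fractions_congruent[of m \<nu> \<nu>'] Z bi bj by auto
        with 1 ij(3) i j show False by simp
      next
        case 2
        then have "coprime m' m" by (simp add: coprime_commute)
        have "\<mu> = 0" "\<nu> = 0" "\<mu>' = 0" "\<nu>' = 0"
          using coprime_fractions_congruent[OF 2(2)] coprime_fractions_congruent[OF \<open>coprime m' m\<close>] Z Z' bi bj by blast+
        with bi bj 2 show False by simp
      qed
    qed
    have regular: "\<exists>L. (F \<longlongrightarrow> L) (at z)" if z: "\<And>i. i \<in> I \<Longrightarrow> z - p i \<notin> period_lattice \<tau>" for z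
    proof -
      have z0: "z \<notin> period_lattice \<tau>" using z[of "(1, 0, 0)"] by (simp add: I_def p_def division_point_def)
      have zm: "of_int m * z \<notin> period_lattice \<tau>" if m: "m \<in> {a, b}" for m
      proof
        assume "of_int m * z \<in> period_lattice \<tau>"
        then obtain k l where kl: "of_int m * z = of_int k * \<tau> + of_int l" by (rule period_latticeE)
        have m0: "m > 0" using m ab by auto
        \<comment> \<open>Division with remainder in both coordinates splits z into a lattice point
          and a division point whose indices lie in range.\<close>
        have k: "k = k div m * m + k mod m" and l: "l = l div m * m + l mod m" by simp_all
        have "of_int m * z = of_int m * (of_int (k div m) * \<tau> + of_int (l div m)) + (of_int (k mod m) * \<tau> + of_int (l mod m))"
          unfolding kl by (subst (1) k, subst (1) l) (simp only: of_int_add of_int_mult, simp add: algebra_simps)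
        then have zeq: "z = (of_int (k div m) * \<tau> + of_int (l div m)) + division_point \<tau> m (k mod m) (l mod m)"
          unfolding division_point_def using m0 by (simp add: field_simps)
        show False
        proof (cases "k mod m = 0 \<and> l mod m = 0")
          case True
          then show ?thesis using zeq z0 by (simp add: division_point_def period_latticeI)
        next
          case False
          then have "(k mod m, l mod m) \<in> division_indices m"
            using m0 by (auto simp: division_indices_def zle_diff1_eq)
          then have "(m, k mod m, l mod m) \<in> I" using m by (auto simp: I_def)
          from z[OF this] zeq show ?thesis by (simp add: p_def period_latticeI)
        qed
      qed
      have "(\<lambda>z. ?f (of_int m * z)) analytic_on {z}" if "m \<in> {a, b}" for m
      proof -
        have "(\<lambda>z. of_int m * z) analytic_on {z}" by (intro analytic_intros)
        from analytic_on_compose_gen[OF this cs_theta_analytic[OF Im_pos zm[OF that]]] show ?thesis by (simp add: o_def)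
      qed
      then have "F analytic_on {z}" unfolding F_def by (intro analytic_intros cs_theta_analytic[OF Im_pos z0]) auto
      then show ?thesis using analytic_tendsto by blast
    qed
    have principal: "\<exists>L. ((\<lambda>z. F z - r i / (z - p i) - k i / (z - p i) ^ 3) \<longlongrightarrow> L) (at (p i))" if "i \<in> I" for i
    proof (cases "i = (1, 0, 0)")
      case True
      show ?thesis
        using triple_pole_expansion[of "of_int a" "of_int b" v ?f c e, OF _ _ v f] ab
        unfolding True F_def by (simp add: p_def r_def k_def r0_def division_point_def)
    next
      case False
      then obtain m \<mu> \<nu> where i: "i = (m, \<mu>, \<nu>)" "m \<in> {a, b}" "(\<mu>, \<nu>) \<in> division_indices m"
        using \<open>i \<in> I\<close> unfolding I_def by auto
      define n where "n = a + b - m"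
      define P where "P = division_point \<tau> m \<mu> \<nu>"
      define H where "H = (\<lambda>z. (-1) powi \<mu> * (?f (of_int n * z) * ?f z))"
      have m0: "m \<noteq> 0" and cop: "coprime n m" using i(2) ab by (auto simp: n_def coprime_commute)
      have "\<mu> \<noteq> 0 \<or> \<nu> \<noteq> 0" using i(3) by (auto simp: division_indices_def)
      then have ri: "r i = c / of_int m * H P" and ki: "k i = 0" and pi: "p i = P"
        by (auto simp: r_def k_def p_def i(1) H_def P_def n_def)
      have nP: "of_int n * P \<notin> period_lattice \<tau>" "P \<notin> period_lattice \<tau>"
        using division_point_not_in_period_lattice[OF i(3), of n] division_point_not_in_period_lattice[OF i(3), of 1] cop
        by (auto simp: P_def)
      have "(\<lambda>z. of_int n * z) analytic_on {P}" by (intro analytic_intros)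
      from analytic_on_compose_gen[OF this cs_theta_analytic[OF Im_pos nP(1)]]
      have "H analytic_on {P}"
        unfolding H_def by (intro analytic_intros cs_theta_analytic[OF Im_pos nP(2)]) (simp_all add: o_def)
      from simple_pole_expansion[OF _ v this f, of "of_int m"] m0
      obtain L where L: "((\<lambda>z. ?f (of_int m * (z - P)) * H z - c / of_int m * H P / (z - P)) \<longlongrightarrow> L) (at P)" by auto
      have "F z = ?f (of_int m * (z - P)) * H z" for z
      proof -
        \<comment> \<open>Because m P = \<mu>\<tau> + \<nu> is a lattice point, the pole at P is
          moved to the origin at the cost of a sign. This is the origin of (-1)^\<mu> in the
          elliptic Dedekind sum.\<close>
        have "?f (of_int m * z) = ?f (of_int m * (z - P) + (of_int \<mu> * \<tau> + of_int \<nu>))"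
          using m0 by (simp add: P_def division_point_def field_simps)
        also have "\<dots> = (-1) powi \<mu> * ?f (of_int m * (z - P))" by (rule cs_theta_add_period[OF Im_pos])
        finally have "?f (of_int m * z) = (-1) powi \<mu> * ?f (of_int m * (z - P))" .
        moreover have "F z = ?f z * ?f (of_int m * z) * ?f (of_int n * z)"
          using i(2) unfolding F_def n_def by auto
        ultimately show ?thesis unfolding H_def by (simp add: mult_ac)
      qed
      then show ?thesis unfolding ri ki pi using L by auto
    qed
    have "(\<Sum>i\<in>I. r i) = 0"
      by (rule elliptic_residue_sum[OF Im_pos fin mero F1 F\<tau> incongruent regular principal])
    moreover have "(\<Sum>i\<in>I. r i) = r0 + (\<Sum>m\<in>{a, b}. \<Sum>x\<in>division_indices m. r (m, x))"
    proof -
      have fd: "finite (division_indices m)" for m unfolding division_indices_def by simp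
      have "(1, 0, 0) \<notin> Sigma {a, b} division_indices" by (simp add: division_indices_def)
      moreover have "(\<Sum>m\<in>{a, b}. \<Sum>x\<in>division_indices m. r (m, x)) = (\<Sum>y\<in>Sigma {a, b} division_indices. r y)"
        by (subst sum.Sigma) (simp_all add: fd case_prod_unfold)
      moreover have "r (1, 0, 0) = r0" by (simp add: r_def)
      ultimately show ?thesis unfolding I_def by (simp add: fd)
    qed
    moreover have "(\<Sum>x\<in>division_indices m. r (m, x)) = 4 * c * elliptic_dedekind_sum \<tau> (a + b - m) m" if "m > 0" for m
    proof -
      have "(\<Sum>x\<in>division_indices m. r (m, x)) = (\<Sum>(\<mu>, \<nu>) \<in> division_indices m. c / of_int m * ((-1) powi \<mu>
        * cs_theta \<tau> (of_int (a + b - m) * division_point \<tau> m \<mu> \<nu>) * cs_theta \<tau> (division_point \<tau> m \<mu> \<nu>)))"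
      proof (intro sum.cong refl)
        fix x assume "x \<in> division_indices m"
        moreover obtain \<mu> \<nu> where x: "x = (\<mu>, \<nu>)" by (cases x)
        ultimately have "(\<mu>, \<nu>) \<noteq> (0, 0)" by (auto simp: division_indices_def)
        then show "r (m, x) = (case x of (\<mu>, \<nu>) \<Rightarrow> c / of_int m * ((-1) powi \<mu>
            * cs_theta \<tau> (of_int (a + b - m) * division_point \<tau> m \<mu> \<nu>) * cs_theta \<tau> (division_point \<tau> m \<mu> \<nu>)))"
          unfolding x r_def by (simp only: prod.case if_False)
      qed
      also have "\<dots> = c / of_int m * (4 * of_int m * elliptic_dedekind_sum \<tau> (a + b - m) m)"
        unfolding elliptic_dedekind_sum_eq_division_points[OF that] sum_distrib_left by (intro sum.cong) auto
      finally show ?thesis using that by simp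
    qed
    ultimately have "r0 + 4 * c * elliptic_dedekind_sum \<tau> b a + 4 * c * elliptic_dedekind_sum \<tau> a b = 0"
      using ne ab by (simp add: add.assoc)
    moreover have "r0 = c * (c * e * of_int (1 + a\<^sup>2 + b\<^sup>2) / of_int (a * b))"
      unfolding r0_def by (simp add: power2_eq_square)
    ultimately have "c * (c * e * of_int (1 + a\<^sup>2 + b\<^sup>2) / of_int (a * b)
       + 4 * (elliptic_dedekind_sum \<tau> a b + elliptic_dedekind_sum \<tau> b a)) = 0" by (simp add: algebra_simps)
    with c have "c * e * of_int (1 + a\<^sup>2 + b\<^sup>2) / of_int (a * b)
       + 4 * (elliptic_dedekind_sum \<tau> a b + elliptic_dedekind_sum \<tau> b a) = 0" by (metis mult_eq_0_iff)
    then have S: "4 * (elliptic_dedekind_sum \<tau> a b + elliptic_dedekind_sum \<tau> b a) = - (c * e * of_int (1 + a\<^sup>2 + b\<^sup>2) / of_int (a * b))"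
      by (simp add: eq_neg_iff_add_eq_0 add.commute)
    have "elliptic_dedekind_sum \<tau> a b + elliptic_dedekind_sum \<tau> b a
       = 4 * (elliptic_dedekind_sum \<tau> a b + elliptic_dedekind_sum \<tau> b a) / 4" by simp
    then show ?thesis unfolding S by simp
  qed
  then show ?thesis using that by blast
qed

lemma elliptic_dedekind_sum_reciprocity:
  assumes "a > 0" "b > 0" "coprime a b" "odd (a + b)"
  shows "elliptic_dedekind_sum \<tau> a b + elliptic_dedekind_sum \<tau> b a
         = (1 / 3 - 1 / 6 * modular_lambda \<tau>) * of_int (1 + a\<^sup>2 + b\<^sup>2) / of_int (4 * a * b)"
proof -
  obtain \<epsilon> where \<epsilon>: "\<And>a b. a > 0 \<Longrightarrow> b > 0 \<Longrightarrow> coprime a b \<Longrightarrow> odd (a + b) \<Longrightarrow>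
       elliptic_dedekind_sum \<tau> a b + elliptic_dedekind_sum \<tau> b a
         = \<epsilon> * of_int (1 + a\<^sup>2 + b\<^sup>2) / of_int (a * b)"
    using elliptic_dedekind_sum_reciprocity_aux by metis
  \<comment> \<open>For the pair (1;2) one has 1 + a^2 + b^2 = 6 and ab = 2, and the second sum has
    denominator 1 and is empty.\<close>
  have "(2 - modular_lambda \<tau>) / 8 = \<epsilon> * 6 / 2"
    using \<epsilon>[of 1 2] by (simp add: elliptic_dedekind_sum_1_2[OF Im_pos] elliptic_dedekind_sum_denominator_1)
  then have "\<epsilon> = (1 / 3 - 1 / 6 * modular_lambda \<tau>) / 4" by (simp add: field_simps)
  with \<epsilon>[OF assms] show ?thesis by simp
qed

lemma elliptic_dedekind_sum_minus: "elliptic_dedekind_sum \<tau> (- a) b = - elliptic_dedekind_sum \<tau> a b"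
  unfolding elliptic_dedekind_sum_eq[OF Im_pos]
  by (simp add: cs_theta_minus[OF Im_pos] sum_negf case_prod_unfold)

lemma elliptic_dedekind_sum_add:
  assumes "b > 0"
  shows "elliptic_dedekind_sum \<tau> (a + 2 * b * k) b = elliptic_dedekind_sum \<tau> a b"
proof -
  have "cs_theta \<tau> (of_int (a + 2 * b * k) * ((of_int \<mu> * \<tau> + of_int \<nu>) / of_int b))
     = cs_theta \<tau> (of_int a * ((of_int \<mu> * \<tau> + of_int \<nu>) / of_int b))" for \<mu> \<nu> :: int
  proof -
    have "of_int (a + 2 * b * k) * ((of_int \<mu> * \<tau> + of_int \<nu>) / of_int b)
      = of_int a * ((of_int \<mu> * \<tau> + of_int \<nu>) / of_int b) + (of_int (2 * k * \<mu>) * \<tau> + of_int (2 * k * \<nu>))"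
      using assms by (simp add: field_simps)
    then show ?thesis by (simp only: cs_theta_add_period[OF Im_pos]) (simp add: power_int_mult)
  qed
  then show ?thesis unfolding elliptic_dedekind_sum_eq[OF Im_pos] by simp
qed

end

section \<open>Behaviour at the cusp\<close>

abbreviation imag_axis :: "real \<Rightarrow> complex" where
  "imag_axis y \<equiv> \<i> * of_real y"

lemma tendsto_exp_neg_at_top:
  fixes c :: real
  assumes "c > 0"
  shows "((\<lambda>y. exp (- (c * y))) \<longlongrightarrow> 0) at_top"
  using assms by real_asymp

text \<open>The prefactor normalises the dominant exponential of the series to 1. Its partner of
  index 0 becomes exp(2 \<pi> i w), which survives in the limit only if t = 0; all further terms are
  handled by Tannery's theorem.\<close>

lemma theta2_cusp:
  fixes t s :: real
  assumes "0 \<le> t" "t < 1"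
  shows "((\<lambda>y. exp (of_real pi * \<i> * ((of_real t * imag_axis y + of_real s) - imag_axis y / 4))
            * theta2 (of_real t * imag_axis y + of_real s) (imag_axis y))
          \<longlongrightarrow> (if t = 0 then exp (2 * of_real pi * \<i> * of_real s) else 0) + 1) at_top"
proof -
  define w where "w = (\<lambda>y. of_real t * imag_axis y + of_real s)"
  define \<alpha> where "\<alpha> = (\<lambda>n y. exp (of_real pi * \<i> * (imag_axis y * of_nat (n * (n + 1)) + w y * of_nat (2 * n + 2))))"
  define \<beta> where "\<beta> = (\<lambda>n y. exp (of_real pi * \<i> * (imag_axis y * of_nat (n * (n + 1)) - w y * of_nat (2 * n))))"
  define A where "A = (\<lambda>n y. \<alpha> n y + \<beta> n y)"
  \<comment> \<open>Decay rate from n(n + 1) - 2tn \<ge> 2(1 - t)n, a consequence of n^2 \<ge> n.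
    Here t < 1 makes it positive.\<close>
  define \<delta> where "\<delta> = 2 * pi * (1 - t)"
  have \<delta>: "\<delta> > 0" using assms by (simp add: \<delta>_def)
  have norm_\<alpha>: "norm (\<alpha> n y) = exp (- (pi * y * (real (n * (n + 1)) + t * real (2 * n + 2))))" for n y
  proof -
    have "Re (of_real pi * \<i> * (imag_axis y * of_nat (n * (n + 1)) + w y * of_nat (2 * n + 2)))
       = - (pi * y * (real (n * (n + 1)) + t * real (2 * n + 2)))"
      unfolding w_def by (simp add: algebra_simps)
    then show ?thesis unfolding \<alpha>_def by simp
  qed
  have norm_\<beta>: "norm (\<beta> n y) = exp (- (pi * y * (real (n * (n + 1)) - t * real (2 * n))))" for n y
  proof -
    have "Re (of_real pi * \<i> * (imag_axis y * of_nat (n * (n + 1)) - w y * of_nat (2 * n)))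
       = - (pi * y * (real (n * (n + 1)) - t * real (2 * n)))"
      unfolding w_def by (simp add: algebra_simps)
    then show ?thesis unfolding \<beta>_def by simp
  qed
  have key: "2 * (1 - t) * real n \<le> real (n * (n + 1)) - t * real (2 * n)" for n
  proof -
    have "n \<le> n * n" by (cases n) auto
    then have "real n \<le> real n * real n" by (metis of_nat_le_iff of_nat_mult)
    then show ?thesis by (simp add: algebra_simps)
  qed
  have bound: "norm (A n y) \<le> 2 * exp (- (\<delta> * real n * y))" if "y \<ge> 0" for n y
  proof -
    have le: "\<delta> * real n * y \<le> pi * y * (real (n * (n + 1)) - t * real (2 * n))"
    proof -
      have "(pi * y) * (2 * (1 - t) * real n) \<le> (pi * y) * (real (n * (n + 1)) - t * real (2 * n))"
        using that by (intro mult_left_mono key) auto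
      then show ?thesis by (simp add: \<delta>_def mult_ac)
    qed
    have le': "pi * y * (real (n * (n + 1)) - t * real (2 * n)) \<le> pi * y * (real (n * (n + 1)) + t * real (2 * n + 2))"
    proof (rule mult_left_mono)
      have "0 \<le> t * real (2 * n)" "0 \<le> t * real (2 * n + 2)" using assms(1) by simp_all
      then show "real (n * (n + 1)) - t * real (2 * n) \<le> real (n * (n + 1)) + t * real (2 * n + 2)" by linarith
    qed (use that in auto)
    have "norm (\<alpha> n y) \<le> exp (- (\<delta> * real n * y))" "norm (\<beta> n y) \<le> exp (- (\<delta> * real n * y))"
      unfolding norm_\<alpha> norm_\<beta> using order_trans[OF le le'] le by (simp_all only: exp_le_cancel_iff neg_le_iff_le)
    then show ?thesis unfolding A_def using norm_triangle_ineq[of "\<alpha> n y" "\<beta> n y"] by linarith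
  qed
  have series: "exp (of_real pi * \<i> * (w y - imag_axis y / 4)) * theta2 (w y) (imag_axis y) = (\<Sum>n. A n y)"
    if "y > 0" for y
  proof -
    let ?\<tau> = "imag_axis y"
    have Im_pos: "Im ?\<tau> > 0" using that by simp
    have eq: "exp (of_real pi * \<i> * (w y - ?\<tau> / 4)) * (exp (of_real pi * \<i> * (?\<tau> / 4 + w y))
        * (jtheta_term ?\<tau> (int n) (w y + ?\<tau> / 2) + jtheta_term ?\<tau> (- int n - 1) (w y + ?\<tau> / 2))) = A n y" for n
    proof -
      have "exp (of_real pi * \<i> * (w y - ?\<tau> / 4)) * (exp (of_real pi * \<i> * (?\<tau> / 4 + w y))
        * jtheta_term ?\<tau> (int n) (w y + ?\<tau> / 2)) = \<alpha> n y"
        unfolding jtheta_term_def \<alpha>_def exp_add[symmetric]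
        by (rule arg_cong[where f = exp]) (simp add: field_simps power2_eq_square)
      moreover have "exp (of_real pi * \<i> * (w y - ?\<tau> / 4)) * (exp (of_real pi * \<i> * (?\<tau> / 4 + w y))
        * jtheta_term ?\<tau> (- int n - 1) (w y + ?\<tau> / 2)) = \<beta> n y"
        unfolding jtheta_term_def \<beta>_def exp_add[symmetric]
        by (rule arg_cong[where f = exp]) (simp add: field_simps power2_eq_square)
      ultimately show ?thesis unfolding A_def by (simp add: distrib_left)
    qed
    show ?thesis unfolding theta2_eq_jtheta[OF Im_pos]
      using sums_unique[OF sums_mult[OF sums_mult[OF sums_jtheta_term[OF Im_pos, of "w y + ?\<tau> / 2"],
            of "exp (of_real pi * \<i> * (?\<tau> / 4 + w y))"],
            of "exp (of_real pi * \<i> * (w y - ?\<tau> / 4))", unfolded eq]] .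
  qed
  define b where "b = (\<lambda>n :: nat. if n = 0 then (if t = 0 then exp (2 * of_real pi * \<i> * of_real s) else 0) + 1 else (0 :: complex))"
  have lim: "((\<lambda>y. A n y) \<longlongrightarrow> b n) at_top" for n
  proof (cases "n = 0")
    case False
    have "((\<lambda>y. 2 * exp (- (\<delta> * real n * y))) \<longlongrightarrow> 2 * 0) at_top"
      using \<delta> False by (intro tendsto_mult_left tendsto_exp_neg_at_top) simp
    then have "(A n \<longlongrightarrow> 0) at_top"
      by (intro Lim_null_comparison[of "A n" "\<lambda>y. 2 * exp (- (\<delta> * real n * y))"]
          eventually_mono[OF eventually_ge_at_top[of 0]] bound) simp_all
    with False show ?thesis by (simp add: b_def)
  next
    case True
    have A0: "A 0 y = exp (2 * of_real pi * \<i> * of_real s) * of_real (exp (- (2 * pi * t * y))) + 1" for y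
    proof -
      have "\<alpha> 0 y = exp (2 * of_real pi * \<i> * of_real s) * of_real (exp (- (2 * pi * t * y)))"
        unfolding \<alpha>_def w_def exp_of_real[symmetric] exp_add[symmetric]
        by (rule arg_cong[where f = exp]) (simp add: algebra_simps)
      then show ?thesis unfolding A_def by (simp add: \<beta>_def)
    qed
    show ?thesis
    proof (cases "t = 0")
      case True
      with \<open>n = 0\<close> A0 show ?thesis by (simp add: b_def)
    next
      case False
      have "((\<lambda>y. exp (2 * of_real pi * \<i> * of_real s) * of_real (exp (- (2 * pi * t * y))) + 1)
          \<longlongrightarrow> exp (2 * of_real pi * \<i> * of_real s) * of_real 0 + 1) at_top"
        using False assms(1) by (intro tendsto_intros tendsto_exp_neg_at_top) simp
      with False \<open>n = 0\<close> A0 show ?thesis by (simp add: b_def)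
    qed
  qed
  have "summable (\<lambda>n. 2 * exp (- \<delta>) ^ n)"
    using \<delta> by (intro summable_mult summable_geometric) simp
  moreover have "eventually (\<lambda>(n, y). norm (A n y) \<le> 2 * exp (- \<delta>) ^ n) (at_top \<times>\<^sub>F at_top)"
  proof -
    have "norm (A n y) \<le> 2 * exp (- \<delta>) ^ n" if "y \<ge> 1" for n y
    proof -
      have "\<delta> * real n * 1 \<le> \<delta> * real n * y" using \<delta> that by (intro mult_left_mono) auto
      then have "exp (- (\<delta> * real n * y)) \<le> exp (- \<delta>) ^ n"
        unfolding exp_of_nat_mult[symmetric] by (simp add: mult.commute)
      moreover have "norm (A n y) \<le> 2 * exp (- (\<delta> * real n * y))" using bound that by simp
      ultimately show ?thesis by linarith
    qed
    then show ?thesis unfolding eventually_prod_filter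
      by (intro exI[of _ "\<lambda>_. True"] exI[of _ "\<lambda>y. y \<ge> 1"]) (auto simp: eventually_ge_at_top)
  qed
  ultimately have "((\<lambda>y. \<Sum>n. A n y) \<longlongrightarrow> (\<Sum>n. b n)) at_top"
    using tannerys_theorem[of A b at_top "\<lambda>n. 2 * exp (- \<delta>) ^ n", OF lim] by auto
  moreover have "(\<Sum>n. b n) = b 0"
    using suminf_finite[of "{0}" b] by (simp add: b_def)
  ultimately have "((\<lambda>y. \<Sum>n. A n y) \<longlongrightarrow> b 0) at_top" by simp
  then have "((\<lambda>y. exp (of_real pi * \<i> * (w y - imag_axis y / 4)) * theta2 (w y) (imag_axis y)) \<longlongrightarrow> b 0) at_top"
    by (rule Lim_transform_eventually) (use series in \<open>auto intro!: eventually_mono[OF eventually_gt_at_top[of 0]]\<close>)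
  then show ?thesis unfolding w_def b_def by simp
qed

text \<open>The limit of \<open>theta2\<close> at s - 1/2: the half period changes the sign of exp(2
  \<pi> i s), and i = exp(\<pi> i / 2) compensates for the altered prefactor.\<close>

lemma theta1_cusp:
  fixes t s :: real
  assumes "0 \<le> t" "t < 1"
  shows "((\<lambda>y. exp (of_real pi * \<i> * ((of_real t * imag_axis y + of_real s) - imag_axis y / 4))
            * theta1 (of_real t * imag_axis y + of_real s) (imag_axis y))
          \<longlongrightarrow> \<i> * (1 - (if t = 0 then exp (2 * of_real pi * \<i> * of_real s) else 0))) at_top"
proof -
  have e: "exp (of_real pi * \<i> / 2) = \<i>"
    using cis_pi_half unfolding cis_conv_exp by (simp add: mult.commute)
  have L: "exp (2 * of_real pi * \<i> * of_real (s - 1 / 2)) = - exp (2 * of_real pi * \<i> * of_real s)"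
  proof -
    have "2 * of_real pi * \<i> * of_real (s - 1 / 2) = 2 * of_real pi * \<i> * of_real s - of_real pi * \<i>"
      by (simp add: algebra_simps)
    then show ?thesis by (simp only: exp_diff exp_pi_i) simp
  qed
  have "((\<lambda>y. \<i> * (exp (of_real pi * \<i> * ((of_real t * imag_axis y + of_real (s - 1 / 2)) - imag_axis y / 4))
            * theta2 (of_real t * imag_axis y + of_real (s - 1 / 2)) (imag_axis y)))
          \<longlongrightarrow> \<i> * ((if t = 0 then exp (2 * of_real pi * \<i> * of_real (s - 1 / 2)) else 0) + 1)) at_top"
    by (intro tendsto_mult_left theta2_cusp assms)
  moreover have "\<i> * ((if t = 0 then exp (2 * of_real pi * \<i> * of_real (s - 1 / 2)) else 0) + 1)
     = \<i> * (1 - (if t = 0 then exp (2 * of_real pi * \<i> * of_real s) else 0))"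
    unfolding L by simp
  moreover have "\<forall>\<^sub>F y in at_top. \<i> * (exp (of_real pi * \<i> * ((of_real t * imag_axis y + of_real (s - 1 / 2)) - imag_axis y / 4))
            * theta2 (of_real t * imag_axis y + of_real (s - 1 / 2)) (imag_axis y))
     = exp (of_real pi * \<i> * ((of_real t * imag_axis y + of_real s) - imag_axis y / 4))
            * theta1 (of_real t * imag_axis y + of_real s) (imag_axis y)"
    using eventually_gt_at_top[of 0]
  proof eventually_elim
    case (elim y)
    then have Im_pos: "Im (imag_axis y) > 0" by simp
    have "exp (of_real pi * \<i> / 2) * exp (of_real pi * \<i> * ((of_real t * imag_axis y + of_real (s - 1 / 2)) - imag_axis y / 4))
       = exp (of_real pi * \<i> * ((of_real t * imag_axis y + of_real s) - imag_axis y / 4))"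
      unfolding exp_add[symmetric] by (rule arg_cong[where f = exp]) (simp add: field_simps)
    then have "\<i> * exp (of_real pi * \<i> * ((of_real t * imag_axis y + of_real (s - 1 / 2)) - imag_axis y / 4))
       = exp (of_real pi * \<i> * ((of_real t * imag_axis y + of_real s) - imag_axis y / 4))"
      unfolding e .
    moreover have "theta1 (of_real t * imag_axis y + of_real s) (imag_axis y)
      = theta2 (of_real t * imag_axis y + of_real (s - 1 / 2)) (imag_axis y)"
      unfolding theta1_eq_theta2[OF Im_pos] by (simp add: algebra_simps)
    ultimately show ?case by (simp add: mult.assoc[symmetric])
  qed
  ultimately show ?thesis by (simp only:) (rule Lim_transform_eventually)
qed

text \<open>At the half period \<tau>/2, that is t = 1/2, the prefactor of
  \<open>theta2_cusp\<close> is exactly the inverse of the exponential linking \<open>theta2\<close>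
  there to the constant of \<open>theta3\<close>. The constant of \<open>theta4\<close> is obtained
  likewise from \<open>theta1\<close>.\<close>

lemma theta3_cusp: "((\<lambda>y. theta3 0 (imag_axis y)) \<longlongrightarrow> 1) at_top"
proof -
  have "\<forall>\<^sub>F y in at_top. exp (of_real pi * \<i> * ((of_real (1/2) * imag_axis y + of_real 0) - imag_axis y / 4))
            * theta2 (of_real (1/2) * imag_axis y + of_real 0) (imag_axis y) = theta3 0 (imag_axis y)"
    using eventually_gt_at_top[of 0]
  proof eventually_elim
    case (elim y)
    then have "Im (imag_axis y) > 0" by simp
    then show ?case
      using theta2_half_tau[of "imag_axis y"] by (simp add: mult.assoc[symmetric] exp_add[symmetric])
  qed
  from Lim_transform_eventually[OF theta2_cusp[of "1/2" 0] this] show ?thesis by simp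
qed

lemma theta4_cusp: "((\<lambda>y. theta4 0 (imag_axis y)) \<longlongrightarrow> 1) at_top"
proof -
  have "\<forall>\<^sub>F y in at_top. - \<i> * (exp (of_real pi * \<i> * ((of_real (1/2) * imag_axis y + of_real 0) - imag_axis y / 4))
            * theta1 (of_real (1/2) * imag_axis y + of_real 0) (imag_axis y)) = theta4 0 (imag_axis y)"
    using eventually_gt_at_top[of 0]
  proof eventually_elim
    case (elim y)
    then have "Im (imag_axis y) > 0" by simp
    note th = theta1_half_tau[OF this]
    have e: "exp (of_real pi * \<i> * ((of_real (1/2) * imag_axis y + of_real 0) - imag_axis y / 4)) * exp (- of_real pi * \<i> * imag_axis y / 4) = 1"
      unfolding exp_add[symmetric] by (simp add: field_simps)
    have "- \<i> * (E * (\<i> * E' * x)) = x" if "E * E' = 1" for E E' x :: complex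
      using that by (simp add: mult_ac)
    from this[OF e] th show ?case by simp
  qed
  from Lim_transform_eventually[OF tendsto_mult_left[OF theta1_cusp[of "1/2" 0], of "- \<i>"] this] show ?thesis by simp
qed

lemma theta2_0_cusp: "((\<lambda>y. theta2 0 (imag_axis y)) \<longlongrightarrow> 0) at_top"
proof -
  have "((\<lambda>y. of_real (exp (- (pi / 4 * y))) * (exp (of_real pi * \<i> * ((of_real 0 * imag_axis y + of_real 0) - imag_axis y / 4))
            * theta2 (of_real 0 * imag_axis y + of_real 0) (imag_axis y)))
          \<longlongrightarrow> of_real 0 * ((if (0 :: real) = 0 then exp (2 * of_real pi * \<i> * of_real 0) else 0) + 1)) at_top"
    by (intro tendsto_mult tendsto_of_real tendsto_exp_neg_at_top theta2_cusp) auto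
  moreover have "of_real (exp (- (pi / 4 * y))) * (exp (of_real pi * \<i> * ((of_real 0 * imag_axis y + of_real 0) - imag_axis y / 4))
            * theta2 (of_real 0 * imag_axis y + of_real 0) (imag_axis y)) = theta2 0 (imag_axis y)" for y
    unfolding exp_of_real[symmetric] mult.assoc[symmetric] exp_add[symmetric] by (simp add: field_simps)
  ultimately show ?thesis by (simp only:) simp
qed

lemma modular_lambda_cusp: "((\<lambda>y. modular_lambda (imag_axis y)) \<longlongrightarrow> 0) at_top"
proof -
  have "((\<lambda>y. modular_lambda (imag_axis y)) \<longlongrightarrow> ((0\<^sup>2) / (1\<^sup>2))\<^sup>2) at_top"
    unfolding modular_lambda_def elliptic_k_def
    by (intro tendsto_intros theta2_0_cusp theta3_cusp) simp
  then show ?thesis by simp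
qed

text \<open>The prefactors of the two theta limits cancel in the quotient, giving (L + 1) / (i (1 -
  L)) with L = exp(2 \<pi> i s) or L = 0. The first is Euler's formula for the cotangent, the second
  is -i; the excluded case L = 1 is that of a pole.\<close>

lemma cs_theta_cusp:
  fixes t s :: real
  assumes "0 \<le> t" "t < 1" "t \<noteq> 0 \<or> s \<notin> \<int>"
  shows "((\<lambda>y. cs_theta (imag_axis y) (of_real t * imag_axis y + of_real s))
          \<longlongrightarrow> (if t = 0 then of_real (cot (pi * s)) else - \<i>)) at_top"
proof -
  define L where "L = (if t = 0 then exp (2 * of_real pi * \<i> * of_real s) else 0)"
  have L1: "L \<noteq> 1"
  proof
    assume "L = 1"
    then have "t = 0" "exp (2 * of_real pi * \<i> * of_real s) = 1" by (auto simp: L_def split: if_splits)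
    then obtain n where "of_real s = (of_int n :: complex)" unfolding exp_2_pi_i_eq_1_iff by blast
    then have "s = of_int n" by (metis of_real_eq_iff of_real_of_int_eq)
    with assms(3) \<open>t = 0\<close> show False by simp
  qed
  let ?w = "\<lambda>y. of_real t * imag_axis y + of_real s"
  let ?E = "\<lambda>y. exp (of_real pi * \<i> * (?w y - imag_axis y / 4))"
  have "((\<lambda>y. theta4 0 (imag_axis y) / theta3 0 (imag_axis y) * ((?E y * theta2 (?w y) (imag_axis y)) / (?E y * theta1 (?w y) (imag_axis y))))
     \<longlongrightarrow> 1 / 1 * ((L + 1) / (\<i> * (1 - L)))) at_top"
    unfolding L_def
    by (rule tendsto_mult[OF tendsto_divide[OF theta4_cusp theta3_cusp]
          tendsto_divide[OF theta2_cusp[OF assms(1,2), of s] theta1_cusp[OF assms(1,2), of s]]])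
       (use L1 in \<open>simp_all add: L_def\<close>)
  then have "((\<lambda>y. cs_theta (imag_axis y) (?w y)) \<longlongrightarrow> (L + 1) / (\<i> * (1 - L))) at_top"
    unfolding cs_theta_def by simp
  moreover have "(L + 1) / (\<i> * (1 - L)) = (if t = 0 then of_real (cot (pi * s)) else - \<i>)"
  proof (cases "t = 0")
    case True
    let ?e = "exp (\<i> * of_real (pi * s))"
    have Le: "L = ?e * ?e" using True unfolding L_def exp_add[symmetric] by (simp add: mult_ac)
    have c: "of_real (cos (pi * s)) = (?e + inverse ?e) / 2" and si: "of_real (sin (pi * s)) = (?e - inverse ?e) / (2 * \<i>)"
      by (simp_all add: cos_of_real[symmetric] sin_of_real[symmetric] cos_exp_eq sin_exp_eq exp_minus)
    have "of_real (cot (pi * s)) = (?e + inverse ?e) / 2 / ((?e - inverse ?e) / (2 * \<i>))"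
      unfolding cot_def of_real_divide c si ..
    also have "\<dots> = \<i> * (?e + inverse ?e) / (?e - inverse ?e)"
    proof -
      have "P / 2 / (M / (2 * \<i>)) = \<i> * P / M" for P M :: complex
        by (cases "M = 0") (simp_all add: field_simps)
      then show ?thesis .
    qed
    also have "\<dots> = \<i> * ((?e + inverse ?e) * ?e) / ((?e - inverse ?e) * ?e)"
      by (simp only: mult.assoc[symmetric] nonzero_mult_divide_mult_cancel_right[OF exp_not_eq_zero])
    also have "\<dots> = \<i> * (L + 1) / (L - 1)" unfolding Le by (simp add: algebra_simps)
    also have "\<dots> = (L + 1) / (\<i> * (1 - L))" using L1 by (simp add: field_simps)
    finally show ?thesis using True by simp
  next
    case False
    then show ?thesis by (simp add: L_def)
  qed
  ultimately show ?thesis by simp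
qed

text \<open>The coefficient of \<tau> is reduced to its fractional part, each unit costing a sign.
  The floor in the Hardy--Berndt sum comes from here.\<close>

lemma cs_theta_cusp_floor:
  fixes t s :: real
  assumes "t \<notin> \<int> \<or> s \<notin> \<int>"
  shows "((\<lambda>y. cs_theta (imag_axis y) (of_real t * imag_axis y + of_real s))
          \<longlongrightarrow> (-1) powi \<lfloor>t\<rfloor> * (if t \<in> \<int> then of_real (cot (pi * s)) else - \<i>)) at_top"
proof -
  have f: "frac t = 0 \<longleftrightarrow> t \<in> \<int>" by (rule frac_eq_0_iff)
  have "((\<lambda>y. (-1) powi \<lfloor>t\<rfloor> * cs_theta (imag_axis y) (of_real (frac t) * imag_axis y + of_real s))
      \<longlongrightarrow> (-1) powi \<lfloor>t\<rfloor> * (if frac t = 0 then of_real (cot (pi * s)) else - \<i>)) at_top"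
    using assms by (intro tendsto_mult_left cs_theta_cusp) (auto simp: f frac_lt_1)
  moreover have "\<forall>\<^sub>F y in at_top. (-1) powi \<lfloor>t\<rfloor> * cs_theta (imag_axis y) (of_real (frac t) * imag_axis y + of_real s)
     = cs_theta (imag_axis y) (of_real t * imag_axis y + of_real s)"
    using eventually_gt_at_top[of 0]
  proof eventually_elim
    case (elim y)
    then have "Im (imag_axis y) > 0" by simp
    from cs_theta_add_period[OF this, of "of_real (frac t) * imag_axis y + of_real s" "\<lfloor>t\<rfloor>" 0]
    have "(-1) powi \<lfloor>t\<rfloor> * cs_theta (imag_axis y) (of_real (frac t) * imag_axis y + of_real s)
      = cs_theta (imag_axis y) (of_real (frac t) * imag_axis y + of_real s + (of_int \<lfloor>t\<rfloor> * imag_axis y + of_int 0))" by simp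
    also have "of_real (frac t) * imag_axis y + of_real s + (of_int \<lfloor>t\<rfloor> * imag_axis y + of_int 0) = of_real t * imag_axis y + of_real s"
      unfolding frac_def by (simp add: algebra_simps)
    finally show ?case .
  qed
  ultimately show ?thesis unfolding f by (rule Lim_transform_eventually)
qed

lemma not_int_quotient:
  fixes a b x :: int
  assumes "b > 0" "coprime a b" "0 < x" "x < b"
  shows "of_int a * of_int x / of_int b \<notin> (\<int> :: real set)"
proof
  assume "of_int a * of_int x / of_int b \<in> (\<int> :: real set)"
  then obtain k :: int where "of_int a * of_int x / of_int b = (of_int k :: real)" by (auto elim: Ints_cases)
  then have "of_int (a * x) = (of_int (k * b) :: real)" using assms(1) by (simp add: field_simps)
  then have "a * x = k * b" by (simp only: of_int_eq_iff)
  then have "b dvd x" using assms(2) by (metis coprime_commute coprime_dvd_mult_right_iff dvd_triv_right)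
  then show False using assms zdvd_not_zless by blast
qed

text \<open>For \<mu> > 0 the two factors -i multiply to -1, and the limit does not depend on \<nu>.
  Each such row thus contributes b equal signs, which reduces the prefactor 1/(4b) to 1/4.\<close>

lemma elliptic_dedekind_sum_cusp:
  fixes a b :: int
  assumes b: "b > 0" and cop: "coprime a b"
  shows "((\<lambda>y. elliptic_dedekind_sum (imag_axis y) a b)
           \<longlongrightarrow> of_real (dedekind_sum a b + 1 / 4 * hardy_berndt_sum a b)) at_top"
proof -
  let ?z = "\<lambda>y \<mu> \<nu>. (of_int \<mu> * imag_axis y + of_int \<nu>) / of_int b"
  let ?g = "\<lambda>y \<mu> \<nu>. (-1) powi \<mu> * cs_theta (imag_axis y) (of_int a * ?z y \<mu> \<nu>) * cs_theta (imag_axis y) (?z y \<mu> \<nu>)"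
  define l :: "int \<Rightarrow> int \<Rightarrow> real" where "l = (\<lambda>\<mu> \<nu>. if \<mu> = 0 then cot (pi * of_int a * of_int \<nu> / of_int b) * cot (pi * of_int \<nu> / of_int b)
      else (-1) powi (\<mu> + 1 + \<lfloor>of_int a * of_int \<mu> / (of_int b :: real)\<rfloor>))"
  have lim: "((\<lambda>y. ?g y \<mu> \<nu>) \<longlongrightarrow> of_real (l \<mu> \<nu>)) at_top" if "(\<mu>, \<nu>) \<in> division_indices b" for \<mu> \<nu>
  proof -
    have bd: "0 \<le> \<mu>" "\<mu> < b" "0 \<le> \<nu>" "\<nu> < b" "\<mu> \<noteq> 0 \<or> \<nu> \<noteq> 0"
      using that by (auto simp: division_indices_def)
    define t s t' s' :: real where "t = of_int a * of_int \<mu> / of_int b" and "s = of_int a * of_int \<nu> / of_int b"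
      and "t' = of_int \<mu> / of_int b" and "s' = of_int \<nu> / of_int b"
    have z: "of_int a * ?z y \<mu> \<nu> = of_real t * imag_axis y + of_real s" "?z y \<mu> \<nu> = of_real t' * imag_axis y + of_real s'" for y
      unfolding t_def s_def t'_def s'_def by (simp_all add: algebra_simps add_divide_distrib)
    have ints: "of_int n * of_int x / of_int b \<in> (\<int> :: real set) \<longleftrightarrow> x = 0" if "0 \<le> x" "x < b" "coprime n b" for n x :: int
      using not_int_quotient[OF b that(3), of x] that by (cases "x = 0") auto
    have ti: "t \<in> \<int> \<longleftrightarrow> \<mu> = 0" "s \<in> \<int> \<longleftrightarrow> \<nu> = 0" "t' \<in> \<int> \<longleftrightarrow> \<mu> = 0" "s' \<in> \<int> \<longleftrightarrow> \<nu> = 0"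
      unfolding t_def s_def t'_def s'_def using ints[of _ a] ints[of _ 1] bd cop by auto
    have fl: "\<lfloor>t'\<rfloor> = 0" unfolding t'_def using bd b by (simp add: floor_eq_iff)
    have "((\<lambda>y. ?g y \<mu> \<nu>) \<longlongrightarrow> (-1) powi \<mu> * ((-1) powi \<lfloor>t\<rfloor> * (if t \<in> \<int> then of_real (cot (pi * s)) else - \<i>))
       * ((-1) powi \<lfloor>t'\<rfloor> * (if t' \<in> \<int> then of_real (cot (pi * s')) else - \<i>))) at_top"
      unfolding z(1) unfolding z(2) using bd(5) by (intro tendsto_mult tendsto_const cs_theta_cusp_floor) (auto simp: ti)
    moreover have "(-1) powi \<mu> * ((-1) powi \<lfloor>t\<rfloor> * (if t \<in> \<int> then of_real (cot (pi * s)) else - \<i>))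
       * ((-1) powi \<lfloor>t'\<rfloor> * (if t' \<in> \<int> then of_real (cot (pi * s')) else - \<i>)) = of_real (l \<mu> \<nu>)"
    proof (cases "\<mu> = 0")
      case True
      then have "t = 0" "t' = 0" by (simp_all add: t_def t'_def)
      then show ?thesis using True by (simp add: l_def s_def s'_def mult.assoc)
    next
      case False
      then have "of_real (l \<mu> \<nu>) = (-1 :: complex) powi (\<mu> + 1 + \<lfloor>t\<rfloor>)" by (simp add: l_def t_def)
      then show ?thesis using False by (simp add: ti fl power_int_add algebra_simps)
    qed
    ultimately show ?thesis by simp
  qed
  have sum_l: "(\<Sum>(\<mu>, \<nu>) \<in> division_indices b. l \<mu> \<nu>)
     = (\<Sum>\<nu> = 1..b - 1. cot (pi * of_int a * of_int \<nu> / of_int b) * cot (pi * of_int \<nu> / of_int b)) + of_int b * hardy_berndt_sum a b"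
  proof -
    have D: "division_indices b = {0} \<times> {1..b - 1} \<union> {1..b - 1} \<times> {0..b - 1}"
      using b unfolding division_indices_def by auto
    have "(\<Sum>(\<mu>, \<nu>) \<in> division_indices b. l \<mu> \<nu>)
       = (\<Sum>(\<mu>, \<nu>) \<in> {0} \<times> {1..b - 1}. l \<mu> \<nu>) + (\<Sum>(\<mu>, \<nu>) \<in> {1..b - 1} \<times> {0..b - 1}. l \<mu> \<nu>)"
      unfolding D by (rule sum.union_disjoint) auto
    also have "(\<Sum>(\<mu>, \<nu>) \<in> {0} \<times> {1..b - 1}. l \<mu> \<nu>) = (\<Sum>\<nu> = 1..b - 1. l 0 \<nu>)"
      unfolding sum.cartesian_product[symmetric] by simp
    also have "(\<Sum>(\<mu>, \<nu>) \<in> {1..b - 1} \<times> {0..b - 1}. l \<mu> \<nu>)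
       = (\<Sum>\<mu> = 1..b - 1. of_int b * (-1) powi (\<mu> + 1 + \<lfloor>of_int a * of_int \<mu> / (of_int b :: real)\<rfloor>))"
      unfolding sum.cartesian_product[symmetric] using b by (intro sum.cong refl) (simp add: l_def)
    finally show ?thesis by (simp add: l_def hardy_berndt_sum_def sum_distrib_left)
  qed
  have "((\<lambda>y. 1 / (4 * of_int b) * (\<Sum>(\<mu>, \<nu>) \<in> division_indices b. ?g y \<mu> \<nu>))
      \<longlongrightarrow> 1 / (4 * of_int b) * (\<Sum>(\<mu>, \<nu>) \<in> division_indices b. of_real (l \<mu> \<nu>))) at_top"
    by (intro tendsto_mult_left tendsto_sum) (auto intro!: lim simp only: prod.case split: prod.split)
  moreover have "1 / (4 * of_int b) * (\<Sum>(\<mu>, \<nu>) \<in> division_indices b. of_real (l \<mu> \<nu>))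
     = complex_of_real (dedekind_sum a b + 1 / 4 * hardy_berndt_sum a b)"
  proof -
    have "1 / (4 * of_int b) * (\<Sum>(\<mu>, \<nu>) \<in> division_indices b. of_real (l \<mu> \<nu>))
       = complex_of_real (1 / (4 * of_int b) * (\<Sum>(\<mu>, \<nu>) \<in> division_indices b. l \<mu> \<nu>))"
      by (simp add: case_prod_unfold)
    also have "1 / (4 * of_int b) * (\<Sum>(\<mu>, \<nu>) \<in> division_indices b. l \<mu> \<nu>) = dedekind_sum a b + 1 / 4 * hardy_berndt_sum a b"
      unfolding sum_l dedekind_sum_def using b by (simp add: distrib_left)
    finally show ?thesis .
  qed
  moreover have "\<forall>\<^sub>F y in at_top. 1 / (4 * of_int b) * (\<Sum>(\<mu>, \<nu>) \<in> division_indices b. ?g y \<mu> \<nu>)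
       = elliptic_dedekind_sum (imag_axis y) a b"
    using eventually_gt_at_top[of 0]
  proof eventually_elim
    case (elim y)
    then have "Im (imag_axis y) > 0" by simp
    then show ?case unfolding division_indices_def by (simp only: elliptic_dedekind_sum_eq)
  qed
  ultimately show ?thesis by (simp only:) (rule Lim_transform_eventually)
qed

section \<open>The rational factor\<close>

text \<open>Induction on the denominator: the numerator is reduced to an m with 0 < m < b, and
  reciprocity replaces the pair (m;b) by (b;m), whose denominator is smaller. Coprimality and odd
  sum are preserved.\<close>

lemma elliptic_dedekind_sum_rational_multiple:
  fixes a b :: int
  assumes "b > 0" "coprime a b" "odd (a + b)"
  shows "\<exists>r :: rat. \<forall>\<tau>. Im \<tau> > 0 \<longrightarrow> elliptic_dedekind_sum \<tau> a b = of_rat r * (1 / 3 - 1 / 6 * modular_lambda \<tau>)"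
  using assms
proof (induction "nat b" arbitrary: a b rule: less_induct)
  case (less b a)
  show ?case
  proof (cases "b = 1")
    case True
    then show ?thesis by (intro exI[of _ 0]) (simp add: elliptic_dedekind_sum_denominator_1)
  next
    case False
    with less.prems(1) have b: "b > 1" by simp
    \<comment> \<open>Chosen so that a' + b is the remainder of a + b modulo 2b, which places a'
      between -b and b - 1, the symmetric range suited to the oddness in a.\<close>
    define k where "k = (a + b) div (2 * b)"
    define a' where "a' = a - 2 * b * k"
    have a: "a = a' + 2 * b * k" by (simp add: a'_def)
    have "a' + b = (a + b) mod (2 * b)" unfolding a'_def k_def by (simp add: minus_mult_div_eq_mod[symmetric])
    with b have bd: "- b \<le> a'" "a' < b" 
      using pos_mod_sign[of "2 * b" "a + b"] pos_mod_bound[of "2 * b" "a + b"] by linarith+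
    have cop: "coprime a' b"
    proof -
      have "gcd a b = gcd a' b" unfolding a using gcd_add_mult[of b "2 * k" a'] by (simp add: gcd.commute add.commute mult_ac)
      with less.prems(2) show ?thesis by (simp add: coprime_iff_gcd_eq_1)
    qed
    have par: "odd (a' + b)" using less.prems(3) unfolding a by simp
    \<comment> \<open>Both values would share the factor b > 1 with the denominator; their exclusion
      gives 0 < m < b.\<close>
    have "a' \<noteq> 0" "a' \<noteq> - b" using cop b by auto
    define m where "m = \<bar>a'\<bar>"
    have m: "0 < m" "m < b" "coprime m b" "odd (m + b)"
      using bd \<open>a' \<noteq> 0\<close> \<open>a' \<noteq> - b\<close> cop par by (auto simp: m_def abs_if)
    have "coprime b m" "odd (b + m)" using m by (simp_all add: coprime_commute add.commute)
    from less.hyps[OF _ m(1) this] m(2) b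
    obtain r where r: "\<And>\<tau>. Im \<tau> > 0 \<Longrightarrow> elliptic_dedekind_sum \<tau> b m = of_rat r * (1 / 3 - 1 / 6 * modular_lambda \<tau>)"
      by auto
    define r' where "r' = of_int (1 + m\<^sup>2 + b\<^sup>2) / of_int (4 * m * b) - r"
    have r': "elliptic_dedekind_sum \<tau> m b = of_rat r' * (1 / 3 - 1 / 6 * modular_lambda \<tau>)" if "Im \<tau> > 0" for \<tau>
    proof -
      have "elliptic_dedekind_sum \<tau> m b = (1 / 3 - 1 / 6 * modular_lambda \<tau>) * of_int (1 + m\<^sup>2 + b\<^sup>2) / of_int (4 * m * b)
          - of_rat r * (1 / 3 - 1 / 6 * modular_lambda \<tau>)"
        using elliptic_dedekind_sum_reciprocity[OF that m(1) less.prems(1) m(3,4)] r[OF that] by (simp add: eq_diff_eq)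
      also have "\<dots> = of_rat r' * (1 / 3 - 1 / 6 * modular_lambda \<tau>)"
      proof -
        have "E * A / B - R * E = (A / B - R) * E" for E A B R :: complex by (simp add: left_diff_distrib)
        then show ?thesis unfolding r'_def of_rat_diff of_rat_divide of_rat_of_int_eq .
      qed
      finally show ?thesis .
    qed
    have "elliptic_dedekind_sum \<tau> a b = of_rat (if a' > 0 then r' else - r') * (1 / 3 - 1 / 6 * modular_lambda \<tau>)"
      if "Im \<tau> > 0" for \<tau>
    proof -
      have "elliptic_dedekind_sum \<tau> a b = elliptic_dedekind_sum \<tau> a' b"
        unfolding a by (rule elliptic_dedekind_sum_add[OF that less.prems(1)])
      also have "\<dots> = (if a' > 0 then 1 else - 1) * elliptic_dedekind_sum \<tau> m b"
        using elliptic_dedekind_sum_minus[OF that, of m b] by (auto simp: m_def)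
      finally show ?thesis unfolding r'[OF that] by (simp add: of_rat_minus)
    qed
    then show ?thesis by blast
  qed
qed

text \<open>The description defining \<open>dedekind_Q\<close> denotes because the factor is also
  unique: 1/3 - \<lambda>/6 tends to 1/3 along the imaginary axis, so it is nonzero at some \<tau>,
  where it can be cancelled.\<close>

lemma elliptic_dedekind_sum_eq_dedekind_Q:
  fixes a b :: int
  assumes "b > 0" "coprime a b" "odd (a + b)" "Im \<tau> > 0"
  shows "elliptic_dedekind_sum \<tau> a b = of_rat (dedekind_Q a b) * (1 / 3 - 1 / 6 * modular_lambda \<tau>)"
proof -
  let ?P = "\<lambda>r :: rat. \<forall>\<tau>. Im \<tau> > 0 \<longrightarrow> elliptic_dedekind_sum \<tau> a b = of_rat r * (1 / 3 - 1 / 6 * modular_lambda \<tau>)"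
  obtain r where r: "?P r" using elliptic_dedekind_sum_rational_multiple[OF assms(1-3)] by blast
  have "((\<lambda>y. 1 / 3 - 1 / 6 * modular_lambda (imag_axis y)) \<longlongrightarrow> 1 / 3 - 1 / 6 * 0) at_top"
    by (intro tendsto_intros modular_lambda_cusp)
  then have "\<forall>\<^sub>F y in at_top. 1 / 3 - 1 / 6 * modular_lambda (imag_axis y) \<noteq> 0"
    by (rule tendsto_imp_eventually_ne) simp
  then have "\<forall>\<^sub>F y in at_top. y > 0 \<and> 1 / 3 - 1 / 6 * modular_lambda (imag_axis y) \<noteq> 0"
    using eventually_gt_at_top[of 0] by eventually_elim simp
  then obtain y where "y > 0" and ne: "1 / 3 - 1 / 6 * modular_lambda (imag_axis y) \<noteq> 0"
    using eventually_happens'[OF trivial_limit_at_top_linorder] by blast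
  then have y: "Im (imag_axis y) > 0" by simp
  have "r' = r" if "?P r'" for r'
  proof -
    have "of_rat r' * (1 / 3 - 1 / 6 * modular_lambda (imag_axis y)) = of_rat r * (1 / 3 - 1 / 6 * modular_lambda (imag_axis y))"
      using r that y by metis
    then have "(of_rat r' :: complex) = of_rat r" using ne by (metis mult_cancel_right)
    then show ?thesis by simp
  qed
  then have "dedekind_Q a b = r" unfolding dedekind_Q_def using r by (intro the_equality)
  with r assms(4) show ?thesis by blast
qed

lemma of_real_of_rat: "of_real (of_rat r) = (of_rat r :: 'a :: real_field)"
  by (cases r) (simp add: of_rat_rat)

theorem theorem6:
  fixes a b :: int
  assumes "(a, b) \<in> U_odd"
  shows "of_rat (dedekind_Q a b) = 3 * (dedekind_sum a b + 1/4 * hardy_berndt_sum a b)"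
proof -
  have ab: "b > 0" "coprime a b" "odd (a + b)"
    using assms by (auto simp: U_odd_def coprime_iff_gcd_eq_1)
  have "((\<lambda>y. of_rat (dedekind_Q a b) * (1 / 3 - 1 / 6 * modular_lambda (imag_axis y)))
      \<longlongrightarrow> of_rat (dedekind_Q a b) * (1 / 3 - 1 / 6 * 0)) at_top"
    by (intro tendsto_intros modular_lambda_cusp)
  moreover have "\<forall>\<^sub>F y in at_top. of_rat (dedekind_Q a b) * (1 / 3 - 1 / 6 * modular_lambda (imag_axis y))
      = elliptic_dedekind_sum (imag_axis y) a b"
    using eventually_gt_at_top[of 0] by eventually_elim (simp add: elliptic_dedekind_sum_eq_dedekind_Q[OF ab])
  ultimately have "((\<lambda>y. elliptic_dedekind_sum (imag_axis y) a b) \<longlongrightarrow> of_rat (dedekind_Q a b) * (1 / 3 - 1 / 6 * 0)) at_top"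
    by (rule Lim_transform_eventually)
  \<comment> \<open>The limit of the sum is one third of Q on one side and s + S/4 on the other,
    which accounts for the factor 3.\<close>
  from tendsto_unique[OF trivial_limit_at_top_linorder this elliptic_dedekind_sum_cusp[OF ab(1,2)]]
  have "complex_of_real (of_rat (dedekind_Q a b)) = of_real (3 * (dedekind_sum a b + 1/4 * hardy_berndt_sum a b))"
    unfolding of_real_of_rat by (simp add: field_simps)
  then show ?thesis by (simp only: of_real_eq_iff)
qed

end
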